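(* Let $n\ge2$ and let $\Phi\subset\mathbb{R}^{n+1}$ be a hypersurface of positive Gaussian curvature. Then $\Phi$ is a hyperquadric if and only if there exists a relative normalization $\bar y$ of $\Phi$ for which one of the following equivalent properties holds true: (a) $3(S-H)+(n-1)J=0$, (b) $3n\|\bar T\|_G=(n-1)(n+2)J$, (c) $n\|\bar T\|_G=(n+2)(H-S)$. Here $H$, $J$, $S$, $\bar T$, $\|\bar T\|_G$ are the mean relative curvature, the Pick-invariant, the scalar curvature of the relative metric, the Tchebychev-vector and its relative norm for the normalization $\bar y$.
   Context: Let $n\ge2$. A hypersurface $\Phi=(M,\bar x)$ in $\mathbb{R}^{n+1}$ consists of an oriented connected $n$-dimensional $C^r$-manifold $M$ ($r\ge 3$) and a $C^r$-immersion $\bar x:M\to\mathbb{R}^{n+1}$ whose Gaussian curvature $K_I$ never vanishes. Let $u^1,\dots,u^n$ be local coordinates and write $f_{/i}=\partial f/\partial u^i$, etc. Let $\bar\xi$ be the Euclidean unit normal field, $h_{ij}=\langle\bar\xi,\bar x_{/ij}\rangle$ the components of the second fundamental form $II$, and $K_I=\det(h_{ij})/\det(\langle \bar x_{/i},\bar x_{/j}\rangle)$. A $C^s$-map $\bar y:M\to\mathbb{R}^{n+1}$ ($r>s\ge1$) is a relative normalization of $\Phi$ if at every point of $M$ the vectors $\bar x_{/1},\dots,\bar x_{/n},\bar y$ are linearly independent and every $\bar y_{/i}$ lies in the span of $\bar x_{/1},\dots,\bar x_{/n}$. The support function of $\bar y$ is $q=\langle\bar\xi,\bar y\rangle$; it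 never vanishes, and orientations are chosen so that $q>0$. The covector $\bar X$ is defined by $\langle\bar X,\bar x_{/i}\rangle=0$ for all $i$ and $\langle\bar X,\bar y\rangle=1$, so $\bar X=q^{-1}\bar\xi$. The relative metric is $G_{ij}=\langle\bar X,\bar x_{/ij}\rangle=q^{-1}h_{ij}$ (Riemannian or pseudo-Riemannian); indices are raised and lowered with $G$, and $\nabla^G$ is its covariant derivative. The Darboux tensor is $A_{jkl}=\langle\bar X,\nabla^G_l\nabla^G_k\bar x_{/j}\rangle$. The Tchebychev-vector is $\bar T=T^m\bar x_{/m}$ with $T^m=\frac1nA_i^{im}$, and its relative norm is $\|\bar T\|_G:=G_{ij}T^iT^j$ (no square root). The Pick-invariant is $J=\frac1{n(n-1)}A_{jkl}A^{jkl}$. The relative shape operator $B_i^j$ is defined by $\bar y_{/i}=-B_i^j\bar x_{/j}$, and the mean relative curvature is $H=\frac1n\operatorname{tr}(B_i^j)$. $S$ is the (normalized) scalar curvature of $G$: $S=\frac{1}{n(n-1)}G^{ij}R_{ij}$ with $R_{ij}$ the Ricci tensor of $G$ (sign convention giving $+1$ for the round unit sphere; for $n=2$ it is the Gaussian curvature of $G$); with this normalization $H+J-S=\frac{n}{n-1}\|\bar T\|_G$. The properties (a)–(c) are understood as identities on $M$. "$\Phi$ is a hyperquadric" means that $\bar x(M)$ is contained in a hyperquadric of $\mathbb{R}^{n+1}$.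
   Formalization: Positive Gaussian curvature is supplemented by definiteness of II (automatic for n=2; for n≥3 the claim fails without it, e.g. the graph of u1u2+u1^3-u3^2), and only relative normalizations whose relative metric is C^2, so that the invariants exist, are considered. *)

theory Defs
  imports "HOL-Analysis.Analysis"
begin

section \<open>Partial derivatives and maps of class C^k\<close>

definition pd :: "'n::finite \<Rightarrow> (real^'n \<Rightarrow> 'b::real_normed_vector) \<Rightarrow> real^'n \<Rightarrow> 'b" where
  "pd i f u = frechet_derivative f (at u) (axis i 1)"

text \<open>Only used for open \<open>U\<close>.\<close>

primrec Ck_on :: "nat \<Rightarrow> (real^'n::finite \<Rightarrow> 'b::real_normed_vector) \<Rightarrow> (real^'n) set \<Rightarrow> bool" where
  "Ck_on 0 f U \<longleftrightarrow> continuous_on U f"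
| "Ck_on (Suc k) f U \<longleftrightarrow> (\<forall>u\<in>U. f differentiable (at u)) \<and> (\<forall>i. Ck_on k (pd i f) U)"

section \<open>Oriented manifolds\<close>

text \<open>
  An atlas is given by its local parametrizations (inverse charts) \<open>(D, \<phi>)\<close>, with
  \<open>D\<close> open in \<open>real^'n\<close> and \<open>\<phi>\<close> a homeomorphism of \<open>D\<close> onto an open set. The atlas
  need not be maximal: everything below is invariant under orientation preserving
  changes of coordinates of class C^r, r \<open>\<ge>\<close> 3.
\<close>

type_synonym ('n, 'm) param = "(real^'n) set \<times> (real^'n \<Rightarrow> 'm)"

definition local_param :: "('n::finite, 'm::topological_space) param \<Rightarrow> bool" where
  "local_param c \<longleftrightarrow> (case c of (D, \<phi>) \<Rightarrow>
     open D \<and> open (\<phi> ` D) \<and> (\<exists>\<psi>. homeomorphism D (\<phi> ` D) \<phi> \<psi>))"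

definition compatible_params ::
    "nat \<Rightarrow> ('n::finite, 'm::topological_space) param \<Rightarrow> ('n, 'm) param \<Rightarrow> bool" where
  "compatible_params r c c' \<longleftrightarrow> (case c of (D, \<phi>) \<Rightarrow> case c' of (E, \<psi>) \<Rightarrow>
     let W = D \<inter> \<phi> -` (\<psi> ` E); \<tau> = inv_into E \<psi> \<circ> \<phi> in
       Ck_on r \<tau> W \<and> (\<forall>u\<in>W. det (matrix (frechet_derivative \<tau> (at u))) > 0))"

definition oriented_manifold ::
    "nat \<Rightarrow> 'm::{t2_space, second_countable_topology} set \<Rightarrow> ('n::finite, 'm) param set \<Rightarrow> bool" where
  "oriented_manifold r M \<A> \<longleftrightarrow>
     (\<forall>c\<in>\<A>. local_param c) \<and>
     (\<forall>c\<in>\<A>. \<forall>c'\<in>\<A>. compatible_params r c c') \<and>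
     M = (\<Union>(D, \<phi>)\<in>\<A>. \<phi> ` D)"

definition Ck_map ::
    "nat \<Rightarrow> ('n::finite, 'm) param set \<Rightarrow> ('m \<Rightarrow> 'b::real_normed_vector) \<Rightarrow> bool" where
  "Ck_map k \<A> f \<longleftrightarrow> (\<forall>(D, \<phi>)\<in>\<A>. Ck_on k (f \<circ> \<phi>) D)"

section \<open>Hypersurfaces\<close>

text \<open>
  From here on \<open>'b\<close> plays the role of the Euclidean space of dimension n+1, where
  n = \<open>CARD('n)\<close>. Objects in local coordinates take the coordinate expressions
  \<open>x\<close>, \<open>y\<close> (and \<open>\<xi>\<close>) of the maps on \<open>M\<close>, i.e. functions of \<open>u\<close>.
\<close>

definition fund1 :: "(real^'n::finite \<Rightarrow> 'b::euclidean_space) \<Rightarrow> real^'n \<Rightarrow> real^'n^'n" where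
  "fund1 x u = (\<chi> i j. pd i x u \<bullet> pd j x u)"

definition fund2 ::
    "(real^'n::finite \<Rightarrow> 'b::euclidean_space) \<Rightarrow> (real^'n \<Rightarrow> 'b) \<Rightarrow> real^'n \<Rightarrow> real^'n^'n" where
  "fund2 x \<xi> u = (\<chi> i j. \<xi> u \<bullet> pd j (pd i x) u)"

definition gauss_curvature ::
    "(real^'n::finite \<Rightarrow> 'b::euclidean_space) \<Rightarrow> (real^'n \<Rightarrow> 'b) \<Rightarrow> real^'n \<Rightarrow> real" where
  "gauss_curvature x \<xi> u = det (fund2 x \<xi> u) / det (fund1 x u)"

text \<open>
  The choice of the unit normal field \<open>\<xi>\<close> (one of the two that exist, \<open>M\<close> being
  connected and orientable) is part of the data.
\<close>

definition unit_normal_field ::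
    "'m::topological_space set \<Rightarrow> ('n::finite, 'm) param set \<Rightarrow> ('m \<Rightarrow> 'b::euclidean_space)
       \<Rightarrow> ('m \<Rightarrow> 'b) \<Rightarrow> bool" where
  "unit_normal_field M \<A> x \<xi> \<longleftrightarrow>
     continuous_on M \<xi> \<and> (\<forall>p\<in>M. norm (\<xi> p) = 1) \<and>
     (\<forall>(D, \<phi>)\<in>\<A>. \<forall>u\<in>D. \<forall>i. (\<xi> \<circ> \<phi>) u \<bullet> pd i (x \<circ> \<phi>) u = 0)"

definition immersion :: "nat \<Rightarrow> ('n::finite, 'm) param set \<Rightarrow> ('m \<Rightarrow> 'b::euclidean_space) \<Rightarrow> bool" where
  "immersion r \<A> x \<longleftrightarrow> Ck_map r \<A> x \<and>
     (\<forall>(D, \<phi>)\<in>\<A>. \<forall>u\<in>D. inj (frechet_derivative (x \<circ> \<phi>) (at u)))"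

definition hypersurface ::
    "nat \<Rightarrow> 'm::{t2_space, second_countable_topology} set \<Rightarrow> ('n::finite, 'm) param set
       \<Rightarrow> ('m \<Rightarrow> 'b::euclidean_space) \<Rightarrow> ('m \<Rightarrow> 'b) \<Rightarrow> bool" where
  "hypersurface r M \<A> x \<xi> \<longleftrightarrow>
     oriented_manifold r M \<A> \<and> connected M \<and> immersion r \<A> x \<and> unit_normal_field M \<A> x \<xi> \<and>
     (\<forall>(D, \<phi>)\<in>\<A>. \<forall>u\<in>D. gauss_curvature (x \<circ> \<phi>) (\<xi> \<circ> \<phi>) u \<noteq> 0)"

definition positive_gauss_curvature ::
    "('n::finite, 'm) param set \<Rightarrow> ('m \<Rightarrow> 'b::euclidean_space) \<Rightarrow> ('m \<Rightarrow> 'b) \<Rightarrow> bool" where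
  "positive_gauss_curvature \<A> x \<xi> \<longleftrightarrow>
     (\<forall>(D, \<phi>)\<in>\<A>. \<forall>u\<in>D. gauss_curvature (x \<circ> \<phi>) (\<xi> \<circ> \<phi>) u > 0)"

text \<open>
  For n = 2, \<open>gauss_curvature > 0\<close> forces the second fundamental form to be definite.
  For n \<open>\<ge>\<close> 3 it does not, and definiteness has to be required separately: on the graph of
  \<open>f = u1 u2 + u1^3 + e3 u3^2 + \<dots> + en un^2\<close>, where each \<open>ei\<close> is 1 or -1 and their
  product is -1 (so that the Hessian determinant, hence the curvature, is positive),
  the constant field \<open>y = (0, \<dots>, 0, 1)\<close> is a relative normalization
  with \<open>H = J = S = 0\<close> and vanishing Tchebychev vector, since the Darboux tensor has the only
  component \<open>-3\<close> in the direction \<open>du1^3\<close>, which is isotropic for the Hessian metric.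
  The graph is however not contained in a hyperquadric.
\<close>

definition definite_form :: "real^'n^'n::finite \<Rightarrow> bool" where
  "definite_form h \<longleftrightarrow>
     (\<forall>v. v \<noteq> 0 \<longrightarrow> v \<bullet> (h *v v) > 0) \<or> (\<forall>v. v \<noteq> 0 \<longrightarrow> v \<bullet> (h *v v) < 0)"

definition definite_fund2 ::
    "('n::finite, 'm) param set \<Rightarrow> ('m \<Rightarrow> 'b::euclidean_space) \<Rightarrow> ('m \<Rightarrow> 'b) \<Rightarrow> bool" where
  "definite_fund2 \<A> x \<xi> \<longleftrightarrow>
     (\<forall>(D, \<phi>)\<in>\<A>. \<forall>u\<in>D. definite_form (fund2 (x \<circ> \<phi>) (\<xi> \<circ> \<phi>) u))"

definition hyperquadric :: "'b::euclidean_space set \<Rightarrow> bool" where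
  "hyperquadric Q \<longleftrightarrow>
     (\<exists>L b c. linear L \<and> (\<forall>v w. L v \<bullet> w = v \<bullet> L w) \<and> L \<noteq> (\<lambda>v. 0) \<and>
        Q = {z. z \<bullet> L z + 2 * (b \<bullet> z) + c = 0})"

section \<open>Intrinsic geometry of a (pseudo-)Riemannian metric in coordinates\<close>

definition christoffel ::
    "(real^'n::finite \<Rightarrow> real^'n^'n) \<Rightarrow> 'n \<Rightarrow> 'n \<Rightarrow> 'n \<Rightarrow> real^'n \<Rightarrow> real" where
  "christoffel G k i j u = (1/2) * (\<Sum>m\<in>UNIV. matrix_inv (G u) $ k $ m *
     (pd i (\<lambda>v. G v $ j $ m) u + pd j (\<lambda>v. G v $ i $ m) u - pd m (\<lambda>v. G v $ i $ j) u))"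

text \<open>Sign convention: the round unit sphere has \<open>ricci = (n - 1) G\<close>.\<close>

definition ricci :: "(real^'n::finite \<Rightarrow> real^'n^'n) \<Rightarrow> 'n \<Rightarrow> 'n \<Rightarrow> real^'n \<Rightarrow> real" where
  "ricci G j k u =
     (\<Sum>i\<in>UNIV. pd i (christoffel G i j k) u) - (\<Sum>i\<in>UNIV. pd j (christoffel G i k i) u)
     + (\<Sum>i\<in>UNIV. \<Sum>p\<in>UNIV. christoffel G i i p u * christoffel G p j k u)
     - (\<Sum>i\<in>UNIV. \<Sum>p\<in>UNIV. christoffel G i j p u * christoffel G p i k u)"

definition scalar_curvature :: "(real^'n::finite \<Rightarrow> real^'n^'n) \<Rightarrow> real^'n \<Rightarrow> real" where
  "scalar_curvature G u = 1 / (real CARD('n) * (real CARD('n) - 1)) *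
     (\<Sum>i\<in>UNIV. \<Sum>j\<in>UNIV. matrix_inv (G u) $ i $ j * ricci G i j u)"

section \<open>Relative geometry in coordinates\<close>

definition conormal ::
    "(real^'n::finite \<Rightarrow> 'b::euclidean_space) \<Rightarrow> (real^'n \<Rightarrow> 'b) \<Rightarrow> real^'n \<Rightarrow> 'b" where
  "conormal x y u = (THE X. (\<forall>i. X \<bullet> pd i x u = 0) \<and> X \<bullet> y u = 1)"

definition rel_metric ::
    "(real^'n::finite \<Rightarrow> 'b::euclidean_space) \<Rightarrow> (real^'n \<Rightarrow> 'b) \<Rightarrow> real^'n \<Rightarrow> real^'n^'n" where
  "rel_metric x y u = (\<chi> i j. conormal x y u \<bullet> pd j (pd i x) u)"

text \<open>
  \<open>cov_dx G x j k\<close> is the component \<open>\<nabla>_k x_j\<close>, and \<open>cov2_dx G x j k l\<close> the component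
  \<open>\<nabla>_l \<nabla>_k x_j\<close>, of the covariant derivatives of the (vector valued) 1-form \<open>dx\<close>.
\<close>

definition cov_dx ::
    "(real^'n::finite \<Rightarrow> real^'n^'n) \<Rightarrow> (real^'n \<Rightarrow> 'b::euclidean_space)
       \<Rightarrow> 'n \<Rightarrow> 'n \<Rightarrow> real^'n \<Rightarrow> 'b" where
  "cov_dx G x j k u = pd k (pd j x) u - (\<Sum>m\<in>UNIV. christoffel G m k j u *\<^sub>R pd m x u)"

definition cov2_dx ::
    "(real^'n::finite \<Rightarrow> real^'n^'n) \<Rightarrow> (real^'n \<Rightarrow> 'b::euclidean_space)
       \<Rightarrow> 'n \<Rightarrow> 'n \<Rightarrow> 'n \<Rightarrow> real^'n \<Rightarrow> 'b" where
  "cov2_dx G x j k l u = pd l (cov_dx G x j k) u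
     - (\<Sum>m\<in>UNIV. christoffel G m l j u *\<^sub>R cov_dx G x m k u)
     - (\<Sum>m\<in>UNIV. christoffel G m l k u *\<^sub>R cov_dx G x j m u)"

definition darboux ::
    "(real^'n::finite \<Rightarrow> 'b::euclidean_space) \<Rightarrow> (real^'n \<Rightarrow> 'b)
       \<Rightarrow> 'n \<Rightarrow> 'n \<Rightarrow> 'n \<Rightarrow> real^'n \<Rightarrow> real" where
  "darboux x y j k l u = conormal x y u \<bullet> cov2_dx (rel_metric x y) x j k l u"

text \<open>The components \<open>T^m = 1/n A_i^{im}\<close>.\<close>

definition tchebychev ::
    "(real^'n::finite \<Rightarrow> 'b::euclidean_space) \<Rightarrow> (real^'n \<Rightarrow> 'b) \<Rightarrow> real^'n \<Rightarrow> real^'n" where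
  "tchebychev x y u = (\<chi> m. 1 / real CARD('n) *
     (\<Sum>i\<in>UNIV. \<Sum>j\<in>UNIV. \<Sum>k\<in>UNIV.
        matrix_inv (rel_metric x y u) $ i $ j * matrix_inv (rel_metric x y u) $ m $ k *
        darboux x y i j k u))"

text \<open>By convention there is no square root.\<close>

definition tchebychev_norm ::
    "(real^'n::finite \<Rightarrow> 'b::euclidean_space) \<Rightarrow> (real^'n \<Rightarrow> 'b) \<Rightarrow> real^'n \<Rightarrow> real" where
  "tchebychev_norm x y u = (\<Sum>i\<in>UNIV. \<Sum>j\<in>UNIV.
     rel_metric x y u $ i $ j * tchebychev x y u $ i * tchebychev x y u $ j)"

definition pick ::
    "(real^'n::finite \<Rightarrow> 'b::euclidean_space) \<Rightarrow> (real^'n \<Rightarrow> 'b) \<Rightarrow> real^'n \<Rightarrow> real" where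
  "pick x y u = 1 / (real CARD('n) * (real CARD('n) - 1)) *
     (\<Sum>j\<in>UNIV. \<Sum>k\<in>UNIV. \<Sum>l\<in>UNIV. \<Sum>j'\<in>UNIV. \<Sum>k'\<in>UNIV. \<Sum>l'\<in>UNIV.
        matrix_inv (rel_metric x y u) $ j $ j' * matrix_inv (rel_metric x y u) $ k $ k' *
        matrix_inv (rel_metric x y u) $ l $ l' * darboux x y j k l u * darboux x y j' k' l' u)"

text \<open>The entry \<open>$ i $ j\<close> is \<open>B_i^j\<close>.\<close>

definition shape_operator ::
    "(real^'n::finite \<Rightarrow> 'b::euclidean_space) \<Rightarrow> (real^'n \<Rightarrow> 'b) \<Rightarrow> real^'n \<Rightarrow> real^'n^'n" where
  "shape_operator x y u =
     (THE B. \<forall>i. pd i y u = - (\<Sum>j\<in>UNIV. B $ i $ j *\<^sub>R pd j x u))"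

definition mean_curvature ::
    "(real^'n::finite \<Rightarrow> 'b::euclidean_space) \<Rightarrow> (real^'n \<Rightarrow> 'b) \<Rightarrow> real^'n \<Rightarrow> real" where
  "mean_curvature x y u = 1 / real CARD('n) * trace (shape_operator x y u)"

section \<open>Relative normalizations\<close>

definition relative_normalization ::
    "nat \<Rightarrow> ('n::finite, 'm) param set \<Rightarrow> ('m \<Rightarrow> 'b::euclidean_space) \<Rightarrow> ('m \<Rightarrow> 'b) \<Rightarrow> bool" where
  "relative_normalization s \<A> x y \<longleftrightarrow> Ck_map s \<A> y \<and>
     (\<forall>(D, \<phi>)\<in>\<A>. \<forall>u\<in>D.
        (\<forall>a b. (\<Sum>i\<in>UNIV. a i *\<^sub>R pd i (x \<circ> \<phi>) u) + b *\<^sub>R (y \<circ> \<phi>) u = 0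
               \<longrightarrow> (\<forall>i. a i = 0) \<and> b = 0) \<and>
        (\<forall>i. pd i (y \<circ> \<phi>) u \<in> span (range (\<lambda>j. pd j (x \<circ> \<phi>) u))))"

definition positive_support ::
    "'m set \<Rightarrow> ('m \<Rightarrow> 'b::euclidean_space) \<Rightarrow> ('m \<Rightarrow> 'b) \<Rightarrow> bool" where
  "positive_support M \<xi> y \<longleftrightarrow> (\<forall>p\<in>M. \<xi> p \<bullet> y p > 0)"

text \<open>
  The Darboux tensor and the curvature of the relative metric involve first derivatives of
  the Christoffel symbols, so they exist classically only for a relative metric of class C^2.
  For \<open>x\<close> of class C^r and \<open>y\<close> of class C^s this is automatic if r \<open>\<ge>\<close> 4 and s \<open>\<ge>\<close> 2;
  in the remaining cases r = 3 or s = 1 it is the requirement that the invariants exist.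
\<close>

definition C2_rel_metric ::
    "('n::finite, 'm) param set \<Rightarrow> ('m \<Rightarrow> 'b::euclidean_space) \<Rightarrow> ('m \<Rightarrow> 'b) \<Rightarrow> bool" where
  "C2_rel_metric \<A> x y \<longleftrightarrow> (\<forall>(D, \<phi>)\<in>\<A>. Ck_on 2 (rel_metric (x \<circ> \<phi>) (y \<circ> \<phi>)) D)"

definition normalization_of ::
    "nat \<Rightarrow> 'm set \<Rightarrow> ('n::finite, 'm) param set \<Rightarrow> ('m \<Rightarrow> 'b::euclidean_space) \<Rightarrow> ('m \<Rightarrow> 'b)
       \<Rightarrow> ('m \<Rightarrow> 'b) \<Rightarrow> bool" where
  "normalization_of s M \<A> x \<xi> y \<longleftrightarrow>
     relative_normalization s \<A> x y \<and> positive_support M \<xi> y \<and> C2_rel_metric \<A> x y"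

definition property_a ::
    "('n::finite, 'm) param set \<Rightarrow> ('m \<Rightarrow> 'b::euclidean_space) \<Rightarrow> ('m \<Rightarrow> 'b) \<Rightarrow> bool" where
  "property_a \<A> x y \<longleftrightarrow> (\<forall>(D, \<phi>)\<in>\<A>. \<forall>u\<in>D.
     (let S = scalar_curvature (rel_metric (x \<circ> \<phi>) (y \<circ> \<phi>)) u;
          H = mean_curvature (x \<circ> \<phi>) (y \<circ> \<phi>) u;
          J = pick (x \<circ> \<phi>) (y \<circ> \<phi>) u;
          n = real CARD('n)
      in 3 * (S - H) + (n - 1) * J = 0))"

definition property_b ::
    "('n::finite, 'm) param set \<Rightarrow> ('m \<Rightarrow> 'b::euclidean_space) \<Rightarrow> ('m \<Rightarrow> 'b) \<Rightarrow> bool" where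
  "property_b \<A> x y \<longleftrightarrow> (\<forall>(D, \<phi>)\<in>\<A>. \<forall>u\<in>D.
     (let T = tchebychev_norm (x \<circ> \<phi>) (y \<circ> \<phi>) u;
          J = pick (x \<circ> \<phi>) (y \<circ> \<phi>) u;
          n = real CARD('n)
      in 3 * n * T = (n - 1) * (n + 2) * J))"

definition property_c ::
    "('n::finite, 'm) param set \<Rightarrow> ('m \<Rightarrow> 'b::euclidean_space) \<Rightarrow> ('m \<Rightarrow> 'b) \<Rightarrow> bool" where
  "property_c \<A> x y \<longleftrightarrow> (\<forall>(D, \<phi>)\<in>\<A>. \<forall>u\<in>D.
     (let S = scalar_curvature (rel_metric (x \<circ> \<phi>) (y \<circ> \<phi>)) u;
          H = mean_curvature (x \<circ> \<phi>) (y \<circ> \<phi>) u;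
          T = tchebychev_norm (x \<circ> \<phi>) (y \<circ> \<phi>) u;
          n = real CARD('n)
      in n * T = (n + 2) * (H - S)))"

end

theory Submission
  imports Defs
begin

text \<open>
  The Gauss equation of a relative normalization gives \<open>H + J - S = n/(n-1) \<parallel>T\<parallel>\<close>, so (a), (b) and (c)
  are equivalent. The form of (b) is the useful one: it says that the trace-free part of the Darboux
  tensor has norm 0, hence, \<open>G\<close> being definite, that the Darboux tensor is the symmetrization of
  \<open>t \<otimes> G\<close> for some 1-form \<open>t\<close>. A multiple of \<open>t\<close> is exact, with the logarithm of a ratio of volume
  forms as a potential, and rescaling the conormal by means of this potential yields another relative
  normalization, for which the Darboux tensor vanishes. Then the shape operator is a multiple of the
  identity, the factor is locally constant, and the osculating quadric does not depend on the point.
  Two quadrics that share an open piece of the hypersurface coincide, which makes the local quadrics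
  fit together on the connected manifold.

  Conversely, let \<open>z L z + 2 b z + c = 0\<close> be the equation of a quadric containing the hypersurface. For a
  nontrivial solution of \<open>L \<beta> = \<alpha> b\<close> the field \<open>\<alpha> x + \<beta>\<close> is, up to sign, a relative normalization;
  its conormal is a constant multiple of the gradient \<open>L x + b\<close>, and its Darboux tensor vanishes.

  Since \<open>x\<close> is only \<open>C^3\<close> and \<open>y\<close> only \<open>C^1\<close>, the shape operator need not be differentiable.
\<close>

text \<open>The obstacle is regularity. Once the Darboux tensor vanishes,
  \<open>dy = - H dx\<close>, and the classical step differentiates this to get
  \<open>dH = 0\<close>; here \<open>H\<close> is not known to be differentiable. The substitute
  concerns maps between open sets of the coordinate space: \<open>dg = h dw\<close> forces
  \<open>h\<close> to be constant, whatever \<open>h\<close> is. The projection of \<open>x\<close>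
  to a fixed tangent space, inverted locally, supplies the coordinates \<open>w\<close>. The
  osculating quadric is then differentiated with \<open>H\<close> as a fixed number.

  The constants come from traces. The sum of the three permutations of \<open>t \<otimes> G\<close>
  has trace \<open>(n + 2) t\<close> and squared norm \<open>3 (n + 2)\<close> times that of
  \<open>t\<close>. So (b) is the equality case of an inequality between a symmetric cubic form and
  its trace. Multiplying the conormal by \<open>exp f\<close> changes the Darboux tensor, apart from
  the factor \<open>exp f\<close>, by half of that sum for \<open>df\<close>; hence
  \<open>df\<close> must be \<open>2 / (n + 2)\<close> times the trace of the Darboux
  tensor.\<close>

no_notation suminf (binder "\<Sum>" 10)

abbreviation (input) sum_UNIV :: "('a::finite \<Rightarrow> 'b::comm_monoid_add) \<Rightarrow> 'b" (binder "\<Sum>" 10) where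
  "sum_UNIV f \<equiv> sum f UNIV"

subsection \<open>Calculus of partial derivatives\<close>

lemma pd_eqI: "(f has_derivative f') (at u) \<Longrightarrow> pd i f u = f' (axis i 1)"
  unfolding pd_def using frechet_derivative_at by metis

lemma has_derivative_pd:
  "f differentiable at u \<Longrightarrow> (f has_derivative (\<lambda>v. \<Sum>i. v $ i *\<^sub>R pd i f u)) (at u)"
proof -
  assume f: "f differentiable at u"
  then have d: "(f has_derivative frechet_derivative f (at u)) (at u)"
    by (simp add: frechet_derivative_works)
  interpret linear "frechet_derivative f (at u)"
    using d has_derivative_linear by blast
  have "frechet_derivative f (at u) v = (\<Sum>i. v $ i *\<^sub>R pd i f u)" for v
  proof -
    have "v = (\<Sum>i. v $ i *\<^sub>R axis i 1)"
      by (metis basis_expansion scalar_mult_eq_scaleR)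
    then show ?thesis
      by (metis (mono_tags, lifting) pd_def scale sum sum.cong)
  qed
  then show ?thesis using d by presburger
qed

lemma differentiable_cong_open:
  assumes "open D" "u \<in> D" "\<And>v. v \<in> D \<Longrightarrow> f v = g v" "f differentiable at u"
  shows "g differentiable at u"
  using assms by (meson differentiable_def has_derivative_transform_within_open)

text \<open>No differentiability is assumed, so \<open>pd\<close> can be rewritten freely on open
  sets: where derivatives do not exist, both sides are the same arbitrary choice made by
  \<open>frechet_derivative\<close>.\<close>

lemma pd_cong_open:
  assumes "open D" "u \<in> D" "\<And>v. v \<in> D \<Longrightarrow> f v = g v"
  shows "pd i f u = pd i g u"
proof (cases "f differentiable at u")
  case True
  then show ?thesis
    unfolding pd_def using frechet_derivative_transform_within_open assms by metis
next
  case False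
  then have "\<not> (f has_derivative f') (at u) \<and> \<not> (g has_derivative f') (at u)" for f'
    using differentiable_cong_open[OF assms(1,2), of g f] assms(3) differentiable_def by metis
  then show ?thesis unfolding pd_def frechet_derivative_def by simp
qed

lemma pd_const [simp]: "pd i (\<lambda>u. c) u = 0"
  by (simp add: pd_def)

lemma pd_zero_on:
  assumes "open D" "u \<in> D" "\<And>v. v \<in> D \<Longrightarrow> f v = 0"
  shows "pd i f u = 0"
  using pd_cong_open[OF assms(1,2), of f "\<lambda>_. 0"] assms(3) by simp

lemma has_derivative_frechet:
  "f differentiable at u \<Longrightarrow> (f has_derivative frechet_derivative f (at u)) (at u)"
  by (simp add: frechet_derivative_works)

lemma pd_add:
  assumes "f differentiable at u" "g differentiable at u"
  shows "pd i (\<lambda>v. f v + g v) u = pd i f u + pd i g u"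
  using pd_eqI[OF has_derivative_add[OF assms[THEN has_derivative_frechet]], of i]
  by (simp add: pd_def)

lemma pd_diff:
  assumes "f differentiable at u" "g differentiable at u"
  shows "pd i (\<lambda>v. f v - g v) u = pd i f u - pd i g u"
  using pd_eqI[OF has_derivative_diff[OF assms[THEN has_derivative_frechet]], of i]
  by (simp add: pd_def)

lemma pd_sum:
  assumes "\<And>k. k \<in> K \<Longrightarrow> f k differentiable at u"
  shows "pd i (\<lambda>v. \<Sum>k\<in>K. f k v) u = (\<Sum>k\<in>K. pd i (f k) u)"
  using pd_eqI[OF has_derivative_sum[of K f, OF has_derivative_frechet[OF assms]], of i]
  by (simp add: pd_def)

lemma pd_scaleR:
  fixes f :: "real^'n::finite \<Rightarrow> real"
  assumes "f differentiable at u" "g differentiable at u"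
  shows "pd i (\<lambda>v. f v *\<^sub>R g v) u = pd i f u *\<^sub>R g u + f u *\<^sub>R pd i g u"
  using pd_eqI[OF has_derivative_scaleR[OF assms[THEN has_derivative_frechet]], of i]
  by (simp add: pd_def add.commute)

lemma pd_mult:
  fixes f :: "real^'n::finite \<Rightarrow> real"
  assumes "f differentiable at u" "g differentiable at u"
  shows "pd i (\<lambda>v. f v * g v) u = pd i f u * g u + f u * pd i g u"
  using pd_scaleR[OF assms] by simp

lemma pd_inner:
  fixes f :: "real^'n::finite \<Rightarrow> 'b::real_inner"
  assumes "f differentiable at u" "g differentiable at u"
  shows "pd i (\<lambda>v. f v \<bullet> g v) u = pd i f u \<bullet> g u + f u \<bullet> pd i g u"
  using pd_eqI[OF has_derivative_inner[OF assms[THEN has_derivative_frechet]], of i]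
  by (simp add: pd_def add.commute)

lemma differentiable_inner_at [derivative_intros]:
  fixes f :: "'a::real_normed_vector \<Rightarrow> 'b::real_inner"
  shows "f differentiable at u \<Longrightarrow> g differentiable at u \<Longrightarrow> (\<lambda>v. f v \<bullet> g v) differentiable at u"
  unfolding differentiable_def by (blast intro: has_derivative_inner)

lemma pd_bounded_linear:
  assumes "bounded_linear L" "f differentiable at u"
  shows "pd i (\<lambda>v. L (f v)) u = L (pd i f u)"
  using pd_eqI[OF bounded_linear.has_derivative[OF assms(1) has_derivative_frechet[OF assms(2)]], of i]
  by (simp add: pd_def)

lemma differentiable_bounded_linear:
  "bounded_linear L \<Longrightarrow> f differentiable at u \<Longrightarrow> (\<lambda>v. L (f v)) differentiable at u"
  unfolding differentiable_def by (blast intro: bounded_linear.has_derivative)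

lemma pd_nth:
  assumes "f differentiable at u"
  shows "pd i (\<lambda>v. f v $ j) u = pd i f u $ j"
  by (rule pd_bounded_linear[OF bounded_linear_vec_nth assms])

lemma differentiable_nth:
  "f differentiable at u \<Longrightarrow> (\<lambda>v. f v $ j) differentiable at u"
  by (rule differentiable_bounded_linear[OF bounded_linear_vec_nth])

lemma pd_chain_real:
  fixes f :: "real^'n::finite \<Rightarrow> real"
  assumes "f differentiable at u" "(h has_real_derivative h') (at (f u))"
  shows "(\<lambda>v. h (f v)) differentiable at u" "pd i (\<lambda>v. h (f v)) u = h' * pd i f u"
proof -
  have "((\<lambda>v. h (f v)) has_derivative (\<lambda>w. h' * frechet_derivative f (at u) w)) (at u)"
    using has_derivative_compose[OF has_derivative_frechet[OF assms(1)]
        assms(2)[unfolded has_field_derivative_def]] by simp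
  then show "(\<lambda>v. h (f v)) differentiable at u" "pd i (\<lambda>v. h (f v)) u = h' * pd i f u"
    using differentiable_def pd_eqI by (blast, metis pd_def)
qed

lemma has_vector_derivative_line:
  fixes f :: "real^'n::finite \<Rightarrow> 'b::real_normed_vector"
  assumes "f differentiable at (p + s *\<^sub>R axis i 1)"
  shows "((\<lambda>s. f (p + s *\<^sub>R axis i 1)) has_vector_derivative pd i f (p + s *\<^sub>R axis i 1)) (at s)"
proof -
  have 1: "((\<lambda>s. p + s *\<^sub>R axis i 1) has_derivative (\<lambda>h. h *\<^sub>R axis i 1)) (at s)"
    by (auto intro!: derivative_eq_intros)
  have "((\<lambda>s. f (p + s *\<^sub>R axis i 1)) has_derivative
      (\<lambda>h. frechet_derivative f (at (p + s *\<^sub>R axis i 1)) (h *\<^sub>R axis i 1))) (at s)"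
    using has_derivative_compose[OF 1 has_derivative_frechet[OF assms]] .
  moreover have "frechet_derivative f (at (p + s *\<^sub>R axis i 1)) (h *\<^sub>R axis i 1)
      = h *\<^sub>R pd i f (p + s *\<^sub>R axis i 1)" for h
    using linear_frechet_derivative[OF assms] linear_scale unfolding pd_def by blast
  ultimately show ?thesis unfolding has_vector_derivative_def by simp
qed

text \<open>Only differentiability of the first derivatives at \<open>u\<close> is assumed: both mixed
  derivatives are the limit of the second difference quotient.\<close>

lemma pd_second_difference:
  fixes f :: "real^'n::finite \<Rightarrow> real"
  assumes D: "open D" "u \<in> D" and f: "\<And>v. v \<in> D \<Longrightarrow> f differentiable at v"
    and fi: "pd i f differentiable at u"
  shows "((\<lambda>t. (f (u + t *\<^sub>R axis i 1 + t *\<^sub>R axis j 1) - f (u + t *\<^sub>R axis i 1)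
        - f (u + t *\<^sub>R axis j 1) + f u) / t\<^sup>2) \<longlongrightarrow> pd j (pd i f) u) (at_right 0)"
proof (rule tendstoI)
  fix e :: real assume e: "e > 0"
  obtain r where r: "r > 0" "ball u r \<subseteq> D" using D open_contains_ball by metis
  let ?g = "pd i f"
  let ?g' = "frechet_derivative ?g (at u)"
  have lin: "linear ?g'" by (rule linear_frechet_derivative[OF fi])
  \<comment> \<open>The tolerance \<open>e / 4\<close> serves two estimates, at distances up to
    \<open>2 t\<close> and \<open>t\<close>; together they cost
    \<open>3 e t / 4 < e t\<close>.\<close>
  obtain d where d: "d > 0"
    "\<And>v. norm (v - u) < d \<Longrightarrow> \<bar>?g v - ?g u - ?g' (v - u)\<bar> \<le> (e/4) * norm (v - u)"
    using has_derivative_frechet[OF fi, unfolded has_derivative_at_alt] e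
    by (metis real_norm_def zero_less_divide_iff zero_less_numeral)
  define m where "m = min d r / 4"
  have m: "m > 0" using d r by (simp add: m_def)
  have "dist ((f (u + t *\<^sub>R axis i 1 + t *\<^sub>R axis j 1) - f (u + t *\<^sub>R axis i 1)
        - f (u + t *\<^sub>R axis j 1) + f u) / t\<^sup>2) (pd j (pd i f) u) < e" if t: "0 < t" "t < m" for t
  proof -
    \<comment> \<open>The second difference is the increment of \<open>p\<close> from 0 to
      \<open>t\<close>, so the mean value theorem turns it into \<open>t\<close> times a difference
      of first derivatives.\<close>
    define p where "p = (\<lambda>s. f (u + t *\<^sub>R axis j 1 + s *\<^sub>R axis i 1) - f (u + s *\<^sub>R axis i 1))"
    define p' where "p' = (\<lambda>s. ?g (u + t *\<^sub>R axis j 1 + s *\<^sub>R axis i 1) - ?g (u + s *\<^sub>R axis i 1))"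
    have n1: "norm (t *\<^sub>R axis j 1 + s *\<^sub>R (axis i 1 :: real^'n)) \<le> 2 * t" if "0 \<le> s" "s \<le> t" for s
      using norm_triangle_ineq[of "t *\<^sub>R axis j 1" "s *\<^sub>R (axis i 1 :: real^'n)"] that t
      by (simp)
    have n2: "norm (s *\<^sub>R (axis i 1 :: real^'n)) \<le> t" if "0 \<le> s" "s \<le> t" for s
      using that by (simp)
    have tm: "2 * t < d" "2 * t < r" "t < d" "t < r" using t unfolding m_def by auto
    have in1: "u + t *\<^sub>R axis j 1 + s *\<^sub>R axis i 1 \<in> D" if "0 \<le> s" "s \<le> t" for s
    proof -
      have "dist u (u + t *\<^sub>R axis j 1 + s *\<^sub>R axis i 1) < r"
        using n1[OF that] tm by (simp add: dist_norm norm_minus_commute add.assoc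
            norm_minus_cancel[of "t *\<^sub>R axis j 1 + s *\<^sub>R axis i 1", symmetric] del: norm_minus_cancel)
      then show ?thesis using r by auto
    qed
    have in2: "u + s *\<^sub>R axis i 1 \<in> D" if "0 \<le> s" "s \<le> t" for s
    proof -
      have "dist u (u + s *\<^sub>R axis i 1) < r"
        using n2[OF that] tm by (simp add: dist_norm)
      then show ?thesis using r by auto
    qed
    have der: "(p has_real_derivative p' s) (at s)" if "0 \<le> s" "s \<le> t" for s
      unfolding p_def p'_def has_real_derivative_iff_has_vector_derivative
      by (intro has_vector_derivative_diff has_vector_derivative_line f in1 in2 that)
    obtain s where s: "0 < s" "s < t" "p t - p 0 = (t - 0) * p' s"
      using MVT2[OF t(1), of p p'] der by auto
    have a1: "\<bar>?g (u + t *\<^sub>R axis j 1 + s *\<^sub>R axis i 1) - ?g u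
        - ?g' (t *\<^sub>R axis j 1 + s *\<^sub>R axis i 1)\<bar> \<le> (e/4) * (2*t)"
    proof -
      have n: "norm (t *\<^sub>R axis j 1 + s *\<^sub>R (axis i 1::real^'n)) \<le> 2*t" using n1 s by simp
      have "\<bar>?g (u + t *\<^sub>R axis j 1 + s *\<^sub>R axis i 1) - ?g u
        - ?g' (t *\<^sub>R axis j 1 + s *\<^sub>R axis i 1)\<bar> \<le> (e/4) * norm (t *\<^sub>R axis j 1 + s *\<^sub>R (axis i 1::real^'n))"
        using d(2)[of "u + t *\<^sub>R axis j 1 + s *\<^sub>R axis i 1"] n tm by (simp add: add.assoc)
      also have "\<dots> \<le> (e/4) * (2*t)" using n e by (intro mult_left_mono) auto
      finally show ?thesis .
    qed
    have a2: "\<bar>?g (u + s *\<^sub>R axis i 1) - ?g u - ?g' (s *\<^sub>R axis i 1)\<bar> \<le> (e/4) * t"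
    proof -
      have n: "norm (s *\<^sub>R (axis i 1::real^'n)) \<le> t" using n2 s by simp
      have "\<bar>?g (u + s *\<^sub>R axis i 1) - ?g u - ?g' (s *\<^sub>R axis i 1)\<bar> \<le> (e/4) * norm (s *\<^sub>R (axis i 1::real^'n))"
        using d(2)[of "u + s *\<^sub>R axis i 1"] n tm by simp
      also have "\<dots> \<le> (e/4) * t" using n e by (intro mult_left_mono) auto
      finally show ?thesis .
    qed
    have l: "?g' (t *\<^sub>R axis j 1 + s *\<^sub>R axis i 1) - ?g' (s *\<^sub>R axis i 1) = t * pd j ?g u"
      using lin unfolding pd_def by (simp add: linear_add linear_scale)
    have "\<bar>p' s - t * pd j ?g u\<bar> \<le> (e/4) * (2*t) + (e/4) * t"
      using a1 a2 l unfolding p'_def by linarith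
    also have "\<dots> < e * t" using e t by (simp add: field_simps)
    finally have b: "\<bar>p' s - t * pd j ?g u\<bar> < e * t" .
    have "f (u + t *\<^sub>R axis i 1 + t *\<^sub>R axis j 1) - f (u + t *\<^sub>R axis i 1)
        - f (u + t *\<^sub>R axis j 1) + f u = t * p' s"
      using s(3) unfolding p_def by (simp add: algebra_simps)
    then have "(f (u + t *\<^sub>R axis i 1 + t *\<^sub>R axis j 1) - f (u + t *\<^sub>R axis i 1)
        - f (u + t *\<^sub>R axis j 1) + f u) / t\<^sup>2 - pd j ?g u = (p' s - t * pd j ?g u) / t"
      using t by (simp add: field_simps power2_eq_square)
    also have "\<bar>\<dots>\<bar> < e" using b t by (simp add: field_simps)
    finally show ?thesis by (simp add: dist_real_def)
  qed
  then show "\<forall>\<^sub>F t in at_right 0. dist ((f (u + t *\<^sub>R axis i 1 + t *\<^sub>R axis j 1) - f (u + t *\<^sub>R axis i 1)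
        - f (u + t *\<^sub>R axis j 1) + f u) / t\<^sup>2) (pd j (pd i f) u) < e"
    unfolding eventually_at_right_field using m by auto
qed

lemma pd_commute_real:
  fixes f :: "real^'n::finite \<Rightarrow> real"
  assumes "open D" "u \<in> D" "\<And>v. v \<in> D \<Longrightarrow> f differentiable at v"
    and "pd i f differentiable at u" "pd j f differentiable at u"
  shows "pd j (pd i f) u = pd i (pd j f) u"
proof -
  have "((\<lambda>t. (f (u + t *\<^sub>R axis i 1 + t *\<^sub>R axis j 1) - f (u + t *\<^sub>R axis i 1)
        - f (u + t *\<^sub>R axis j 1) + f u) / t\<^sup>2) \<longlongrightarrow> pd i (pd j f) u) (at_right 0)"
    using pd_second_difference[OF assms(1,2) assms(3) assms(5), of i]
    by (simp add: algebra_simps)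
  then show ?thesis
    using pd_second_difference[OF assms(1-4), of j] tendsto_unique trivial_limit_at_right_real by blast
qed

lemma pd_commute:
  fixes f :: "real^'n::finite \<Rightarrow> 'b::real_inner"
  assumes D: "open D" "u \<in> D" and f: "\<And>v. v \<in> D \<Longrightarrow> f differentiable at v"
    and i: "pd i f differentiable at u" and j: "pd j f differentiable at u"
  shows "pd j (pd i f) u = pd i (pd j f) u"
proof -
  have bl: "bounded_linear (\<lambda>v. v \<bullet> b)" for b :: 'b by (rule bounded_linear_inner_left)
  have *: "pd k (pd l (\<lambda>v. f v \<bullet> b)) u = pd k (pd l f) u \<bullet> b \<and> pd l (\<lambda>v. f v \<bullet> b) differentiable at u"
    if "pd l f differentiable at u" for k l b
  proof -
    have e: "pd l f v \<bullet> b = pd l (\<lambda>v. f v \<bullet> b) v" if "v \<in> D" for v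
      using pd_bounded_linear[OF bl f[OF that]] by simp
    have d: "(\<lambda>v. pd l f v \<bullet> b) differentiable at u"
      using that by (rule differentiable_bounded_linear[OF bl])
    then have "pd l (\<lambda>v. f v \<bullet> b) differentiable at u"
      by (rule differentiable_cong_open[OF D e, rotated])
    moreover have "pd k (\<lambda>v. pd l f v \<bullet> b) u = pd k (pd l (\<lambda>v. f v \<bullet> b)) u"
      by (rule pd_cong_open[OF D e])
    ultimately show ?thesis using pd_bounded_linear[OF bl that] by metis
  qed
  have "pd j (pd i f) u \<bullet> b = pd i (pd j f) u \<bullet> b" for b
    using pd_commute_real[OF D, of "\<lambda>v. f v \<bullet> b" i j] *[OF i] *[OF j]
      differentiable_bounded_linear[OF bl] f by metis
  then show ?thesis by (metis inner_commute vector_eq_rdot)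
qed

subsection \<open>Maps of class C^k\<close>

lemma Ck_on_cong:
  assumes "open U" "\<And>u. u \<in> U \<Longrightarrow> f u = g u" "Ck_on k f U"
  shows "Ck_on k g U"
  using assms(2,3)
proof (induction k arbitrary: f g)
  case 0 then show ?case by (metis Ck_on.simps(1) continuous_on_cong)
next
  case (Suc k)
  have "g differentiable at u" if "u \<in> U" for u
    using Suc.prems that differentiable_cong_open[OF assms(1) that] by (metis Ck_on.simps(2))
  moreover have "Ck_on k (pd i g) U" for i
  proof (rule Suc.IH[of "pd i f"])
    show "pd i f u = pd i g u" if "u \<in> U" for u
      by (rule pd_cong_open[OF assms(1) that Suc.prems(1)])
  qed (use Suc.prems in simp)
  ultimately show ?case by simp
qed

lemma Ck_on_Suc_imp: "Ck_on (Suc k) f U \<Longrightarrow> Ck_on k f U"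
proof (induction k arbitrary: f)
  case 0
  then show ?case
    by (simp add: continuous_at_imp_continuous_on differentiable_imp_continuous_within)
next
  case (Suc k)
  show ?case using Suc.prems Suc.IH by (subst Ck_on.simps, subst (asm) Ck_on.simps) blast
qed

lemma Ck_on_mono: "Ck_on k f U \<Longrightarrow> l \<le> k \<Longrightarrow> Ck_on l f U"
proof (induction k)
  case (Suc k)
  then show ?case using Ck_on_Suc_imp le_Suc_eq by blast
qed simp

lemma Ck_on_const: "Ck_on k (\<lambda>u. c) U"
proof (induction k arbitrary: c)
  case (Suc k)
  have "pd i (\<lambda>u. c) = (\<lambda>u. 0)" for i :: 'a by (rule ext) simp
  then show ?case using Suc by simp
qed simp

lemma Ck_on_add:
  assumes "open U"
  shows "Ck_on k f U \<Longrightarrow> Ck_on k g U \<Longrightarrow> Ck_on k (\<lambda>u. f u + g u) U"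
proof (induction k arbitrary: f g)
  case (Suc k)
  have "Ck_on k (pd i (\<lambda>u. f u + g u)) U" for i
    by (rule Ck_on_cong[OF assms, of "\<lambda>u. pd i f u + pd i g u"])
      (use Suc in \<open>auto simp: pd_add\<close>)
  then show ?case using Suc.prems by simp
qed (simp add: continuous_on_add)

lemma Ck_on_bounded_linear:
  assumes "open U" "bounded_linear L"
  shows "Ck_on k f U \<Longrightarrow> Ck_on k (\<lambda>u. L (f u)) U"
proof (induction k arbitrary: f)
  case 0 then show ?case by (simp add: assms(2) bounded_linear.continuous_on)
next
  case (Suc k)
  have "Ck_on k (pd i (\<lambda>u. L (f u))) U" for i
    by (rule Ck_on_cong[OF assms(1), of "\<lambda>u. L (pd i f u)"])
      (use Suc in \<open>auto simp: pd_bounded_linear[OF assms(2)]\<close>)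
  then show ?case using Suc.prems by (simp add: differentiable_bounded_linear[OF assms(2)])
qed

lemma Ck_on_inner:
  fixes f g :: "real^'n::finite \<Rightarrow> 'b::real_inner"
  assumes "open U"
  shows "Ck_on k f U \<Longrightarrow> Ck_on k g U \<Longrightarrow> Ck_on k (\<lambda>u. f u \<bullet> g u) U"
proof (induction k arbitrary: f g)
  case (Suc k)
  have "Ck_on k (pd i (\<lambda>u. f u \<bullet> g u)) U" for i
  proof (rule Ck_on_cong[OF assms, of "\<lambda>u. pd i f u \<bullet> g u + f u \<bullet> pd i g u"])
    show "Ck_on k (\<lambda>u. pd i f u \<bullet> g u + f u \<bullet> pd i g u) U"
      using Suc.prems Suc.prems[THEN Ck_on_Suc_imp] by (intro Ck_on_add[OF assms] Suc.IH) auto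
  qed (use Suc.prems in \<open>auto simp: pd_inner\<close>)
  then show ?case using Suc.prems by (simp add: differentiable_inner_at)
qed (simp add: continuous_on_inner)

lemma Ck_on_sum:
  assumes "open U"
  shows "(\<And>j. j \<in> J \<Longrightarrow> Ck_on k (f j) U) \<Longrightarrow> Ck_on k (\<lambda>u. \<Sum>j\<in>J. f j u) U"
  by (induction J rule: infinite_finite_induct) (auto intro!: Ck_on_const Ck_on_add[OF assms])

lemma Ck_on_vec:
  fixes f :: "real^'n::finite \<Rightarrow> 'b::real_inner^'m::finite"
  assumes "open U" "\<And>j. Ck_on k (\<lambda>u. f u $ j) U"
  shows "Ck_on k f U"
proof -
  have bl: "bounded_linear (\<lambda>x. axis j x :: 'b^'m)" for j
  proof (rule bounded_linear_intro[where K = 1])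
    show "norm (axis j x :: 'b^'m) \<le> norm x * 1" for x :: 'b
      by (simp add: norm_eq_sqrt_inner inner_axis_axis)
  qed (simp_all add: vec_eq_iff axis_def)
  have "f = (\<lambda>u. \<Sum>j. axis j (f u $ j))"
    by (rule ext) (simp add: vec_eq_iff axis_def if_distrib cong: if_cong)
  moreover have "Ck_on k (\<lambda>u. \<Sum>j. axis j (f u $ j)) U"
    by (intro Ck_on_sum assms Ck_on_bounded_linear[OF assms(1) bl])
  ultimately show ?thesis by simp
qed

subsection \<open>Determinants and inverse matrices\<close>

lemma differentiable_prod_at:
  fixes f :: "'i \<Rightarrow> 'a::real_normed_vector \<Rightarrow> real"
  shows "(\<And>i. i \<in> I \<Longrightarrow> f i differentiable at u) \<Longrightarrow> (\<lambda>v. \<Prod>i\<in>I. f i v) differentiable at u"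
  by (induction I rule: infinite_finite_induct) auto

lemma differentiable_det:
  fixes M :: "'a::real_normed_vector \<Rightarrow> real^'n^'n::finite"
  assumes "\<And>i j. (\<lambda>v. M v $ i $ j) differentiable at u"
  shows "(\<lambda>v. det (M v)) differentiable at u"
  unfolding det_def by (intro differentiable_sum ballI differentiable_mult differentiable_const
      differentiable_prod_at assms finite_permutations finite)

lemma matrix_inv_mult:
  fixes A :: "real^'n^'n::finite"
  assumes "det A \<noteq> 0"
  shows "A ** matrix_inv A = mat 1" "matrix_inv A ** A = mat 1"
proof -
  have "\<exists>B. A ** B = mat 1 \<and> B ** A = mat 1"
    using assms invertible_det_nz unfolding invertible_def by blast
  then have "A ** matrix_inv A = mat 1 \<and> matrix_inv A ** A = mat 1"
    unfolding matrix_inv_def by (rule someI_ex)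
  then show "A ** matrix_inv A = mat 1" "matrix_inv A ** A = mat 1" by auto
qed

text \<open>Cramer's rule writes the entries as quotients of determinants, from which
  differentiability of the inverse can be read off.\<close>

lemma matrix_inv_nth:
  fixes A :: "real^'n^'n::finite"
  assumes "det A \<noteq> 0"
  shows "matrix_inv A $ k $ j = det (\<chi> i l. if l = k then (axis j 1 :: real^'n) $ i else A $ i $ l) / det A"
proof -
  have "A *v (matrix_inv A *v axis j 1) = axis j 1"
    using matrix_inv_mult[OF assms] by (simp add: matrix_vector_mul_assoc)
  then have "matrix_inv A *v axis j 1 =
      (\<chi> k. det (\<chi> i l. if l = k then (axis j 1 :: real^'n) $ i else A $ i $ l) / det A)"
    using cramer[OF assms] by blast
  then have "(matrix_inv A *v axis j 1) $ k =
      det (\<chi> i l. if l = k then (axis j 1 :: real^'n) $ i else A $ i $ l) / det A"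
    by simp
  then show ?thesis by (simp add: matrix_vector_mult_basis column_def)
qed

lemma differentiable_matrix_inv:
  fixes M :: "real^'m::finite \<Rightarrow> real^'n^'n::finite"
  assumes D: "open D" "u \<in> D" and nz: "\<And>v. v \<in> D \<Longrightarrow> det (M v) \<noteq> 0"
    and M: "\<And>i j. (\<lambda>v. M v $ i $ j) differentiable at u"
  shows "(\<lambda>v. matrix_inv (M v) $ k $ j) differentiable at u"
proof (rule differentiable_cong_open[OF D])
  show "det (\<chi> i l. if l = k then (axis j 1 :: real^'n) $ i else M v $ i $ l) / det (M v)
      = matrix_inv (M v) $ k $ j" if "v \<in> D" for v
    using matrix_inv_nth[OF nz[OF that]] by simp
  have "(\<lambda>v. (\<chi> i l. if l = k then (axis j 1 :: real^'n) $ i else M v $ i $ l) $ a $ b) differentiable at u"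
    for a b by (cases "b = k") (auto simp: M)
  then show "(\<lambda>v. det (\<chi> i l. if l = k then (axis j 1 :: real^'n) $ i else M v $ i $ l) / det (M v))
      differentiable at u"
    by (intro differentiable_divide differentiable_det M nz D(2))
qed

lemma matrix_inv_sums:
  fixes A :: "real^'n^'n::finite"
  assumes "det A \<noteq> 0"
  shows "(\<Sum>k. A $ i $ k * matrix_inv A $ k $ j) = (if i = j then 1 else 0)"
    and "(\<Sum>k. matrix_inv A $ i $ k * A $ k $ j) = (if i = j then 1 else 0)"
proof -
  have "(A ** matrix_inv A) $ i $ j = mat 1 $ i $ j" "(matrix_inv A ** A) $ i $ j = mat 1 $ i $ j"
    using matrix_inv_mult[OF assms] by auto
  then show "(\<Sum>k. A $ i $ k * matrix_inv A $ k $ j) = (if i = j then 1 else 0)"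
    "(\<Sum>k. matrix_inv A $ i $ k * A $ k $ j) = (if i = j then 1 else 0)"
    by (auto simp: matrix_matrix_mult_def mat_def)
qed

lemma matrix_inv_symmetric:
  fixes A :: "real^'n^'n::finite"
  assumes "det A \<noteq> 0" "\<And>i j. A $ i $ j = A $ j $ i"
  shows "matrix_inv A $ i $ j = matrix_inv A $ j $ i"
proof -
  have t: "transpose A = A" using assms(2) by (simp add: transpose_def vec_eq_iff)
  let ?B = "matrix_inv A"
  have "transpose ?B = transpose ?B ** (A ** ?B)"
    using matrix_inv_mult[OF assms(1)] by simp
  also have "\<dots> = transpose (A ** ?B) ** ?B"
    by (simp add: matrix_transpose_mul t matrix_mul_assoc)
  also have "\<dots> = ?B" using matrix_inv_mult[OF assms(1)] by simp
  finally have "transpose ?B $ j $ i = ?B $ j $ i" by simp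
  then show ?thesis by (simp add: transpose_def)
qed

text \<open>Liouville's formula for \<open>M' = W M\<close>. By multilinearity, differentiating row
  \<open>i\<close> puts a combination of all rows in its place; every row other than the
  \<open>i\<close>-th then occurs twice, so only \<open>W i i\<close> survives.\<close>

lemma pd_det:
  fixes M :: "real^'m::finite \<Rightarrow> real^'n^'n::finite"
  assumes M: "\<And>i j. (\<lambda>v. M v $ i $ j) differentiable at u"
    and W: "\<And>i j. pd l (\<lambda>v. M v $ i $ j) u = (\<Sum>k. W i k * M u $ k $ j)"
  shows "pd l (\<lambda>v. det (M v)) u = (\<Sum>i. W i i) * det (M u)"
proof -
  let ?S = "{p. p permutes (UNIV::'n set)}"
  let ?M' = "\<lambda>i. (\<chi> j. pd l (\<lambda>v. M v $ i $ j) u) :: real^'n"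
  have pr: "pd l (\<lambda>v. \<Prod>i\<in>UNIV. M v $ i $ p i) u
      = (\<Sum>i. pd l (\<lambda>v. M v $ i $ p i) u * (\<Prod>j\<in>UNIV-{i}. M u $ j $ p j))" for p
    using pd_eqI[OF has_derivative_prod[OF has_derivative_frechet[OF M]], of l "\<lambda>i. i" p UNIV]
    by (simp add: pd_def)
  have "pd l (\<lambda>v. det (M v)) u = (\<Sum>p\<in>?S. of_int (sign p) * pd l (\<lambda>v. \<Prod>i\<in>UNIV. M v $ i $ p i) u)"
    unfolding det_def
    by (subst pd_sum) (auto intro!: differentiable_mult differentiable_prod_at M sum.cong simp: pd_mult[OF differentiable_const differentiable_prod_at[OF M]])
  also have "\<dots> = (\<Sum>p\<in>?S. \<Sum>i. of_int (sign p) *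
      (\<Prod>j\<in>UNIV. (\<chi> k. if k = i then ?M' i else M u $ k) $ j $ p j))"
  proof (intro sum.cong refl)
    fix p assume "p \<in> ?S"
    have "(\<Prod>j\<in>UNIV. (\<chi> k. if k = i then ?M' i else M u $ k) $ j $ p j)
       = pd l (\<lambda>v. M v $ i $ p i) u * (\<Prod>j\<in>UNIV-{i}. M u $ j $ p j)" for i
      by (subst prod.remove[of _ i]) (auto intro!: prod.cong)
    then show "of_int (sign p) * pd l (\<lambda>v. \<Prod>i\<in>UNIV. M v $ i $ p i) u = (\<Sum>i. of_int (sign p) *
      (\<Prod>j\<in>UNIV. (\<chi> k. if k = i then ?M' i else M u $ k) $ j $ p j))"
      unfolding pr sum_distrib_left by simp
  qed
  also have "\<dots> = (\<Sum>i. det (\<chi> k. if k = i then ?M' i else M u $ k))"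
    unfolding det_def by (subst sum.swap) simp
  also have "\<dots> = (\<Sum>i. W i i * det (M u))"
  proof (intro sum.cong refl)
    fix i
    have "?M' i = (\<Sum>k. W i k *s M u $ k)"
      by (simp add: vec_eq_iff W)
    then have "det (\<chi> k. if k = i then ?M' i else M u $ k)
       = det (\<chi> k. if k = i then (\<Sum>k. W i k *s M u $ k) else M u $ k)"
      by (rule arg_cong)
    also have "\<dots> = (\<Sum>m. det (\<chi> k. if k = i then W i m *s M u $ m else M u $ k))"
      by (rule det_linear_row_sum) simp
    also have "\<dots> = (\<Sum>m. W i m * det (\<chi> k. if k = i then M u $ m else M u $ k))"
      by (simp add: det_row_mul)
    also have "\<dots> = (\<Sum>m. if m = i then W i i * det (M u) else 0)"
    proof (intro sum.cong refl)
      fix m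
      show "W i m * det (\<chi> k. if k = i then M u $ m else M u $ k) = (if m = i then W i i * det (M u) else 0)"
      proof (cases "m = i")
        case True
        have "(\<chi> k. if k = i then M u $ i else M u $ k) = M u" by (simp add: vec_eq_iff)
        then show ?thesis unfolding True by simp
      next
        case False
        have "det (\<chi> k. if k = i then M u $ m else M u $ k) = 0"
          by (rule det_identical_rows[OF False]) (simp add: row_def vec_eq_iff False)
        then show ?thesis using False by simp
      qed
    qed
    finally show "det (\<chi> k. if k = i then ?M' i else M u $ k) = W i i * det (M u)" by simp
  qed
  finally show ?thesis by (simp add: sum_distrib_right)
qed

subsection \<open>Frames\<close>

lemma delta_contract:
  fixes A B :: "'n::finite \<Rightarrow> 'n \<Rightarrow> real"
  assumes "\<And>i j. (\<Sum>k. A i k * B k j) = (if i = j then 1 else 0)"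
  shows "(\<Sum>k. A i k * (\<Sum>j. B k j * f j)) = f i"
proof -
  have "(\<Sum>k. A i k * (\<Sum>j. B k j * f j)) = (\<Sum>j. (\<Sum>k. A i k * B k j) * f j)"
    unfolding sum_distrib_left sum_distrib_right
    by (subst sum.swap) (simp add: mult.assoc)
  also have "\<dots> = (\<Sum>j. if i = j then f j else 0)"
    unfolding assms by (intro sum.cong) auto
  finally show ?thesis by simp
qed

lemma det_nonzero_if_kernel_trivial:
  fixes A :: "real^'n^'n::finite"
  assumes "\<And>v. A *v v = 0 \<Longrightarrow> v = 0"
  shows "det A \<noteq> 0"
  using assms matrix_left_invertible_ker invertible_left_inverse invertible_det_nz by metis

lemma frame_expand:
  fixes e :: "'n::finite \<Rightarrow> 'b::euclidean_space" and y v :: 'b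
  assumes dim: "DIM('b) = CARD('n) + 1"
    and ind: "\<And>a b. (\<Sum>i. a i *\<^sub>R e i) + b *\<^sub>R y = 0 \<Longrightarrow> (\<forall>i. a i = 0) \<and> b = 0"
  obtains a b where "v = (\<Sum>i. a i *\<^sub>R e i) + b *\<^sub>R y"
proof -
  let ?p = "\<lambda>(a :: real^'n, b :: real). (\<Sum>i. a $ i *\<^sub>R e i) + b *\<^sub>R y"
  have lin: "linear ?p"
    by (rule linearI) (auto simp: scaleR_left_distrib sum.distrib scaleR_right_distrib scaleR_sum_right split: prod.splits)
  have inj: "inj ?p"
    unfolding linear_injective_0[OF lin]
  proof (intro allI impI)
    fix c assume "?p c = 0"
    then have "(\<Sum>i. fst c $ i *\<^sub>R e i) + snd c *\<^sub>R y = 0" by (simp add: split_beta)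
    from ind[OF this] show "c = 0" by (simp add: prod_eq_iff vec_eq_iff)
  qed
  have "dim (range ?p) = DIM((real^'n) \<times> real)"
    using dim_image_eq[OF lin, of UNIV] inj by simp
  then have "span (range ?p) = UNIV"
    using dim_eq_full[of "range ?p"] dim by simp
  then have "range ?p = UNIV"
    using linear_subspace_image[OF lin subspace_UNIV] span_eq_iff by blast
  then obtain c where "v = ?p c" using surjD[of ?p v] by blast
  then show ?thesis using that by (cases c) auto
qed

lemma frame_orthogonal_zero:
  fixes e :: "'n::finite \<Rightarrow> 'b::euclidean_space" and y v :: 'b
  assumes dim: "DIM('b) = CARD('n) + 1"
    and ind: "\<And>a b. (\<Sum>i. a i *\<^sub>R e i) + b *\<^sub>R y = 0 \<Longrightarrow> (\<forall>i. a i = 0) \<and> b = 0"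
    and "\<And>i. v \<bullet> e i = 0" "v \<bullet> y = 0"
  shows "v = 0"
proof -
  obtain a b where v: "v = (\<Sum>i. a i *\<^sub>R e i) + b *\<^sub>R y"
    using frame_expand[OF dim ind] by blast
  have "v \<bullet> v = v \<bullet> ((\<Sum>i. a i *\<^sub>R e i) + b *\<^sub>R y)" using v by simp
  also have "\<dots> = 0" using assms(3,4) by (simp add: inner_add_right inner_sum_right)
  finally show ?thesis by simp
qed

lemma conormal_eqI:
  fixes x y :: "real^'n::finite \<Rightarrow> 'b::euclidean_space"
  assumes dim: "DIM('b) = CARD('n) + 1"
    and ind: "\<And>a b. (\<Sum>i. a i *\<^sub>R pd i x u) + b *\<^sub>R y u = 0 \<Longrightarrow> (\<forall>i. a i = 0) \<and> b = 0"
    and Z: "\<And>i. Z \<bullet> pd i x u = 0" "Z \<bullet> y u = 1"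
  shows "conormal x y u = Z"
  unfolding conormal_def
proof (rule the_equality)
  show "(\<forall>i. Z \<bullet> pd i x u = 0) \<and> Z \<bullet> y u = 1" using Z by simp
  fix Z' assume Z': "(\<forall>i. Z' \<bullet> pd i x u = 0) \<and> Z' \<bullet> y u = 1"
  have "Z' - Z = 0"
    by (rule frame_orthogonal_zero[OF dim ind]) (use Z Z' in \<open>auto simp: inner_diff_left\<close>)
  then show "Z' = Z" by simp
qed

subsection \<open>Local relative geometry\<close>

text \<open>Plain differentiability is asked for instead of \<open>Ck_on\<close>: it suffices for
  mixed derivatives to commute, by \<open>pd_commute\<close>, and it passes directly to the rescaled
  normalization constructed below.\<close>

locale relative_frame =
  fixes D :: "(real^'n::finite) set" and x y :: "real^'n \<Rightarrow> 'b::euclidean_space"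
  assumes open_D: "open D" and dim: "DIM('b) = CARD('n) + 1"
    and x_diff: "u \<in> D \<Longrightarrow> x differentiable at u"
    and dx_diff: "u \<in> D \<Longrightarrow> pd i x differentiable at u"
    and ddx_diff: "u \<in> D \<Longrightarrow> pd j (pd i x) differentiable at u"
    and y_diff: "u \<in> D \<Longrightarrow> y differentiable at u"
    and indep: "u \<in> D \<Longrightarrow> (\<Sum>i. a i *\<^sub>R pd i x u) + b *\<^sub>R y u = 0 \<Longrightarrow> (\<forall>i. a i = 0) \<and> b = 0"
    and dy_tangent: "u \<in> D \<Longrightarrow> pd i y u \<in> span (range (\<lambda>j. pd j x u))"
    and metric_diff: "u \<in> D \<Longrightarrow> rel_metric x y differentiable at u"
    and dmetric_diff: "u \<in> D \<Longrightarrow> pd i (rel_metric x y) differentiable at u"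
    and det_metric: "u \<in> D \<Longrightarrow> det (rel_metric x y u) \<noteq> 0"
begin

abbreviation X where "X \<equiv> conormal x y"
abbreviation G where "G i j u \<equiv> rel_metric x y u $ i $ j"
abbreviation Q where "Q i j u \<equiv> matrix_inv (rel_metric x y u) $ i $ j"
abbreviation \<Gamma> where "\<Gamma> \<equiv> christoffel (rel_metric x y)"
abbreviation A where "A \<equiv> darboux x y"
abbreviation B where "B i j u \<equiv> shape_operator x y u $ i $ j"

lemma ddx_commute: "u \<in> D \<Longrightarrow> pd j (pd i x) u = pd i (pd j x) u"
  by (rule pd_commute[OF open_D]) (auto intro: x_diff dx_diff)

lemma dddx_commute12: "u \<in> D \<Longrightarrow> pd l (pd k (pd j x)) u = pd k (pd l (pd j x)) u"
  by (rule pd_commute[OF open_D]) (auto intro: dx_diff ddx_diff)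

lemma frame_coeffs:
  assumes "u \<in> D" "(\<Sum>i. a i *\<^sub>R pd i x u) + b *\<^sub>R y u = (\<Sum>i. a' i *\<^sub>R pd i x u) + b' *\<^sub>R y u"
  shows "a i = a' i" "b = b'"
proof -
  have "(\<Sum>i. (a i - a' i) *\<^sub>R pd i x u) + (b - b') *\<^sub>R y u = 0"
    using assms(2) by (simp add: scaleR_left_diff_distrib sum_subtractf algebra_simps)
  from indep[OF assms(1) this] show "a i = a' i" "b = b'" by auto
qed

lemma fund1_inner: "pd i x u \<bullet> pd j x u = fund1 x u $ i $ j"
  by (simp add: fund1_def)

lemma fund1_sym: "fund1 x u $ i $ j = fund1 x u $ j $ i"
  by (simp add: fund1_def inner_commute)

lemma det_fund1: "u \<in> D \<Longrightarrow> det (fund1 x u) \<noteq> 0"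
proof (rule det_nonzero_if_kernel_trivial)
  fix v :: "real^'n" assume u: "u \<in> D" and v: "fund1 x u *v v = 0"
  have "(\<Sum>i. v $ i *\<^sub>R pd i x u) \<bullet> (\<Sum>i. v $ i *\<^sub>R pd i x u) = v \<bullet> (fund1 x u *v v)"
    by (simp add: inner_sum_left inner_sum_right inner_vec_def matrix_vector_mult_def fund1_inner
        sum_distrib_left mult.commute mult.left_commute fund1_sym)
  then have "(\<Sum>i. v $ i *\<^sub>R pd i x u) + 0 *\<^sub>R y u = 0" using v by simp
  from indep[OF u this] show "v = 0" by (simp add: vec_eq_iff)
qed

text \<open>Coefficients of the Euclidean orthogonal projection to the tangent space. The Euclidean
  structure is auxiliary: it gives an expression that is linear in \<open>v\<close> and
  differentiable in \<open>u\<close>.\<close>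

definition tcoef :: "real^'n \<Rightarrow> 'b \<Rightarrow> 'n \<Rightarrow> real" where
  "tcoef u v i = (\<Sum>j. matrix_inv (fund1 x u) $ i $ j * (v \<bullet> pd j x u))"

lemma tcoef_tangent:
  assumes u: "u \<in> D"
  shows "tcoef u (\<Sum>k. a k *\<^sub>R pd k x u) i = a i"
proof -
  have "tcoef u (\<Sum>k. a k *\<^sub>R pd k x u) i =
      (\<Sum>j. matrix_inv (fund1 x u) $ i $ j * (\<Sum>k. fund1 x u $ j $ k * a k))"
    by (simp add: tcoef_def inner_sum_left fund1_inner mult.commute fund1_sym)
  also have "\<dots> = a i"
    by (rule delta_contract) (rule matrix_inv_sums[OF det_fund1[OF u]])
  finally show ?thesis .
qed

lemma tcoef_projection:
  assumes u: "u \<in> D"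
  shows "(v - (\<Sum>i. tcoef u v i *\<^sub>R pd i x u)) \<bullet> pd k x u = 0"
proof -
  have "(\<Sum>i. tcoef u v i *\<^sub>R pd i x u) \<bullet> pd k x u = (\<Sum>i. fund1 x u $ k $ i *
      (\<Sum>j. matrix_inv (fund1 x u) $ i $ j * (v \<bullet> pd j x u)))"
    by (simp add: inner_sum_left tcoef_def fund1_inner mult.commute fund1_sym)
  also have "\<dots> = v \<bullet> pd k x u"
    by (rule delta_contract) (rule matrix_inv_sums[OF det_fund1[OF u]])
  finally show ?thesis by (simp add: inner_diff_left)
qed

lemma tcoef_diff:
  assumes u: "u \<in> D" and f: "f differentiable at u"
  shows "(\<lambda>w. tcoef w (f w) i) differentiable at u"
proof -
  have "(\<lambda>w. fund1 x w $ i $ j) differentiable at u" for i j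
    unfolding fund1_def by (simp add: differentiable_inner_at dx_diff u)
  then show ?thesis
    unfolding tcoef_def
    by (intro differentiable_sum ballI differentiable_mult differentiable_inner_at f dx_diff u finite
        differentiable_matrix_inv[OF open_D u det_fund1])
qed

text \<open>The part of \<open>y\<close> orthogonal to the tangent space. Divided by its squared
  length it is the conormal, an explicit formula that shows the differentiability hidden by the
  definite description.\<close>

definition normal_part :: "real^'n \<Rightarrow> 'b" where
  "normal_part u = y u - (\<Sum>i. tcoef u (y u) i *\<^sub>R pd i x u)"

lemma normal_part_facts:
  assumes u: "u \<in> D"
  shows "normal_part u \<bullet> pd k x u = 0" "normal_part u \<bullet> y u = normal_part u \<bullet> normal_part u"
    "normal_part u \<bullet> normal_part u \<noteq> 0"
proof -
  show 1: "normal_part u \<bullet> pd k x u = 0" for k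
    unfolding normal_part_def by (rule tcoef_projection[OF u])
  have "normal_part u \<bullet> normal_part u = normal_part u \<bullet> y u
      - (\<Sum>i. tcoef u (y u) i * (normal_part u \<bullet> pd i x u))"
    by (subst (2) normal_part_def) (simp add: inner_diff_right inner_sum_right)
  then show "normal_part u \<bullet> y u = normal_part u \<bullet> normal_part u" using 1 by simp
  have "normal_part u \<noteq> 0"
  proof
    assume "normal_part u = 0"
    then have "(\<Sum>i. (- tcoef u (y u) i) *\<^sub>R pd i x u) + 1 *\<^sub>R y u = 0"
      unfolding normal_part_def by (simp add: sum_negf)
    from indep[OF u this] show False by simp
  qed
  then show "normal_part u \<bullet> normal_part u \<noteq> 0" by simp
qed

lemma conormal_eq: "u \<in> D \<Longrightarrow> X u = (1 / (normal_part u \<bullet> normal_part u)) *\<^sub>R normal_part u"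
  by (rule conormal_eqI[OF dim indep]) (use normal_part_facts in auto)

lemma X_dx: "u \<in> D \<Longrightarrow> X u \<bullet> pd i x u = 0"
  and X_y: "u \<in> D \<Longrightarrow> X u \<bullet> y u = 1"
  using normal_part_facts by (auto simp: conormal_eq)

lemma X_diff: 
  assumes u: "u \<in> D" shows "X differentiable at u"
proof -
  have n: "normal_part differentiable at u"
    unfolding normal_part_def[abs_def]
    by (intro differentiable_diff y_diff differentiable_sum ballI differentiable_scaleR tcoef_diff
        dx_diff u finite)
  show ?thesis
    by (rule differentiable_cong_open[OF open_D u, of "\<lambda>u. (1 / (normal_part u \<bullet> normal_part u)) *\<^sub>R normal_part u"])
      (use conormal_eq normal_part_facts(3)[OF u] in \<open>auto intro!: differentiable_scaleR differentiable_divide differentiable_inner_at n\<close>)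
qed

lemma G_eq: "G i j u = X u \<bullet> pd j (pd i x) u"
  by (simp add: rel_metric_def)

lemma G_sym: "u \<in> D \<Longrightarrow> G i j u = G j i u"
  by (simp add: G_eq ddx_commute)

lemma Q_sym: "u \<in> D \<Longrightarrow> Q i j u = Q j i u"
  by (rule matrix_inv_symmetric[OF det_metric G_sym])

lemma GQ: "u \<in> D \<Longrightarrow> (\<Sum>k. G i k u * Q k j u) = (if i = j then 1 else 0)"
  and QG: "u \<in> D \<Longrightarrow> (\<Sum>k. Q i k u * G k j u) = (if i = j then 1 else 0)"
  using matrix_inv_sums[OF det_metric] by auto

lemma tangent_expand:
  assumes u: "u \<in> D"
  shows "v = (\<Sum>i. tcoef u (v - (X u \<bullet> v) *\<^sub>R y u) i *\<^sub>R pd i x u) + (X u \<bullet> v) *\<^sub>R y u"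
proof -
  obtain a b where v: "v = (\<Sum>i. a i *\<^sub>R pd i x u) + b *\<^sub>R y u"
    by (rule frame_expand[OF dim indep[OF u]])
  have b: "X u \<bullet> v = b"
    unfolding v using X_dx[OF u] X_y[OF u] by (simp add: inner_add_right inner_sum_right)
  have "tcoef u (v - (X u \<bullet> v) *\<^sub>R y u) i = a i" for i
    unfolding b by (subst v) (simp add: tcoef_tangent[OF u])
  then show ?thesis using v b by simp
qed

lemma X_dy: 
  assumes u: "u \<in> D" shows "X u \<bullet> pd i y u = 0"
proof -
  have "span (range (\<lambda>j. pd j x u)) \<subseteq> {v. X u \<bullet> v = 0}"
    by (rule span_minimal) (auto simp: X_dx[OF u] subspace_def inner_add_right)
  then show ?thesis using dy_tangent[OF u] by blast
qed

lemma tangent_expand0: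
  assumes u: "u \<in> D" and "X u \<bullet> v = 0"
  shows "v = (\<Sum>i. tcoef u v i *\<^sub>R pd i x u)"
  using tangent_expand[OF u, of v] assms(2) by simp

lemma dX_dx: 
  assumes u: "u \<in> D" shows "pd l X u \<bullet> pd j x u = - G j l u"
proof -
  have "pd l (\<lambda>v. X v \<bullet> pd j x v) u = 0"
    by (rule pd_zero_on[OF open_D u]) (rule X_dx)
  then show ?thesis
    using u by (simp add: pd_inner X_diff dx_diff G_eq)
qed

lemma dX_y: 
  assumes u: "u \<in> D" shows "pd l X u \<bullet> y u = 0"
proof -
  have "pd l (\<lambda>v. X v \<bullet> y v) u = pd l (\<lambda>v. 1) u"
    by (rule pd_cong_open[OF open_D u]) (rule X_y)
  then show ?thesis
    using u by (simp add: pd_inner X_diff y_diff X_dy)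
qed

lemma shape: 
  assumes u: "u \<in> D" shows "pd i y u = - (\<Sum>j. B i j u *\<^sub>R pd j x u)"
proof -
  let ?P = "\<lambda>B::real^'n^'n. \<forall>i. pd i y u = - (\<Sum>j. B $ i $ j *\<^sub>R pd j x u)"
  let ?B = "\<chi> i j. - tcoef u (pd i y u) j"
  have "?P ?B" using tangent_expand0[OF u X_dy[OF u]] by (simp add: sum_negf)
  moreover have "B' = ?B" if "?P B'" for B'
  proof -
    have "tcoef u (pd i y u) j = - B' $ i $ j" for i j
    proof -
      have e: "pd i y u = (\<Sum>j. (- B' $ i $ j) *\<^sub>R pd j x u)" using that by (simp add: sum_negf)
      show ?thesis unfolding e by (rule tcoef_tangent[OF u])
    qed
    then show ?thesis by (simp add: vec_eq_iff)
  qed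
  ultimately have "?P (shape_operator x y u)"
    unfolding shape_operator_def by (rule theI)
  then show ?thesis by blast
qed

section \<open>The Levi-Civita connection of the relative metric\<close>

lemma metric_nth_diff: "u \<in> D \<Longrightarrow> (\<lambda>v. G i j v) differentiable at u"
  by (intro differentiable_nth metric_diff)

lemma dmetric_nth_diff:
  assumes u: "u \<in> D" shows "pd l (\<lambda>v. G i j v) differentiable at u"
proof -
  have e: "pd l (rel_metric x y) v $ i $ j = pd l (\<lambda>v. G i j v) v" if "v \<in> D" for v
    using metric_diff[OF that] by (simp add: pd_nth differentiable_nth)
  show ?thesis
    by (rule differentiable_cong_open[OF open_D u e differentiable_nth[OF differentiable_nth[OF dmetric_diff[OF u]]]])
qed

lemma dG_sym: "u \<in> D \<Longrightarrow> pd l (\<lambda>v. G i j v) u = pd l (\<lambda>v. G j i v) u"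
  by (rule pd_cong_open[OF open_D]) (auto intro: G_sym)

lemma ddG_commute: "u \<in> D \<Longrightarrow> pd k (pd l (\<lambda>v. G i j v)) u = pd l (pd k (\<lambda>v. G i j v)) u"
  by (rule pd_commute[OF open_D]) (auto intro: metric_nth_diff dmetric_nth_diff)

lemma christoffel_diff:
  assumes u: "u \<in> D" shows "\<Gamma> k i j differentiable at u"
  unfolding christoffel_def[abs_def]
  by (intro differentiable_mult differentiable_const differentiable_sum ballI differentiable_add
      differentiable_diff dmetric_nth_diff u finite metric_nth_diff
      differentiable_matrix_inv[OF open_D u det_metric])

lemma christoffel_sym: "u \<in> D \<Longrightarrow> \<Gamma> k i j u = \<Gamma> k j i u"
  unfolding christoffel_def by (simp add: dG_sym[of u _ i j] add.commute)

lemma christoffel_lower: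
  assumes u: "u \<in> D"
  shows "(\<Sum>k. G m k u * \<Gamma> k i j u)
    = (pd i (\<lambda>v. G j m v) u + pd j (\<lambda>v. G i m v) u - pd m (\<lambda>v. G i j v) u) / 2"
proof -
  let ?f = "\<lambda>m. pd i (\<lambda>v. G j m v) u + pd j (\<lambda>v. G i m v) u - pd m (\<lambda>v. G i j v) u"
  have "(\<Sum>k. G m k u * \<Gamma> k i j u) = (1/2) * (\<Sum>k. G m k u * (\<Sum>p. Q k p u * ?f p))"
    unfolding christoffel_def sum_distrib_left by (simp add: mult.left_commute)
  then show ?thesis using delta_contract[OF GQ[OF u]] by simp
qed

text \<open>Metric compatibility: this is \<open>\<nabla>G = 0\<close> written out.\<close>

lemma dG_christoffel:
  assumes u: "u \<in> D"
  shows "pd l (\<lambda>v. G i j v) u = (\<Sum>p. \<Gamma> p l i u * G p j u) + (\<Sum>p. \<Gamma> p l j u * G i p u)"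
proof -
  have "(\<Sum>p. \<Gamma> p l i u * G p j u) = (\<Sum>p. G j p u * \<Gamma> p l i u)"
    using G_sym[OF u] by (simp add: mult.commute)
  moreover have "(\<Sum>p. \<Gamma> p l j u * G i p u) = (\<Sum>p. G i p u * \<Gamma> p l j u)"
    by (simp add: mult.commute)
  ultimately show ?thesis
    unfolding christoffel_lower[OF u] using dG_sym[OF u, of l i j]
    by (simp add: field_simps)
qed

text \<open>\<open>\<Theta>\<close> are the coefficients of the connection induced by \<open>y\<close> in the equation
  \<open>x_jk = \<Theta>^m_jk x_m + G_jk y\<close>; they differ from the Christoffel symbols by the Darboux tensor
  with its last index raised, \<open>\<A>\<close>.\<close>

definition \<Theta> :: "'n \<Rightarrow> 'n \<Rightarrow> 'n \<Rightarrow> real^'n \<Rightarrow> real" where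
  "\<Theta> m j k u = tcoef u (pd k (pd j x) u - G j k u *\<^sub>R y u) m"

definition \<A> :: "'n \<Rightarrow> 'n \<Rightarrow> 'n \<Rightarrow> real^'n \<Rightarrow> real" where
  "\<A> m j k u = \<Theta> m j k u - \<Gamma> m j k u"

lemma ddx_expand: "u \<in> D \<Longrightarrow> pd k (pd j x) u = (\<Sum>m. \<Theta> m j k u *\<^sub>R pd m x u) + G j k u *\<^sub>R y u"
  using tangent_expand[of u "pd k (pd j x) u"] by (simp add: G_eq \<Theta>_def)

lemma \<Theta>_diff: "u \<in> D \<Longrightarrow> \<Theta> m j k differentiable at u"
  unfolding \<Theta>_def[abs_def]
  by (intro tcoef_diff differentiable_diff differentiable_scaleR ddx_diff y_diff metric_nth_diff)

lemma \<A>_diff: "u \<in> D \<Longrightarrow> \<A> m j k differentiable at u"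
  unfolding \<A>_def[abs_def] by (intro differentiable_diff \<Theta>_diff christoffel_diff)

lemma \<Theta>_sym: "u \<in> D \<Longrightarrow> \<Theta> m j k u = \<Theta> m k j u"
  unfolding \<Theta>_def by (simp add: ddx_commute[of u k] G_sym[of u j])

lemma \<A>_sym: "u \<in> D \<Longrightarrow> \<A> m j k u = \<A> m k j u"
  unfolding \<A>_def by (simp add: \<Theta>_sym[of u m j] christoffel_sym[of u m j])

lemma X_cov: "u \<in> D \<Longrightarrow> X u \<bullet> cov_dx (rel_metric x y) x j k u = G j k u"
  by (simp add: cov_dx_def inner_diff_right inner_sum_right X_dx G_eq)

lemma cov_expand: "u \<in> D \<Longrightarrow>
    cov_dx (rel_metric x y) x j k u = (\<Sum>m. \<A> m j k u *\<^sub>R pd m x u) + G j k u *\<^sub>R y u"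
  by (simp add: cov_dx_def ddx_expand[of u k j] \<A>_def scaleR_left_diff_distrib sum_subtractf
      christoffel_sym[of u _ k j])

text \<open>Pairing with the conormal removes the tangential terms. The derivative of
  \<open>\<A>^m_jk x_m\<close> leaves \<open>\<A>^m_jk G_ml\<close>, while the derivative of
  \<open>G_jk\<close> cancels against the two connection terms because the metric is
  parallel.\<close>

lemma darboux_eq:
  assumes u: "u \<in> D"
  shows "A j k l u = (\<Sum>m. \<A> m j k u * G m l u)"
proof -
  have "pd l (cov_dx (rel_metric x y) x j k) u
      = pd l (\<lambda>u. (\<Sum>m. \<A> m j k u *\<^sub>R pd m x u) + G j k u *\<^sub>R y u) u"
    by (rule pd_cong_open[OF open_D u]) (rule cov_expand)
  also have "\<dots> = (\<Sum>m. pd l (\<A> m j k) u *\<^sub>R pd m x u + \<A> m j k u *\<^sub>R pd l (pd m x) u)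
      + (pd l (\<lambda>v. G j k v) u *\<^sub>R y u + G j k u *\<^sub>R pd l y u)"
    using u by (simp add: pd_add pd_sum pd_scaleR \<A>_diff dx_diff y_diff metric_nth_diff)
  finally have "X u \<bullet> pd l (cov_dx (rel_metric x y) x j k) u
      = (\<Sum>m. \<A> m j k u * G m l u) + pd l (\<lambda>v. G j k v) u"
    using u by (simp add: inner_add_right inner_sum_right X_dx X_y X_dy G_eq)
  then show ?thesis
    unfolding darboux_def cov2_dx_def inner_diff_right inner_sum_right inner_scaleR_right
      X_cov[OF u] dG_christoffel[OF u] by simp
qed

text \<open>The form with the connections eliminated. It shows the symmetry of the tensor, and how
  it reacts to a change of conormal, at a glance.\<close>

lemma darboux_formula:
  assumes u: "u \<in> D"
  shows "A j k l u = X u \<bullet> pd l (pd k (pd j x)) u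
    - (pd l (\<lambda>v. G j k v) u + pd j (\<lambda>v. G k l v) u + pd k (\<lambda>v. G l j v) u) / 2"
proof -
  have "pd l (\<lambda>v. G j k v) u = pd l (\<lambda>v. X v \<bullet> pd k (pd j x) v) u"
    by (simp add: G_eq)
  also have "\<dots> = pd l X u \<bullet> pd k (pd j x) u + X u \<bullet> pd l (pd k (pd j x)) u"
    using u by (simp add: pd_inner X_diff ddx_diff)
  also have "pd l X u \<bullet> pd k (pd j x) u = - (\<Sum>m. \<Theta> m j k u * G m l u)"
    unfolding ddx_expand[OF u, of k j] using u
    by (simp add: inner_add_right inner_sum_right dX_dx dX_y sum_negf)
  finally have 1: "(\<Sum>m. \<Theta> m j k u * G m l u) = X u \<bullet> pd l (pd k (pd j x)) u - pd l (\<lambda>v. G j k v) u"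
    by simp
  have "(\<Sum>m. \<Gamma> m j k u * G m l u) = (\<Sum>m. G l m u * \<Gamma> m j k u)"
    using G_sym[OF u] by (simp add: mult.commute)
  then have 2: "(\<Sum>m. \<Gamma> m j k u * G m l u) =
      (pd j (\<lambda>v. G k l v) u + pd k (\<lambda>v. G j l v) u - pd l (\<lambda>v. G j k v) u) / 2"
    using christoffel_lower[OF u] by simp
  show ?thesis
    unfolding darboux_eq[OF u] \<A>_def left_diff_distrib sum_subtractf 1 2
    using dG_sym[OF u, of k j l] by (simp add: field_simps)
qed

lemma darboux_sym12: "u \<in> D \<Longrightarrow> A j k l u = A k j l u"
  unfolding darboux_eq by (simp add: \<A>_sym[of u _ j])

text \<open>In \<open>darboux_formula\<close> the metric terms form a cyclic sum and the two outer
  derivatives of \<open>x\<close> commute. With \<open>darboux_sym12\<close> this makes the tensor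
  totally symmetric.\<close>

lemma darboux_sym23: "u \<in> D \<Longrightarrow> A j k l u = A j l k u"
  unfolding darboux_formula
  using dddx_commute12[of u l k j] dG_sym[of u l j k] dG_sym[of u j k l] dG_sym[of u k l j]
  by (simp add: field_simps)

lemma raise_darboux: "u \<in> D \<Longrightarrow> \<A> m j k u = (\<Sum>l. Q m l u * A j k l u)"
  unfolding darboux_eq
  using delta_contract[OF QG, of u m "\<lambda>p. \<A> p j k u"] G_sym[of u]
  by (simp add: mult.commute)

text \<open>Integrability: the two expansions of the third derivatives of \<open>x\<close> in the
  frame, with \<open>k\<close> and \<open>l\<close> exchanged, have equal tangential
  coefficients.\<close>

lemma gauss_equation:
  assumes u: "u \<in> D"
  shows "pd l (\<Theta> m j k) u - pd k (\<Theta> m j l) u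
    + (\<Sum>p. \<Theta> p j k u * \<Theta> m p l u) - (\<Sum>p. \<Theta> p j l u * \<Theta> m p k u)
    = G j k u * B l m u - G j l u * B k m u"
proof -
  \<comment> \<open>The coefficient of \<open>y\<close> stays existential, as only tangential
    coefficients are compared.\<close>
  have *: "\<exists>b. pd l (pd k (pd j x)) u = (\<Sum>m. (pd l (\<Theta> m j k) u
      + (\<Sum>p. \<Theta> p j k u * \<Theta> m p l u) - G j k u * B l m u) *\<^sub>R pd m x u) + b *\<^sub>R y u" for k l
  proof -
    have "pd l (pd k (pd j x)) u
      = pd l (\<lambda>u. (\<Sum>m. \<Theta> m j k u *\<^sub>R pd m x u) + G j k u *\<^sub>R y u) u"
      by (rule pd_cong_open[OF open_D u]) (rule ddx_expand)
    also have "\<dots> = (\<Sum>m. pd l (\<Theta> m j k) u *\<^sub>R pd m x u + \<Theta> m j k u *\<^sub>R pd l (pd m x) u)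
        + (pd l (\<lambda>v. G j k v) u *\<^sub>R y u + G j k u *\<^sub>R pd l y u)"
      using u by (simp add: pd_add pd_sum pd_scaleR \<Theta>_diff dx_diff y_diff metric_nth_diff)
    also have "(\<Sum>m. pd l (\<Theta> m j k) u *\<^sub>R pd m x u + \<Theta> m j k u *\<^sub>R pd l (pd m x) u)
       = (\<Sum>m. pd l (\<Theta> m j k) u *\<^sub>R pd m x u) + (\<Sum>p. \<Theta> p j k u *\<^sub>R pd l (pd p x) u)"
      by (rule sum.distrib)
    also have "(\<Sum>p. \<Theta> p j k u *\<^sub>R pd l (pd p x) u) =
       (\<Sum>m. (\<Sum>p. \<Theta> p j k u * \<Theta> m p l u) *\<^sub>R pd m x u) + (\<Sum>p. \<Theta> p j k u * G p l u) *\<^sub>R y u"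
      unfolding ddx_expand[OF u, of l] scaleR_add_right sum.distrib scaleR_sum_right scaleR_sum_left
      by (subst sum.swap) simp
    finally have "pd l (pd k (pd j x)) u = (\<Sum>m. (pd l (\<Theta> m j k) u
      + (\<Sum>p. \<Theta> p j k u * \<Theta> m p l u) - G j k u * B l m u) *\<^sub>R pd m x u)
      + ((\<Sum>p. \<Theta> p j k u * G p l u) + pd l (\<lambda>v. G j k v) u) *\<^sub>R y u"
      unfolding shape[OF u]
      by (simp add: scaleR_left_diff_distrib scaleR_left_distrib sum_subtractf sum.distrib scaleR_sum_right)
    then show ?thesis by blast
  qed
  obtain b where b: "pd l (pd k (pd j x)) u = (\<Sum>m. (pd l (\<Theta> m j k) u
      + (\<Sum>p. \<Theta> p j k u * \<Theta> m p l u) - G j k u * B l m u) *\<^sub>R pd m x u) + b *\<^sub>R y u"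
    using * by blast
  obtain b' where b': "pd k (pd l (pd j x)) u = (\<Sum>m. (pd k (\<Theta> m j l) u
      + (\<Sum>p. \<Theta> p j l u * \<Theta> m p k u) - G j l u * B k m u) *\<^sub>R pd m x u) + b' *\<^sub>R y u"
    using * by blast
  note eq = trans[OF b[symmetric] trans[OF dddx_commute12[OF u, of l k j] b']]
  from frame_coeffs(1)[OF u eq, of m] show ?thesis by simp
qed

end

lemma sum_swap_pairs:
  "(\<Sum>m\<in>M. \<Sum>p\<in>P. \<Sum>k\<in>K. \<Sum>j\<in>J. f k j m p) = (\<Sum>k\<in>K. \<Sum>j\<in>J. \<Sum>m\<in>M. \<Sum>p\<in>P. f k j m p)"
proof -
  have "(\<Sum>m\<in>M. \<Sum>p\<in>P. \<Sum>k\<in>K. \<Sum>j\<in>J. f k j m p) = (\<Sum>m\<in>M. \<Sum>k\<in>K. \<Sum>p\<in>P. \<Sum>j\<in>J. f k j m p)"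
    by (intro sum.cong refl sum.swap)
  also have "\<dots> = (\<Sum>k\<in>K. \<Sum>m\<in>M. \<Sum>p\<in>P. \<Sum>j\<in>J. f k j m p)" by (rule sum.swap)
  also have "\<dots> = (\<Sum>k\<in>K. \<Sum>m\<in>M. \<Sum>j\<in>J. \<Sum>p\<in>P. f k j m p)"
    by (intro sum.cong refl sum.swap)
  also have "\<dots> = (\<Sum>k\<in>K. \<Sum>j\<in>J. \<Sum>m\<in>M. \<Sum>p\<in>P. f k j m p)"
    by (intro sum.cong refl sum.swap)
  finally show ?thesis .
qed

subsection \<open>Theorema egregium\<close>

context relative_frame
begin

text \<open>The Riemann tensor of the relative metric with \<open>m\<close> raised; the sign is such
  that the contraction of \<open>m\<close> with \<open>l\<close> is \<open>ricci\<close>.\<close>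

definition curv :: "'n \<Rightarrow> 'n \<Rightarrow> 'n \<Rightarrow> 'n \<Rightarrow> real^'n \<Rightarrow> real" where
  "curv m j k l u = pd l (\<Gamma> m j k) u - pd k (\<Gamma> m j l) u
    + (\<Sum>p. \<Gamma> p j k u * \<Gamma> m p l u) - (\<Sum>p. \<Gamma> p j l u * \<Gamma> m p k u)"

text \<open>The covariant derivative of the Darboux tensor, with the index \<open>m\<close> raised and lowered
  respectively.\<close>

definition \<D> :: "'n \<Rightarrow> 'n \<Rightarrow> 'n \<Rightarrow> 'n \<Rightarrow> real^'n \<Rightarrow> real" where
  "\<D> l m j k u = pd l (\<A> m j k) u + (\<Sum>r. \<Gamma> m l r u * \<A> r j k u)
    - (\<Sum>r. \<Gamma> r l j u * \<A> m r k u) - (\<Sum>r. \<Gamma> r l k u * \<A> m j r u)"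

definition \<D>' :: "'n \<Rightarrow> 'n \<Rightarrow> 'n \<Rightarrow> 'n \<Rightarrow> real^'n \<Rightarrow> real" where
  "\<D>' l m j k u = pd l (A m j k) u - (\<Sum>r. \<Gamma> r l m u * A r j k u)
    - (\<Sum>r. \<Gamma> r l j u * A m r k u) - (\<Sum>r. \<Gamma> r l k u * A m j r u)"

text \<open>Substitute \<open>\<Theta> = \<Gamma> + \<A>\<close> in the Gauss equation. The mixed
  products are connection terms of the covariant derivative of \<open>\<A>\<close>; the one that is
  missing is symmetric in \<open>k\<close> and \<open>l\<close> and drops out of the
  difference.\<close>

lemma curvature_split:
  assumes u: "u \<in> D"
  shows "curv m j k l u + (\<D> l m j k u - \<D> k m j l u)
    + ((\<Sum>p. \<A> p j k u * \<A> m p l u) - (\<Sum>p. \<A> p j l u * \<A> m p k u))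
    = G j k u * B l m u - G j l u * B k m u"
proof -
  have \<Theta>: "\<Theta> m j k = (\<lambda>u. \<Gamma> m j k u + \<A> m j k u)" for m j k
    by (rule ext) (simp add: \<A>_def)
  have d: "pd l (\<Theta> m j k) u = pd l (\<Gamma> m j k) u + pd l (\<A> m j k) u" for l m j k
    unfolding \<Theta> by (rule pd_add) (rule christoffel_diff[OF u] \<A>_diff[OF u])+
  have s: "(\<Sum>p. \<Theta> p j k u * \<Theta> m p l u) = (\<Sum>p. \<Gamma> p j k u * \<Gamma> m p l u)
      + (\<Sum>r. \<Gamma> r k j u * \<A> m r l u) + (\<Sum>r. \<Gamma> m l r u * \<A> r j k u)
      + (\<Sum>p. \<A> p j k u * \<A> m p l u)" for k l
    unfolding \<Theta> sum.distrib[symmetric]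
    by (intro sum.cong refl)
      (simp add: algebra_simps christoffel_sym[OF u, of _ k j] christoffel_sym[OF u, of m l])
  have c: "(\<Sum>r. \<Gamma> r l k u * \<A> m j r u) = (\<Sum>r. \<Gamma> r k l u * \<A> m j r u)"
    by (simp add: christoffel_sym[OF u, of _ k l])
  show ?thesis
    using gauss_equation[OF u, of l m j k] unfolding d s curv_def \<D>_def c by linarith
qed

text \<open>Lowering an index commutes with covariant differentiation because the metric is
  parallel.\<close>

lemma lower_\<D>:
  assumes u: "u \<in> D"
  shows "(\<Sum>m. G p m u * \<D> l m j k u) = \<D>' l p j k u"
proof -
  have e: "A p j k v = (\<Sum>m. G p m v * \<A> m j k v)" if "v \<in> D" for v p j k
    using darboux_eq[OF that, of j k p] darboux_sym12[OF that] darboux_sym23[OF that] G_sym[OF that]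
    by (simp add: mult.commute)
  have "pd l (A p j k) u = pd l (\<lambda>v. \<Sum>m. G p m v * \<A> m j k v) u"
    by (rule pd_cong_open[OF open_D u e])
  also have "\<dots> = (\<Sum>m. pd l (\<lambda>v. G p m v) u * \<A> m j k u) + (\<Sum>m. G p m u * pd l (\<A> m j k) u)"
    using u by (simp add: pd_sum pd_mult metric_nth_diff \<A>_diff sum.distrib)
  also have "(\<Sum>m. pd l (\<lambda>v. G p m v) u * \<A> m j k u) =
     (\<Sum>m. \<Sum>r. \<Gamma> r l p u * (G r m u * \<A> m j k u)) +
     (\<Sum>m. \<Sum>r. G p r u * (\<Gamma> r l m u * \<A> m j k u))"
    unfolding dG_christoffel[OF u] by (simp only: distrib_right sum.distrib sum_distrib_right, simp add: ac_simps)
  also have "(\<Sum>m. \<Sum>r. \<Gamma> r l p u * (G r m u * \<A> m j k u)) = (\<Sum>r. \<Gamma> r l p u * A r j k u)"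
    unfolding e[OF u] sum_distrib_left by (rule sum.swap)
  also have "(\<Sum>m. \<Sum>r. G p r u * (\<Gamma> r l m u * \<A> m j k u)) =
      (\<Sum>m. G p m u * (\<Sum>r. \<Gamma> m l r u * \<A> r j k u))"
    unfolding sum_distrib_left by (rule sum.swap)
  finally have 1: "pd l (A p j k) u - (\<Sum>r. \<Gamma> r l p u * A r j k u) =
     (\<Sum>m. G p m u * pd l (\<A> m j k) u) + (\<Sum>m. G p m u * (\<Sum>r. \<Gamma> m l r u * \<A> r j k u))"
    by simp
  have 2: "(\<Sum>r. \<Gamma> r l j u * A p r k u) = (\<Sum>m. G p m u * (\<Sum>r. \<Gamma> r l j u * \<A> m r k u))"
    unfolding e[OF u] sum_distrib_left by (subst sum.swap) (simp add: mult.left_commute)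
  have 3: "(\<Sum>r. \<Gamma> r l k u * A p j r u) = (\<Sum>m. G p m u * (\<Sum>r. \<Gamma> r l k u * \<A> m j r u))"
    unfolding e[OF u] sum_distrib_left by (subst sum.swap) (simp add: mult.left_commute)
  show ?thesis
    unfolding \<D>'_def \<D>_def 1 2 3 by (simp add: right_diff_distrib distrib_left sum.distrib sum_subtractf)
qed

lemma raise_\<D>': "u \<in> D \<Longrightarrow> \<D> l m j k u = (\<Sum>p. Q m p u * \<D>' l p j k u)"
  unfolding lower_\<D>[symmetric] using delta_contract[OF QG, of u m "\<lambda>m. \<D> l m j k u"] by simp

lemma \<D>'_sym: 
  assumes u: "u \<in> D" shows "\<D>' l p j k u = \<D>' l j p k u"
proof -
  have "pd l (A p j k) u = pd l (A j p k) u"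
    by (rule pd_cong_open[OF open_D u]) (rule darboux_sym12)
  moreover have "(\<Sum>r. \<Gamma> r l p u * A r j k u) = (\<Sum>r. \<Gamma> r l p u * A j r k u)"
    "(\<Sum>r. \<Gamma> r l j u * A p r k u) = (\<Sum>r. \<Gamma> r l j u * A r p k u)"
    "(\<Sum>r. \<Gamma> r l k u * A p j r u) = (\<Sum>r. \<Gamma> r l k u * A j p r u)"
    by (intro sum.cong refl arg_cong2[of _ _ _ _ "(*)"] darboux_sym12[OF u])+
  ultimately show ?thesis unfolding \<D>'_def by simp
qed

text \<open>Both contractions are the divergence of the trace of the Darboux tensor: renaming the
  two contracted pairs into each other only exchanges two indices in which \<open>\<D>'\<close> is
  symmetric.\<close>

lemma \<D>_contraction:
  assumes u: "u \<in> D"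
  shows "(\<Sum>j. \<Sum>k. Q j k u * (\<Sum>m. \<D> m m j k u - \<D> k m j m u)) = 0"
proof -
  have "(\<Sum>j. \<Sum>k. Q j k u * (\<Sum>m. \<D> k m j m u))
      = (\<Sum>j. \<Sum>k. \<Sum>m. \<Sum>p. Q j k u * Q m p u * \<D>' k p j m u)"
    by (simp add: raise_\<D>'[OF u] sum_distrib_left mult.assoc)
  also have "\<dots> = (\<Sum>k. \<Sum>j. \<Sum>p. \<Sum>m. Q p m u * Q k j u * \<D>' m j p k u)"
    by (rule sum_swap_pairs)
  also have "\<dots> = (\<Sum>k. \<Sum>j. \<Sum>p. \<Sum>m. Q j k u * Q m p u * \<D>' m p j k u)"
  proof (intro sum.cong refl)
    fix k j p m
    show "Q p m u * Q k j u * \<D>' m j p k u = Q j k u * Q m p u * \<D>' m p j k u"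
      using \<D>'_sym[OF u, of m j p k] Q_sym[OF u, of p m] Q_sym[OF u, of k j] by simp
  qed
  also have "\<dots> = (\<Sum>j. \<Sum>k. \<Sum>p. \<Sum>m. Q j k u * Q m p u * \<D>' m p j k u)"
    by (rule sum.swap)
  also have "\<dots> = (\<Sum>j. \<Sum>k. \<Sum>m. \<Sum>p. Q j k u * Q m p u * \<D>' m p j k u)"
    by (intro sum.cong refl sum.swap)
  also have "\<dots> = (\<Sum>j. \<Sum>k. Q j k u * (\<Sum>m. \<D> m m j k u))"
    by (simp add: raise_\<D>'[OF u] sum_distrib_left mult.assoc)
  finally show ?thesis by (simp add: sum_subtractf right_diff_distrib)
qed

lemma ricci_eq:
  assumes u: "u \<in> D"
  shows "ricci (rel_metric x y) k j u = (\<Sum>m. curv m j k m u)"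
proof -
  have "pd i (\<Gamma> i k j) u = pd i (\<Gamma> i j k) u" for i
    by (rule pd_cong_open[OF open_D u]) (rule christoffel_sym)
  moreover have "(\<Sum>i. \<Sum>p. \<Gamma> i i p u * \<Gamma> p k j u) = (\<Sum>m. \<Sum>p. \<Gamma> p j k u * \<Gamma> m p m u)"
    by (intro sum.cong refl) (metis christoffel_sym[OF u] mult.commute)
  moreover have "(\<Sum>i. \<Sum>p. \<Gamma> i k p u * \<Gamma> p i j u) = (\<Sum>m. \<Sum>p. \<Gamma> p j m u * \<Gamma> m p k u)"
    by (intro sum.cong refl) (metis christoffel_sym[OF u] mult.commute)
  ultimately show ?thesis
    unfolding ricci_def curv_def by (simp add: sum.distrib sum_subtractf)
qed

section \<open>Contractions of the quadratic terms\<close>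

lemma tchebychev_nth: "u \<in> D \<Longrightarrow> real CARD('n) * tchebychev x y u $ m = (\<Sum>i. \<Sum>j. Q i j u * \<A> m i j u)"
  by (simp add: tchebychev_def raise_darboux sum_distrib_left mult.assoc)

text \<open>The trace form is \<open>n\<close> times the Tchebychev vector with its index lowered;
  total symmetry makes it immaterial which two slots are traced.\<close>

lemma darboux_trace:
  assumes u: "u \<in> D"
  shows "(\<Sum>m. \<A> m p m u) = (\<Sum>i. \<Sum>j. Q i j u * A i j p u)"
    and "(\<Sum>m. \<A> m p m u) = real CARD('n) * (\<Sum>m. G p m u * tchebychev x y u $ m)"
proof -
  show 1: "(\<Sum>m. \<A> m p m u) = (\<Sum>i. \<Sum>j. Q i j u * A i j p u)"
    unfolding raise_darboux[OF u]
    by (intro sum.cong refl) (metis darboux_sym12[OF u] darboux_sym23[OF u])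
  have "real CARD('n) * (\<Sum>m. G p m u * tchebychev x y u $ m) = (\<Sum>m. G p m u * (real CARD('n) * tchebychev x y u $ m))"
    by (simp add: sum_distrib_left mult.left_commute)
  also have "\<dots> = (\<Sum>m. \<Sum>i. \<Sum>j. Q i j u * (\<A> m i j u * G p m u))"
    by (simp add: tchebychev_nth[OF u] sum_distrib_left ac_simps)
  also have "\<dots> = (\<Sum>i. \<Sum>m. \<Sum>j. Q i j u * (\<A> m i j u * G p m u))"
    by (rule sum.swap)
  also have "\<dots> = (\<Sum>i. \<Sum>j. \<Sum>m. Q i j u * (\<A> m i j u * G p m u))"
    by (intro sum.cong refl sum.swap)
  also have "\<dots> = (\<Sum>i. \<Sum>j. Q i j u * A i j p u)"
    by (simp add: darboux_eq[OF u] sum_distrib_left G_sym[OF u, of p])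
  finally show "(\<Sum>m. \<A> m p m u) = real CARD('n) * (\<Sum>m. G p m u * tchebychev x y u $ m)"
    using 1 by simp
qed

lemma tchebychev_contraction:
  assumes u: "u \<in> D"
  shows "(\<Sum>j. \<Sum>k. Q j k u * (\<Sum>m. \<Sum>p. \<A> p j k u * \<A> m p m u))
    = real CARD('n)^2 * tchebychev_norm x y u"
proof -
  have "(\<Sum>j. \<Sum>k. Q j k u * (\<Sum>m. \<Sum>p. \<A> p j k u * \<A> m p m u))
      = (\<Sum>j. \<Sum>k. Q j k u * (\<Sum>p. \<Sum>m. \<A> p j k u * \<A> m p m u))"
    by (intro sum.cong refl arg_cong2[of _ _ _ _ "(*)"] sum.swap)
  also have "\<dots> = (\<Sum>j. \<Sum>k. \<Sum>p. Q j k u * \<A> p j k u * (\<Sum>m. \<A> m p m u))"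
    by (simp add: sum_distrib_left mult.assoc)
  also have "\<dots> = (\<Sum>j. \<Sum>p. \<Sum>k. Q j k u * \<A> p j k u * (\<Sum>m. \<A> m p m u))"
    by (intro sum.cong refl sum.swap)
  also have "\<dots> = (\<Sum>p. \<Sum>j. \<Sum>k. Q j k u * \<A> p j k u * (\<Sum>m. \<A> m p m u))"
    by (rule sum.swap)
  also have "\<dots> = (\<Sum>p. (real CARD('n) * tchebychev x y u $ p) * (real CARD('n) * (\<Sum>m. G p m u * tchebychev x y u $ m)))"
    by (simp add: tchebychev_nth[OF u] darboux_trace(2)[OF u, symmetric] sum_distrib_right)
  also have "\<dots> = real CARD('n)^2 * tchebychev_norm x y u"
    by (simp add: tchebychev_norm_def sum_distrib_left power2_eq_square ac_simps)
  finally show ?thesis .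
qed

text \<open>Two of the three inverse metrics in the square of the Darboux tensor are absorbed into
  the two factors \<open>\<A>\<close>; by total symmetry the third may be taken on the pair
  \<open>j\<close>, \<open>k\<close>.\<close>

lemma pick_contraction:
  assumes u: "u \<in> D" and "real CARD('n) \<ge> 2"
  shows "(\<Sum>j. \<Sum>k. Q j k u * (\<Sum>m. \<Sum>p. \<A> p j m u * \<A> m p k u))
    = real CARD('n) * (real CARD('n) - 1) * pick x y u"
proof -
  let ?g = "\<lambda>j k l j' k'. Q j j' u * \<A> l j' k' u * (Q k' k u * A j k l u)"
  have "real CARD('n) * (real CARD('n) - 1) * pick x y u = (\<Sum>j. \<Sum>k. \<Sum>l. \<Sum>j'. \<Sum>k'. \<Sum>l'.
        Q j j' u * Q k k' u * Q l l' u * A j k l u * A j' k' l' u)"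
    using assms(2) unfolding pick_def by simp
  also have "\<dots> = (\<Sum>j. \<Sum>k. \<Sum>l. \<Sum>j'. \<Sum>k'. ?g j k l j' k')"
    by (simp add: raise_darboux[OF u] sum_distrib_left sum_distrib_right Q_sym[OF u, of k for k] ac_simps)
  also have "\<dots> = (\<Sum>j. \<Sum>l. \<Sum>k. \<Sum>j'. \<Sum>k'. ?g j k l j' k')"
    by (intro sum.cong refl sum.swap)
  also have "\<dots> = (\<Sum>j. \<Sum>l. \<Sum>j'. \<Sum>k. \<Sum>k'. ?g j k l j' k')"
    by (intro sum.cong refl sum.swap)
  also have "\<dots> = (\<Sum>j. \<Sum>l. \<Sum>j'. \<Sum>k'. \<Sum>k. ?g j k l j' k')"
    by (intro sum.cong refl sum.swap)
  also have "\<dots> = (\<Sum>j. \<Sum>l. \<Sum>j'. \<Sum>k'.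
        Q j j' u * (\<A> k' j l u * \<A> l k' j' u))"
  proof (intro sum.cong refl)
    fix j l j' k'
    have "(\<Sum>k. Q k' k u * A j k l u) = \<A> k' j l u"
      unfolding raise_darboux[OF u] by (simp add: darboux_sym23[OF u, of j l])
    then have "(\<Sum>k. ?g j k l j' k') = Q j j' u * \<A> l j' k' u * \<A> k' j l u"
      by (simp flip: sum_distrib_left)
    then show "(\<Sum>k. ?g j k l j' k') = Q j j' u * (\<A> k' j l u * \<A> l k' j' u)"
      using \<A>_sym[OF u, of l j' k'] by simp
  qed
  also have "\<dots> = (\<Sum>j. \<Sum>j'. \<Sum>l. \<Sum>k'.
        Q j j' u * (\<A> k' j l u * \<A> l k' j' u))"
    by (intro sum.cong refl sum.swap)
  finally show ?thesis by (simp add: sum_distrib_left)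
qed

text \<open>Setting \<open>l = m\<close> in \<open>curvature_split\<close> and contracting with the
  inverse metric gives \<open>n (n - 1) S\<close> for the curvature, 0 for the derivative terms,
  \<open>n^2 T - n (n - 1) J\<close> for the quadratic terms (\<open>T\<close> being the Tchebychev
  norm), and \<open>n^2 H - n H\<close> on the right.\<close>

theorem theorema_egregium:
  assumes u: "u \<in> D" and two: "real CARD('n) \<ge> 2"
  shows "mean_curvature x y u + pick x y u - scalar_curvature (rel_metric x y) u
    = real CARD('n) / (real CARD('n) - 1) * tchebychev_norm x y u"
proof -
  let ?c = "\<lambda>F. \<Sum>j. \<Sum>k. Q j k u * (\<Sum>m. F m j k :: real)"
  have add: "?c (\<lambda>m j k. F m j k + F' m j k) = ?c F + ?c F'" for F F'
    by (simp add: sum.distrib distrib_left)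
  have dif: "?c (\<lambda>m j k. F m j k - F' m j k) = ?c F - ?c F'" for F F'
    by (simp add: sum_subtractf right_diff_distrib)
  have "?c (\<lambda>m j k. curv m j k m u + (\<D> m m j k u - \<D> k m j m u)
    + ((\<Sum>p. \<A> p j k u * \<A> m p m u) - (\<Sum>p. \<A> p j m u * \<A> m p k u)))
    = ?c (\<lambda>m j k. G j k u * B m m u - G j m u * B k m u)"
    unfolding curvature_split[OF u] ..
  then have 1: "?c (\<lambda>m j k. curv m j k m u) + real CARD('n)^2 * tchebychev_norm x y u - real CARD('n) * (real CARD('n) - 1) * pick x y u
     = ?c (\<lambda>m j k. G j k u * B m m u) - ?c (\<lambda>m j k. G j m u * B k m u)"
    unfolding add dif[of "\<lambda>m j k. (\<Sum>p. \<A> p j k u * \<A> m p m u)"]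
      dif[of "\<lambda>m j k. G j k u * B m m u"] \<D>_contraction[OF u]
      tchebychev_contraction[OF u] pick_contraction[OF u two] by simp
  have "?c (\<lambda>m j k. curv m j k m u) = (\<Sum>j. \<Sum>k. Q k j u * ricci (rel_metric x y) k j u)"
    unfolding ricci_eq[OF u] by (intro sum.cong refl arg_cong2[of _ _ _ _ "(*)"] Q_sym[OF u])
  also have "\<dots> = (\<Sum>k. \<Sum>j. Q k j u * ricci (rel_metric x y) k j u)"
    by (rule sum.swap)
  finally have 2: "?c (\<lambda>m j k. curv m j k m u) = real CARD('n) * (real CARD('n) - 1) * scalar_curvature (rel_metric x y) u"
    using two unfolding scalar_curvature_def by simp
  have H: "(\<Sum>m. B m m u) = real CARD('n) * mean_curvature x y u"
    by (simp add: mean_curvature_def trace_def)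
  have "(\<Sum>j. \<Sum>k. Q j k u * G j k u) = (\<Sum>j. \<Sum>k. Q j k u * G k j u)"
    by (intro sum.cong refl arg_cong2[of _ _ _ _ "(*)"] G_sym[OF u])
  then have "(\<Sum>j. \<Sum>k. Q j k u * G j k u) = real CARD('n)"
    by (simp add: QG[OF u])
  then have 3: "?c (\<lambda>m j k. G j k u * B m m u) = real CARD('n) * (real CARD('n) * mean_curvature x y u)"
    unfolding sum_distrib_left[symmetric] H mult.assoc[symmetric] sum_distrib_right[symmetric] by simp
  have "?c (\<lambda>m j k. G j m u * B k m u) = (\<Sum>k. \<Sum>j. \<Sum>m. Q j k u * (G j m u * B k m u))"
    unfolding sum_distrib_left by (rule sum.swap)
  also have "\<dots> = (\<Sum>k. \<Sum>m. \<Sum>j. Q j k u * (G j m u * B k m u))"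
    by (intro sum.cong refl sum.swap)
  also have "\<dots> = (\<Sum>k. \<Sum>m. (\<Sum>j. Q k j u * G j m u) * B k m u)"
    by (simp add: sum_distrib_right mult.assoc Q_sym[OF u, of _ k for k])
  also have "\<dots> = (\<Sum>k. \<Sum>m. if k = m then B k m u else 0)"
    unfolding QG[OF u] by (intro sum.cong refl) auto
  finally have 4: "?c (\<lambda>m j k. G j m u * B k m u) = real CARD('n) * mean_curvature x y u"
    using H by simp
  have "real CARD('n) * (real CARD('n) - 1) * scalar_curvature (rel_metric x y) u + real CARD('n)^2 * tchebychev_norm x y u
      - real CARD('n) * (real CARD('n) - 1) * pick x y u = real CARD('n) * (real CARD('n) - 1) * mean_curvature x y u"
    using 1 unfolding 2 3 4 by (simp add: algebra_simps)
  then have "real CARD('n) * ((real CARD('n) - 1) * (mean_curvature x y u + pick x y u - scalar_curvature (rel_metric x y) u)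
     - real CARD('n) * tchebychev_norm x y u) = 0"
    by (simp add: algebra_simps power2_eq_square)
  then have "(real CARD('n) - 1) * (mean_curvature x y u + pick x y u - scalar_curvature (rel_metric x y) u)
     = real CARD('n) * tchebychev_norm x y u"
    using two by simp
  then have "mean_curvature x y u + pick x y u - scalar_curvature (rel_metric x y) u
     = real CARD('n) * tchebychev_norm x y u / (real CARD('n) - 1)"
    using two by (subst eq_divide_eq) (auto simp: mult.commute)
  then show ?thesis by simp
qed

end

subsection \<open>Orthonormal frames of a definite form\<close>

text \<open>Gram-Schmidt, one vector at a time: as long as fewer than \<open>n\<close> vectors are
  chosen, some vector lies outside their span.\<close>

lemma posdef_orthonormal_set:
  fixes S :: "real^'n^'n::finite"
  assumes sym: "\<And>v w. v \<bullet> (S *v w) = w \<bullet> (S *v v)"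
    and pos: "\<And>v. v \<noteq> 0 \<Longrightarrow> v \<bullet> (S *v v) > 0"
    and "k \<le> CARD('n)"
  shows "\<exists>T. finite T \<and> card T = k \<and> (\<forall>a\<in>T. \<forall>b\<in>T. a \<bullet> (S *v b) = (if a = b then 1 else 0))"
  using assms(3)
proof (induction k)
  case 0 show ?case by (rule exI[of _ "{}"]) simp
next
  case (Suc k)
  then obtain T where T: "finite T" "card T = k"
    "\<And>a b. a \<in> T \<Longrightarrow> b \<in> T \<Longrightarrow> a \<bullet> (S *v b) = (if a = b then 1 else 0)"
    by auto
  have "dim (span T) < CARD('n)"
    using dim_le_card'[OF T(1)] T(2) Suc.prems by simp
  then have "span T \<noteq> UNIV" using dim_eq_full[of T] by auto
  then obtain v where v: "v \<notin> span T" by auto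
  define w where "w = v - (\<Sum>b\<in>T. (v \<bullet> (S *v b)) *\<^sub>R b)"
  have "(\<Sum>b\<in>T. (v \<bullet> (S *v b)) *\<^sub>R b) \<in> span T"
    by (intro span_sum span_scale span_base)
  then have w: "w \<notin> span T" unfolding w_def using v span_add by fastforce
  then have w0: "w \<noteq> 0" using span_zero by metis
  have orth: "w \<bullet> (S *v a) = 0" if a: "a \<in> T" for a
  proof -
    have "(\<Sum>b\<in>T. (v \<bullet> (S *v b)) *\<^sub>R b) \<bullet> (S *v a) = (\<Sum>b\<in>T. if b = a then v \<bullet> (S *v b) else 0)"
      unfolding inner_sum_left by (intro sum.cong) (auto simp: T(3) a)
    also have "\<dots> = v \<bullet> (S *v a)" using T(1) a by simp
    finally show ?thesis unfolding w_def inner_diff_left by simp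
  qed
  define c where "c = w \<bullet> (S *v w)"
  have c: "c > 0" unfolding c_def using pos[OF w0] .
  define w' where "w' = (1 / sqrt c) *\<^sub>R w"
  have S1: "S *v w' = (1 / sqrt c) *\<^sub>R (S *v w)"
    unfolding w'_def by (simp add: matrix_vector_mult_scaleR)
  have "w' \<notin> T"
  proof
    assume "w' \<in> T"
    then have "sqrt c *\<^sub>R w' \<in> span T" by (intro span_scale span_base)
    then show False using w c by (simp add: w'_def)
  qed
  moreover have "w' \<bullet> (S *v w') = 1"
  proof -
    have "w' \<bullet> (S *v w') = c / (sqrt c * sqrt c)"
      unfolding S1 by (simp add: w'_def c_def)
    then show ?thesis using c by simp
  qed
  moreover have "w' \<bullet> (S *v a) = 0" "a \<bullet> (S *v w') = 0" if "a \<in> T" for a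
    using orth[OF that] sym[of a w] unfolding S1 by (auto simp: w'_def)
  ultimately show ?case
    using T by (intro exI[of _ "insert w' T"]) auto
qed

text \<open>The number \<open>e\<close> is the sign of the form, so positive and negative definite
  metrics are handled together.\<close>

lemma definite_orthonormal_frame:
  fixes S :: "real^'n^'n::finite"
  assumes sym: "\<And>i j. S $ i $ j = S $ j $ i" and def: "definite_form S"
  obtains e :: real and E :: "'n \<Rightarrow> 'n \<Rightarrow> real"
  where "e * e = 1" "\<And>a b. (\<Sum>i. E a i * (\<Sum>j. S $ i $ j * E b j)) = (if a = b then e else 0)"
proof -
  have t: "transpose S = S" using sym by (simp add: transpose_def vec_eq_iff)
  obtain e :: real where e: "e * e = 1" "\<And>v. v \<noteq> 0 \<Longrightarrow> e * (v \<bullet> (S *v v)) > 0"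
  proof (cases "\<forall>v. v \<noteq> 0 \<longrightarrow> v \<bullet> (S *v v) > 0")
    case True then show ?thesis using that[of 1] by simp
  next
    case False
    then have "\<forall>v. v \<noteq> 0 \<longrightarrow> v \<bullet> (S *v v) < 0" using def unfolding definite_form_def by blast
    then show ?thesis using that[of "-1"] by simp
  qed
  have m: "(e *\<^sub>R S) *v v = e *\<^sub>R (S *v v)" for v
    by (simp add: scaleR_matrix_vector_assoc)
  have s: "v \<bullet> (S *v w) = w \<bullet> (S *v v)" for v w
    by (metis dot_lmul_matrix inner_commute t transpose_matrix_vector)
  have "\<exists>T. finite T \<and> card T = CARD('n) \<and>
      (\<forall>a\<in>T. \<forall>b\<in>T. a \<bullet> ((e *\<^sub>R S) *v b) = (if a = b then 1 else 0))"
  proof (rule posdef_orthonormal_set)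
    show "v \<bullet> ((e *\<^sub>R S) *v w) = w \<bullet> ((e *\<^sub>R S) *v v)" for v w
      unfolding m inner_scaleR_right s[of v w] ..
    show "v \<bullet> ((e *\<^sub>R S) *v v) > 0" if "v \<noteq> 0" for v
      unfolding m inner_scaleR_right by (rule e(2)[OF that])
  qed simp
  then obtain T where T: "finite T" "card T = CARD('n)"
    "\<And>a b. a \<in> T \<Longrightarrow> b \<in> T \<Longrightarrow> a \<bullet> ((e *\<^sub>R S) *v b) = (if a = b then 1 else 0)" by blast
  obtain E where E: "bij_betw E (UNIV::'n set) T"
    using finite_same_card_bij[OF finite_class.finite_UNIV T(1)] T(2) by metis
  show ?thesis
  proof (rule that[of e "\<lambda>a i. E a $ i"])
    fix a b
    have "E a \<bullet> ((e *\<^sub>R S) *v E b) = (if a = b then 1 else 0)"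
      using T(3)[of "E a" "E b"] E by (auto simp: bij_betw_def inj_on_def)
    then have "e * (e * (E a \<bullet> (S *v E b))) = (if a = b then e else 0)"
      unfolding m by simp
    then have "E a \<bullet> (S *v E b) = (if a = b then e else 0)"
      unfolding mult.assoc[symmetric] e(1) by simp
    then show "(\<Sum>i. E a $ i * (\<Sum>j. S $ i $ j * E b $ j)) = (if a = b then e else 0)"
      by (simp add: inner_vec_def matrix_vector_mult_def)
  qed (rule e(1))
qed

text \<open>If \<open>P\<close> has the frame vectors as rows, then \<open>P S P^T = e I\<close>;
  since \<open>e^2 = 1\<close>, \<open>P\<close> is invertible and the inverse of \<open>S\<close>
  is \<open>e P^T P\<close>.\<close>

lemma orthonormal_frame_inverse:
  fixes S :: "real^'n^'n::finite" and E :: "'n \<Rightarrow> 'n \<Rightarrow> real"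
  assumes e: "e * e = 1" and S: "det S \<noteq> 0"
    and E: "\<And>a b. (\<Sum>i. E a i * (\<Sum>j. S $ i $ j * E b j)) = (if a = b then e else 0)"
  shows "matrix_inv S $ i $ j = e * (\<Sum>a. E a i * E a j)"
proof -
  define P :: "real^'n^'n" where "P = (\<chi> a i. E a i)"
  have 1: "P ** (S ** transpose P) = e *\<^sub>R mat 1"
    unfolding vec_eq_iff P_def
    using E by (auto simp: matrix_matrix_mult_def transpose_def mat_def)
  have r: "B ** (e *\<^sub>R C) = e *\<^sub>R (B ** C)" "(e *\<^sub>R B) ** C = e *\<^sub>R (B ** C)" for B C :: "real^'n^'n"
    by (simp_all add: vec_eq_iff matrix_matrix_mult_def sum_distrib_left mult.left_commute mult.assoc)
  have "P ** (e *\<^sub>R (S ** transpose P)) = mat 1"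
    unfolding r 1 using e by simp
  then have "(e *\<^sub>R (S ** transpose P)) ** P = mat 1"
    by (simp add: matrix_left_right_inverse)
  then have "S ** (e *\<^sub>R (transpose P ** P)) = mat 1"
    by (simp add: r matrix_mul_assoc)
  then have "matrix_inv S ** (S ** (e *\<^sub>R (transpose P ** P))) = matrix_inv S"
    by simp
  then have "matrix_inv S = e *\<^sub>R (transpose P ** P)"
    unfolding matrix_mul_assoc matrix_inv_mult[OF S] by simp
  then show ?thesis
    by (simp add: P_def matrix_matrix_mult_def transpose_def)
qed

subsection \<open>Symmetric cubic forms\<close>

text \<open>Let \<open>P\<close> be the right-hand side of the claim. Then
  \<open>F . P = 3 |\<tau>|^2\<close> and \<open>|P|^2 = 3 (n + 2) |\<tau>|^2\<close>, so
  \<open>|(n + 2) F - P|^2 = (n + 2) ((n + 2) |F|^2 - 3 |\<tau>|^2)\<close>, which the hypothesis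
  makes 0.\<close>

lemma cubic_form_tracefree:
  fixes F :: "'n::finite \<Rightarrow> 'n \<Rightarrow> 'n \<Rightarrow> real"
  assumes s1: "\<And>a b c. F a b c = F b a c" and s2: "\<And>a b c. F a b c = F a c b"
    and \<tau>: "\<And>a. \<tau> a = (\<Sum>b. F a b b)"
    and eq: "(real CARD('n) + 2) * (\<Sum>a. \<Sum>b. \<Sum>c. (F a b c)\<^sup>2) = 3 * (\<Sum>a. (\<tau> a)\<^sup>2)"
  shows "(real CARD('n) + 2) * F a b c = (if b = c then \<tau> a else 0) + (if a = c then \<tau> b else 0)
    + (if a = b then \<tau> c else 0)"
proof -
  let ?n = "real CARD('n)"
  let ?S = "\<lambda>f. \<Sum>a. \<Sum>b. \<Sum>c\<in>(UNIV::'n set). f a b c :: real"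
  define d :: "'n \<Rightarrow> 'n \<Rightarrow> real" where "d a b = (if a = b then 1 else 0)" for a b
  define P where "P a b c = \<tau> a * d b c + \<tau> b * d a c + \<tau> c * d a b" for a b c
  have add: "?S (\<lambda>a b c. f a b c + g a b c) = ?S f + ?S g" for f g by (simp add: sum.distrib)
  have dif: "?S (\<lambda>a b c. f a b c - g a b c) = ?S f - ?S g" for f g by (simp add: sum_subtractf)
  have mul: "?S (\<lambda>a b c. k * f a b c) = k * ?S f" for k f by (simp add: sum_distrib_left)
  have dl: "(\<Sum>c. d b c * f c) = f b" for b and f :: "'n \<Rightarrow> real"
    unfolding d_def by (simp add: if_distrib[of "\<lambda>x. x * _"] cong: if_cong)
  have dr: "(\<Sum>b. d b c * f b) = f c" for c and f :: "'n \<Rightarrow> real"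
    unfolding d_def by (simp add: if_distrib[of "\<lambda>x. x * _"] cong: if_cong)
  have ds: "d a b = d b a" for a b by (simp add: d_def)
  have dd: "d a b * d a b = d a b" for a b by (simp add: d_def)
  have d1: "(\<Sum>c. d b c) = 1" for b using dl[of b "\<lambda>_. 1"] by simp
  let ?t = "\<Sum>a. (\<tau> a)\<^sup>2"
  have FP: "?S (\<lambda>a b c. F a b c * P a b c) = 3 * ?t"
  proof -
    have "?S (\<lambda>a b c. d b c * (F a b c * \<tau> a)) = (\<Sum>a. \<tau> a * (\<Sum>b. F a b b))"
      by (simp add: dl sum_distrib_left mult.commute)
    then have 1: "?S (\<lambda>a b c. d b c * (F a b c * \<tau> a)) = ?t"
      by (simp add: \<tau>[symmetric] power2_eq_square)
    have "?S (\<lambda>a b c. d a c * (F a b c * \<tau> b)) = (\<Sum>a. \<Sum>b. \<tau> b * F b a a)"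
      by (simp add: dl s1[of _ b for b] s2[of b _ a for a b] mult.commute)
    also have "\<dots> = (\<Sum>b. \<tau> b * (\<Sum>a. F b a a))"
      unfolding sum_distrib_left by (rule sum.swap)
    finally have 2: "?S (\<lambda>a b c. d a c * (F a b c * \<tau> b)) = ?t"
      by (simp add: \<tau>[symmetric] power2_eq_square)
    have "?S (\<lambda>a b c. d a b * (F a b c * \<tau> c)) = (\<Sum>a. \<Sum>c. \<Sum>b. d a b * (F a b c * \<tau> c))"
      by (intro sum.cong refl sum.swap)
    also have "\<dots> = (\<Sum>a. \<Sum>c. \<tau> c * F c a a)"
      unfolding dl by (intro sum.cong refl) (metis s1 s2 mult.commute)
    also have "\<dots> = (\<Sum>c. \<tau> c * (\<Sum>a. F c a a))"
      unfolding sum_distrib_left by (rule sum.swap)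
    finally have 3: "?S (\<lambda>a b c. d a b * (F a b c * \<tau> c)) = ?t"
      by (simp add: \<tau>[symmetric] power2_eq_square)
    have "?S (\<lambda>a b c. F a b c * P a b c) = ?S (\<lambda>a b c. d b c * (F a b c * \<tau> a))
       + ?S (\<lambda>a b c. d a c * (F a b c * \<tau> b)) + ?S (\<lambda>a b c. d a b * (F a b c * \<tau> c))"
      unfolding add[symmetric] P_def by (simp add: algebra_simps)
    then show ?thesis using 1 2 3 by simp
  qed
  have PP: "?S (\<lambda>a b c. P a b c * P a b c) = 3 * (?n + 2) * ?t"
  proof -
    have "P a b c * P a b c = d b c * (\<tau> a)\<^sup>2 + d a c * (\<tau> b)\<^sup>2 + d a b * (\<tau> c)\<^sup>2
       + 2 * (d b c * (d a c * (\<tau> a * \<tau> b))) + 2 * (d b c * (d a b * (\<tau> a * \<tau> c)))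
       + 2 * (d a c * (d a b * (\<tau> b * \<tau> c)))" for a b c
      unfolding P_def by (simp add: algebra_simps power2_eq_square) (simp add: d_def)
    then have "?S (\<lambda>a b c. P a b c * P a b c) = ?S (\<lambda>a b c. d b c * (\<tau> a)\<^sup>2)
      + ?S (\<lambda>a b c. d a c * (\<tau> b)\<^sup>2) + ?S (\<lambda>a b c. d a b * (\<tau> c)\<^sup>2)
      + 2 * ?S (\<lambda>a b c. d b c * (d a c * (\<tau> a * \<tau> b))) + 2 * ?S (\<lambda>a b c. d b c * (d a b * (\<tau> a * \<tau> c)))
      + 2 * ?S (\<lambda>a b c. d a c * (d a b * (\<tau> b * \<tau> c)))"
      by (simp only: add mul)
    moreover have "?S (\<lambda>a b c. d b c * (\<tau> a)\<^sup>2) = ?n * ?t"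
      unfolding dl by (simp add: sum_distrib_left)
    moreover have "?S (\<lambda>a b c. d a c * (\<tau> b)\<^sup>2) = ?n * ?t"
      unfolding dl by simp
    moreover have "?S (\<lambda>a b c. d a b * (\<tau> c)\<^sup>2) = ?n * ?t"
      unfolding sum_distrib_left[symmetric] sum_distrib_right[symmetric] d1 by simp
    moreover have "?S (\<lambda>a b c. d b c * (d a c * (\<tau> a * \<tau> b))) = ?t"
      unfolding dl by (simp add: power2_eq_square)
    moreover have "?S (\<lambda>a b c. d b c * (d a b * (\<tau> a * \<tau> c))) = ?t"
      unfolding dl by (simp add: power2_eq_square)
    moreover have "?S (\<lambda>a b c. d a c * (d a b * (\<tau> b * \<tau> c))) = ?t"
      unfolding dl by (simp add: power2_eq_square)
    ultimately show ?thesis by (simp add: algebra_simps)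
  qed
  \<comment> \<open>This is \<open>n + 2\<close> times the trace-free part of
    \<open>F\<close>.\<close>
  define R where "R a b c = (?n + 2) * F a b c - P a b c" for a b c
  have "?S (\<lambda>a b c. (R a b c)\<^sup>2) = (?n + 2)\<^sup>2 * ?S (\<lambda>a b c. (F a b c)\<^sup>2)
     - 2 * (?n + 2) * ?S (\<lambda>a b c. F a b c * P a b c) + ?S (\<lambda>a b c. P a b c * P a b c)"
    unfolding mul[symmetric] add[symmetric] dif[symmetric] R_def
    by (simp add: power2_eq_square algebra_simps)
  also have "\<dots> = (?n + 2) * ((?n + 2) * ?S (\<lambda>a b c. (F a b c)\<^sup>2)) - 3 * (?n + 2) * ?t"
    unfolding FP PP by (simp add: power2_eq_square algebra_simps)
  also have "\<dots> = 0" unfolding eq by simp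
  finally have "?S (\<lambda>a b c. (R a b c)\<^sup>2) = 0" .
  then have "(\<Sum>b. \<Sum>c. (R a b c)\<^sup>2) = 0"
    by (subst (asm) sum_nonneg_eq_0_iff) (auto intro!: sum_nonneg)
  then have "(\<Sum>c. (R a b c)\<^sup>2) = 0"
    by (subst (asm) sum_nonneg_eq_0_iff) (auto intro!: sum_nonneg)
  then have "(R a b c)\<^sup>2 = 0"
    by (subst (asm) sum_nonneg_eq_0_iff) auto
  then show ?thesis unfolding R_def P_def d_def by (auto split: if_splits)
qed

subsection \<open>Proportional differentials\<close>

text \<open>If \<open>dg = h dw\<close> then the i-th component of \<open>g\<close> depends only on the i-th coordinate, hence so
  does \<open>h\<close>, for each \<open>i\<close>. No regularity of \<open>h\<close> is available or needed.\<close>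

lemma conformal_factor_constant:
  fixes g :: "real^'n::finite \<Rightarrow> real^'n" and h :: "real^'n \<Rightarrow> real"
  assumes n: "CARD('n) \<ge> 2"
    and g: "\<And>w. w \<in> ball p r \<Longrightarrow> (g has_derivative (\<lambda>v. h w *\<^sub>R v)) (at w)"
    and w: "w \<in> ball p r"
  shows "h w = h p"
proof -
  have slice: "h a = h b" if ab: "a \<in> ball p r" "b \<in> ball p r" "a $ i = b $ i" for a b i
  proof -
    have gi: "((\<lambda>w. g w $ i) has_derivative (\<lambda>v. h w * v $ i)) (at w)" if "w \<in> ball p r" for w
      using bounded_linear.has_derivative[OF bounded_linear_vec_nth g[OF that], of i] by simp
    \<comment> \<open>Along a segment on which the \<open>i\<close>-th coordinate is fixed, the
      derivative of the \<open>i\<close>-th component of \<open>g\<close> is \<open>h\<close> times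
      0.\<close>
    have eq: "g a' $ i = g b' $ i" if a'b': "a' \<in> ball p r" "b' \<in> ball p r" "a' $ i = b' $ i" for a' b'
    proof -
      let ?l = "\<lambda>t. a' + t *\<^sub>R (b' - a')"
      have l: "?l t \<in> ball p r" if "0 \<le> t" "t \<le> 1" for t
        using convexD_alt[OF convex_ball a'b'(1,2) that] by (simp add: algebra_simps)
      have "((\<lambda>t. g (?l t) $ i) has_real_derivative 0) (at t)" if "0 \<le> t" "t \<le> 1" for t
      proof -
        have 1: "(?l has_derivative (\<lambda>s. s *\<^sub>R (b' - a'))) (at t)"
          by (auto intro!: derivative_eq_intros)
        have "((\<lambda>t. g (?l t) $ i) has_derivative (\<lambda>s. h (?l t) * (s *\<^sub>R (b' - a')) $ i)) (at t)"
          using has_derivative_compose[OF 1 gi[OF l[OF that]]] .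
        then show ?thesis using a'b'(3) by (simp add: has_field_derivative_def lambda_zero)
      qed
      then obtain t where "g (?l 1) $ i - g (?l 0) $ i = (1 - 0) * 0"
        using MVT2[of 0 1 "\<lambda>t. g (?l t) $ i" "\<lambda>_. 0"] by auto
      then show ?thesis by simp
    qed
    define m where "m = min (r - dist p a) (r - dist p b)"
    have m: "m > 0" using ab by (simp add: m_def)
    have dl: "((\<lambda>s. g (a + s *\<^sub>R axis i 1) $ i) has_real_derivative h a) (at 0)" if "a \<in> ball p r" for a
    proof -
      have 1: "((\<lambda>s::real. a + s *\<^sub>R axis i 1) has_derivative (\<lambda>s. s *\<^sub>R axis i 1)) (at 0)"
        by (auto intro!: derivative_eq_intros)
      have "((\<lambda>s. g (a + s *\<^sub>R axis i 1) $ i) has_derivative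
          (\<lambda>s. h a * (s *\<^sub>R (axis i 1 :: real^'n)) $ i)) (at 0)"
        using has_derivative_compose[OF 1, of "\<lambda>w. g w $ i" "\<lambda>v. h a * v $ i"] gi[OF that] by simp
      then show ?thesis by (simp add: has_field_derivative_def)
    qed
    have inb: "c + s *\<^sub>R axis i 1 \<in> ball p r" if "\<bar>s\<bar> < m" "c \<in> {a, b}" for c s
    proof -
      have "dist p (c + s *\<^sub>R axis i 1) \<le> dist p c + norm (s *\<^sub>R (axis i 1 :: real^'n))"
        by (metis dist_add_cancel2 dist_norm dist_triangle add.right_neutral add_diff_cancel_left' dist_commute)
      then show ?thesis using that by (auto simp: m_def)
    qed
    \<comment> \<open>On the parallel lines through \<open>a\<close> and \<open>b\<close> the
      \<open>i\<close>-th component of \<open>g\<close> is the same function of \<open>s\<close>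
      near 0, so its derivatives \<open>h a\<close> and \<open>h b\<close> agree.\<close>
    have "((\<lambda>s. g (a + s *\<^sub>R axis i 1) $ i) has_real_derivative h b) (at 0)"
    proof (rule has_field_derivative_transform_within_open[OF dl[OF ab(2)], of "ball 0 m"])
      fix s :: real assume "s \<in> ball 0 m"
      then show "g (b + s *\<^sub>R axis i 1) $ i = g (a + s *\<^sub>R axis i 1) $ i"
        using eq[OF inb[of s b] inb[of s a]] ab(3) by simp
    qed (use m in auto)
    then show ?thesis using dl[OF ab(1)] DERIV_unique by blast
  qed
  obtain i j :: 'n where ij: "i \<noteq> j"
    using n card_le_Suc0_iff_eq[OF finite_class.finite_UNIV[where 'a='n]] by fastforce
  \<comment> \<open>This point agrees with \<open>w\<close> in the coordinate \<open>i\<close> and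
    with \<open>p\<close> in the coordinate \<open>j\<close>, so two applications of
    \<open>slice\<close> join \<open>w\<close> to \<open>p\<close>. Here dimension at least 2
    enters.\<close>
  define w' where "w' = (\<chi> k. if k = j then p $ j else w $ k)"
  have "norm (w' - p) \<le> norm (w - p)"
    by (rule norm_le_componentwise_cart) (simp add: w'_def)
  then have w': "w' \<in> ball p r" using w by (simp add: dist_norm norm_minus_commute)
  have "h w = h w'" by (rule slice[OF w w', of i]) (use ij in \<open>simp add: w'_def\<close>)
  moreover have "h w' = h p"
    by (rule slice[OF w', of p j]) (use w in \<open>auto simp: w'_def intro: le_less_trans[OF zero_le_dist]\<close>)
  ultimately show ?thesis by simp
qed

subsection \<open>Darboux tensors that are pure trace\<close>

context relative_frame
begin

lemma quadratic_contraction_frame: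
  assumes Q: "\<And>i j. Q i j u = e * (\<Sum>a. E a i * E a j)"
  shows "(\<Sum>i. \<Sum>j. Q i j u * H i j) = e * (\<Sum>a. \<Sum>i. E a i * (\<Sum>j. E a j * H i j))"
proof -
  have "(\<Sum>i. \<Sum>j. Q i j u * H i j) = (\<Sum>i. \<Sum>j. \<Sum>a. e * (E a i * (E a j * H i j)))"
    unfolding Q by (simp add: sum_distrib_left sum_distrib_right mult.assoc)
  also have "\<dots> = (\<Sum>i. \<Sum>a. \<Sum>j. e * (E a i * (E a j * H i j)))"
    by (intro sum.cong refl sum.swap)
  also have "\<dots> = (\<Sum>a. \<Sum>i. \<Sum>j. e * (E a i * (E a j * H i j)))"
    by (rule sum.swap)
  finally show ?thesis by (simp add: sum_distrib_left)
qed

lemma quadratic_contraction_frame2: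
  assumes Q: "\<And>i j. Q i j u = e * (\<Sum>a. E a i * E a j)"
  shows "(\<Sum>i. \<Sum>j. Q i j u * (f i * g j))
    = e * (\<Sum>a. (\<Sum>i. E a i * f i) * (\<Sum>j. E a j * g j))"
  unfolding quadratic_contraction_frame[OF Q] sum_product
  by (simp add: sum_distrib_left ac_simps)

text \<open>The inverse metric is built from the frame. A covector that vanishes on the frame is
  therefore 0 once its index is raised, and lowering the index recovers it.\<close>

lemma frame_injective:
  assumes u: "u \<in> D" and e: "e * e = (1::real)" and Q: "\<And>i j. Q i j u = e * (\<Sum>a. E a i * E a j)"
    and z: "\<And>a. (\<Sum>j. E a j * f j) = 0"
  shows "f i = 0"
proof -
  have "f i = (\<Sum>k. G i k u * (\<Sum>j. Q k j u * f j))"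
    using delta_contract[OF GQ[OF u]] by simp
  also have "\<dots> = 0"
  proof (intro sum.neutral ballI)
    fix k
    have "(\<Sum>j. Q k j u * f j) = (\<Sum>j. \<Sum>a. e * E a k * (E a j * f j))"
      unfolding Q by (simp add: sum_distrib_left sum_distrib_right ac_simps)
    also have "\<dots> = (\<Sum>a. e * E a k * (\<Sum>j. E a j * f j))"
      unfolding sum_distrib_left by (rule sum.swap)
    finally show "G i k u * (\<Sum>j. Q k j u * f j) = 0" by (simp add: z)
  qed
  finally show ?thesis .
qed

text \<open>In an orthonormal frame the norms of the tensor and of its trace become sums of squares
  with the common factor \<open>e\<close>. The factor cancels from (b), and
  \<open>cubic_form_tracefree\<close> applies.\<close>

lemma darboux_pure_trace:
  assumes u: "u \<in> D" and two: "real CARD('n) \<ge> 2" and def: "definite_form (rel_metric x y u)"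
    and b: "3 * real CARD('n) * tchebychev_norm x y u
      = (real CARD('n) - 1) * (real CARD('n) + 2) * pick x y u"
  defines "\<tau> \<equiv> \<lambda>p. \<Sum>m. \<A> m p m u"
  shows "(real CARD('n) + 2) * A j k l u = \<tau> j * G k l u + \<tau> k * G j l u + \<tau> l * G j k u"
proof -
  let ?n = "real CARD('n)"
  obtain e :: real and E :: "'n \<Rightarrow> 'n \<Rightarrow> real" where e: "e * e = 1" and
    E: "\<And>a b. (\<Sum>i. E a i * (\<Sum>j. G i j u * E b j)) = (if a = b then e else 0)"
    by (rule definite_orthonormal_frame[of "rel_metric x y u", OF G_sym[OF u] def]) (rule that)
  have Q: "Q i j u = e * (\<Sum>a. E a i * E a j)" for i j
    by (rule orthonormal_frame_inverse[OF e det_metric[OF u] E])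
  define ev where "ev f a = (\<Sum>i. E a i * f i)" for f :: "'n \<Rightarrow> real" and a
  note L1 = quadratic_contraction_frame[OF Q, folded ev_def]
  note L2 = quadratic_contraction_frame2[OF Q, folded ev_def]
  note L3 = frame_injective[OF u e Q, folded ev_def]
  have L0: "(\<Sum>i. \<Sum>j. Q i j u * (\<Sum>c\<in>K. H c i j)) = (\<Sum>c\<in>K. \<Sum>i. \<Sum>j. Q i j u * H c i j)"
    for K :: "'n set" and H
    unfolding sum_distrib_left
    by (rule trans[OF sum.cong[OF refl sum.swap] sum.swap])
  have ev_sum: "ev (\<lambda>i. \<Sum>k\<in>K. f i k) a = (\<Sum>k\<in>K. ev (\<lambda>i. f i k) a)" for f a and K :: "'n set"
    unfolding ev_def sum_distrib_left by (rule sum.swap)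
  have ev_mul: "ev (\<lambda>i. f i * c) a = ev f a * c" "ev (\<lambda>i. c * f i) a = c * ev f a" for f a c
    by (simp_all add: ev_def sum_distrib_left sum_distrib_right ac_simps)
  have ev_dif: "ev (\<lambda>i. f i - g i) a = ev f a - ev g a" for f g a
    by (simp add: ev_def sum_subtractf right_diff_distrib)
  have ev_swap: "ev (\<lambda>i. ev (\<lambda>j. f i j) b) a = ev (\<lambda>j. ev (\<lambda>i. f i j) a) b" for f a b
    unfolding ev_def sum_distrib_left by (subst sum.swap) (simp add: mult.left_commute)
  have evG: "ev (\<lambda>i. ev (\<lambda>j. G i j u) b) a = (if a = b then e else 0)" for a b
    using E[of a b] by (simp add: ev_def mult.commute)
  define F where "F a b c = ev (\<lambda>j. ev (\<lambda>k. ev (\<lambda>l. A j k l u) c) b) a" for a b c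
  have s1: "F a b c = F b a c" for a b c
    unfolding F_def by (subst ev_swap) (simp add: darboux_sym12[OF u])
  have s2: "F a b c = F a c b" for a b c
    unfolding F_def by (subst (2) ev_swap) (simp add: darboux_sym23[OF u])
  \<comment> \<open>Each of the three inverse metrics contributes a factor \<open>e\<close>, and
    \<open>e^3 = e\<close>.\<close>
  have J: "?n * (?n - 1) * pick x y u = e * (\<Sum>a. \<Sum>b. \<Sum>c. (F a b c)\<^sup>2)"
  proof -
    let ?g = "\<lambda>j k l j' k' l'. Q j j' u * Q k k' u * Q l l' u * A j k l u * A j' k' l' u"
    have inner: "(\<Sum>k. \<Sum>k'. Q k k' u * (\<Sum>l. \<Sum>l'. Q l l' u * (A j k l u * A j' k' l' u)))
        = (\<Sum>c. \<Sum>b. ev (\<lambda>k. ev (\<lambda>l. A j k l u) c) b * ev (\<lambda>k. ev (\<lambda>l. A j' k l u) c) b)" for j j'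
    proof -
      have "(\<Sum>k. \<Sum>k'. Q k k' u * (\<Sum>l. \<Sum>l'. Q l l' u * (A j k l u * A j' k' l' u)))
        = (\<Sum>k. \<Sum>k'. Q k k' u * (\<Sum>c. e * (ev (\<lambda>l. A j k l u) c * ev (\<lambda>l. A j' k' l u) c)))"
        unfolding L2 by (simp add: sum_distrib_left)
      also have "\<dots> = (\<Sum>c. \<Sum>k. \<Sum>k'. Q k k' u * (e * (ev (\<lambda>l. A j k l u) c * ev (\<lambda>l. A j' k' l u) c)))"
        by (rule L0)
      also have "\<dots> = (\<Sum>c. e * (\<Sum>k. \<Sum>k'. Q k k' u * (ev (\<lambda>l. A j k l u) c * ev (\<lambda>l. A j' k' l u) c)))"
        by (simp add: sum_distrib_left mult.left_commute)
      also have "\<dots> = (\<Sum>c. (e * e) * (\<Sum>b. ev (\<lambda>k. ev (\<lambda>l. A j k l u) c) b * ev (\<lambda>k. ev (\<lambda>l. A j' k l u) c) b))"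
        unfolding L2 by (simp add: mult.assoc)
      finally show ?thesis by (simp add: e)
    qed
    have "?n * (?n - 1) * pick x y u = (\<Sum>j. \<Sum>k. \<Sum>l. \<Sum>j'. \<Sum>k'. \<Sum>l'. ?g j k l j' k' l')"
      using two unfolding pick_def by simp
    also have "\<dots> = (\<Sum>j. \<Sum>k. \<Sum>j'. \<Sum>l. \<Sum>k'. \<Sum>l'. ?g j k l j' k' l')"
      by (intro sum.cong refl sum.swap)
    also have "\<dots> = (\<Sum>j. \<Sum>j'. \<Sum>k. \<Sum>l. \<Sum>k'. \<Sum>l'. ?g j k l j' k' l')"
      by (intro sum.cong refl sum.swap)
    also have "\<dots> = (\<Sum>j. \<Sum>j'. \<Sum>k. \<Sum>k'. \<Sum>l. \<Sum>l'. ?g j k l j' k' l')"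
      by (intro sum.cong refl sum.swap)
    also have "\<dots> = (\<Sum>j. \<Sum>j'. Q j j' u * (\<Sum>k. \<Sum>k'. Q k k' u *
        (\<Sum>l. \<Sum>l'. Q l l' u * (A j k l u * A j' k' l' u))))"
      by (simp add: sum_distrib_left mult.assoc)
    also have "\<dots> = (\<Sum>j. \<Sum>j'. Q j j' u * (\<Sum>c. \<Sum>b.
        ev (\<lambda>k. ev (\<lambda>l. A j k l u) c) b * ev (\<lambda>k. ev (\<lambda>l. A j' k l u) c) b))"
      by (simp only: inner)
    also have "\<dots> = (\<Sum>c. \<Sum>b. e * (\<Sum>a. F a b c * F a b c))"
      unfolding L0 L2 F_def ..
    also have "\<dots> = (\<Sum>b. \<Sum>c. \<Sum>a. e * (F a b c * F a b c))"
      unfolding sum_distrib_left by (rule sum.swap)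
    also have "\<dots> = (\<Sum>b. \<Sum>a. \<Sum>c. e * (F a b c * F a b c))"
      by (intro sum.cong refl sum.swap)
    also have "\<dots> = (\<Sum>a. \<Sum>b. \<Sum>c. e * (F a b c * F a b c))"
      by (rule sum.swap)
    finally show ?thesis by (simp add: sum_distrib_left power2_eq_square)
  qed
  define t where "t a = (\<Sum>b. F a b b)" for a
  have \<tau>: "ev \<tau> a = e * t a" for a
  proof -
    have "\<tau> = (\<lambda>p. e * (\<Sum>b. ev (\<lambda>i. ev (\<lambda>j. A i j p u) b) b))"
      unfolding \<tau>_def darboux_trace(1)[OF u] L1 by (simp add: ev_def)
    then have "ev \<tau> a = e * (\<Sum>b. ev (\<lambda>p. ev (\<lambda>i. ev (\<lambda>j. A i j p u) b) b) a)"
      by (simp add: ev_mul ev_sum)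
    also have "(\<lambda>p i j. A i j p u) = (\<lambda>p i j. A p i j u)"
      by (intro ext) (metis darboux_sym12[OF u] darboux_sym23[OF u])
    then have "(\<Sum>b. ev (\<lambda>p. ev (\<lambda>i. ev (\<lambda>j. A i j p u) b) b) a) = t a"
      unfolding t_def F_def by (metis (no_types))
    finally show ?thesis .
  qed
  \<comment> \<open>Again \<open>e^3 = e\<close>: one factor from the inverse metric, two from
    evaluating \<open>\<tau>\<close> on the frame.\<close>
  have T: "(real CARD('n))\<^sup>2 * tchebychev_norm x y u = e * (\<Sum>a. (t a)\<^sup>2)"
  proof -
    let ?T = "\<lambda>m. tchebychev x y u $ m"
    have lower: "\<tau> p = (\<Sum>m. G p m u * (?n * ?T m))" for p
      unfolding \<tau>_def darboux_trace(2)[OF u] by (simp add: sum_distrib_left mult.left_commute)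
    have raise: "?n * ?T m = (\<Sum>p. Q m p u * \<tau> p)" for m
      unfolding lower using delta_contract[OF QG[OF u], of m "\<lambda>m. ?n * ?T m"] by simp
    have "?n\<^sup>2 * tchebychev_norm x y u = (\<Sum>p. (?n * ?T p) * \<tau> p)"
      unfolding lower tchebychev_norm_def by (simp add: sum_distrib_left power2_eq_square ac_simps)
    also have "\<dots> = (\<Sum>p. \<Sum>m. Q p m u * (\<tau> p * \<tau> m))"
      unfolding raise by (simp add: sum_distrib_left sum_distrib_right ac_simps)
    also have "\<dots> = e * (\<Sum>a. (e * e) * (t a * t a))"
      unfolding L2 \<tau> by (simp add: ac_simps)
    finally show ?thesis unfolding e by (simp add: power2_eq_square)
  qed
  \<comment> \<open>Property (b) multiplied by \<open>n\<close>, to match the normalizations in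
    \<open>T\<close> and \<open>J\<close>.\<close>
  have "3 * (?n\<^sup>2 * tchebychev_norm x y u) = (?n + 2) * (?n * (?n - 1) * pick x y u)"
    using arg_cong[OF b, of "\<lambda>z. ?n * z"] by (simp add: power2_eq_square ac_simps)
  then have "e * (3 * (\<Sum>a. (t a)\<^sup>2)) = e * ((?n + 2) * (\<Sum>a. \<Sum>b. \<Sum>c. (F a b c)\<^sup>2))"
    unfolding T J by (simp add: mult.left_commute)
  then have eq: "(?n + 2) * (\<Sum>a. \<Sum>b. \<Sum>c. (F a b c)\<^sup>2) = 3 * (\<Sum>a. (t a)\<^sup>2)"
    using e by (metis mult_cancel_left mult_zero_left zero_neq_one)
  have F: "(?n + 2) * F a b c = (if b = c then t a else 0) + (if a = c then t b else 0)
    + (if a = b then t c else 0)" for a b c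
    by (rule cubic_form_tracefree[OF s1 s2 t_def eq])
  define R where "R j k l = (?n + 2) * A j k l u - \<tau> j * G k l u - \<tau> k * G j l u - \<tau> l * G j k u" for j k l
  have z1: "ev (\<lambda>j. ev (\<lambda>k. ev (\<lambda>l. R j k l) c) b) a = 0" for a b c
  proof -
    have r1: "ev (\<lambda>j. ev (\<lambda>k. ev (\<lambda>l. \<tau> k * G j l u) c) b) a = ev \<tau> b * (if a = c then e else 0)"
      unfolding ev_mul evG ..
    have r2: "ev (\<lambda>j. ev (\<lambda>k. ev (\<lambda>l. \<tau> j * G k l u) c) b) a = ev \<tau> a * (if b = c then e else 0)"
      unfolding ev_mul evG ..
    have r3: "ev (\<lambda>j. ev (\<lambda>k. ev (\<lambda>l. \<tau> l * G j k u) c) b) a = ev \<tau> c * (if a = b then e else 0)"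
      unfolding ev_mul evG ..
    have r4: "ev (\<lambda>j. ev (\<lambda>k. ev (\<lambda>l. (?n + 2) * A j k l u) c) b) a = (?n + 2) * F a b c"
      unfolding ev_mul F_def ..
    have ee: "e * z * (if P then e else 0) = (if P then z else 0)" for z and P
      using e by (simp add: mult.commute mult.left_commute)
    show ?thesis
      unfolding R_def ev_dif r1 r2 r3 r4 \<tau> F ee by simp
  qed
  \<comment> \<open>\<open>R\<close> vanishes on all triples of frame vectors; the frame is now
    removed slot by slot.\<close>
  have z2: "ev (\<lambda>k. ev (\<lambda>l. R j k l) c) b = 0" for j b c
    by (rule L3[of "\<lambda>j. ev (\<lambda>k. ev (\<lambda>l. R j k l) c) b" j]) (rule z1)
  have z3: "ev (\<lambda>l. R j k l) c = 0" for j k c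
    by (rule L3[of "\<lambda>k. ev (\<lambda>l. R j k l) c" k]) (rule z2)
  have "R j k l = 0"
    by (rule L3[of "\<lambda>l. R j k l" l]) (rule z3)
  then show ?thesis unfolding R_def by simp
qed

end

subsection \<open>Change of normalization\<close>

text \<open>Squaring under the logarithm avoids a case distinction on the sign of
  \<open>d\<close>.\<close>

lemma ln_square_chain:
  fixes d :: "real^'n::finite \<Rightarrow> real"
  assumes "d differentiable at u" "d u \<noteq> 0" "pd l d u = c * d u"
  shows "(\<lambda>v. ln ((d v)\<^sup>2)) differentiable at u" "pd l (\<lambda>v. ln ((d v)\<^sup>2)) u = 2 * c"
proof -
  have "((\<lambda>t. ln (t\<^sup>2)) has_real_derivative (2 / d u)) (at (d u))"
    using assms(2) by (auto intro!: derivative_eq_intros simp: field_simps power2_eq_square zero_less_mult_iff linorder_neq_iff)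
  from pd_chain_real(1)[OF assms(1) this] pd_chain_real(2)[OF assms(1) this, of l]
  show "(\<lambda>v. ln ((d v)\<^sup>2)) differentiable at u" "pd l (\<lambda>v. ln ((d v)\<^sup>2)) u = 2 * c"
    using assms by simp_all
qed

context relative_frame
begin

text \<open>Metric compatibility puts connection terms on both sides of \<open>G\<close>.
  Conjugating one of them by \<open>G\<close> gives the form \<open>W G\<close> that
  \<open>pd_det\<close> wants; conjugation preserves the trace, whence the factor 2.\<close>

lemma pd_det_metric:
  assumes u: "u \<in> D"
  shows "pd l (\<lambda>v. det (rel_metric x y v)) u = (2 * (\<Sum>m. \<Gamma> m l m u)) * det (rel_metric x y u)"
proof -
  define W where "W i k = \<Gamma> k l i u + (\<Sum>p. G i p u * (\<Sum>r. \<Gamma> p l r u * Q r k u))" for i k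
  have W: "pd l (\<lambda>v. G i j v) u = (\<Sum>k. W i k * G k j u)" for i j
  proof -
    have "(\<Sum>k. (\<Sum>p. G i p u * (\<Sum>r. \<Gamma> p l r u * Q r k u)) * G k j u)
      = (\<Sum>k. \<Sum>p. G i p u * ((\<Sum>r. \<Gamma> p l r u * Q r k u) * G k j u))"
      by (simp add: sum_distrib_right mult.assoc)
    also have "\<dots> = (\<Sum>p. G i p u * (\<Sum>k. \<Sum>r. \<Gamma> p l r u * (Q r k u * G k j u)))"
      by (subst sum.swap) (simp add: sum_distrib_left sum_distrib_right mult.assoc)
    also have "\<dots> = (\<Sum>p. G i p u * (\<Sum>r. \<Gamma> p l r u * (\<Sum>k. Q r k u * G k j u)))"
      unfolding sum_distrib_left by (intro sum.cong refl sum.swap)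
    also have "\<dots> = (\<Sum>p. \<Gamma> p l j u * G i p u)"
      unfolding QG[OF u] by (simp add: if_distrib mult.commute cong: if_cong)
    finally show ?thesis
      unfolding W_def dG_christoffel[OF u] by (simp add: distrib_right sum.distrib)
  qed
  have "(\<Sum>i. \<Sum>p. G i p u * (\<Sum>r. \<Gamma> p l r u * Q r i u))
    = (\<Sum>p. \<Sum>i. \<Sum>r. \<Gamma> p l r u * (Q r i u * G i p u))"
    by (subst sum.swap) (simp add: sum_distrib_left ac_simps)
  also have "\<dots> = (\<Sum>p. \<Sum>r. \<Gamma> p l r u * (\<Sum>i. Q r i u * G i p u))"
    unfolding sum_distrib_left by (intro sum.cong refl sum.swap)
  also have "\<dots> = (\<Sum>p. \<Gamma> p l p u)"
    unfolding QG[OF u] by (simp add: if_distrib cong: if_cong)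
  finally have tr: "(\<Sum>i. W i i) = 2 * (\<Sum>m. \<Gamma> m l m u)"
    unfolding W_def by (simp add: sum.distrib)
  show ?thesis
    unfolding tr[symmetric] by (rule pd_det[OF metric_nth_diff[OF u] W])
qed

text \<open>The trace of \<open>\<A>\<close> is the differential of the logarithm of the ratio of the two volume forms
  that are parallel for \<open>\<Theta>\<close> and \<open>\<Gamma>\<close>: the volume form induced by \<open>y\<close>, computed in a fixed basis,
  and that of the relative metric.\<close>

lemma darboux_trace_potential:
  obtains f where "\<And>u. u \<in> D \<Longrightarrow> f differentiable at u"
    "\<And>u l. u \<in> D \<Longrightarrow> pd l f u = (\<Sum>m. \<A> m l m u)"
proof -
  have "card (UNIV :: 'n option set) = card (Basis :: 'b set)"
    using dim by (simp add: card_UNIV_option)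
  then obtain \<beta> where \<beta>: "bij_betw \<beta> (UNIV :: 'n option set) (Basis :: 'b set)"
    using finite_same_card_bij[OF finite_class.finite_UNIV finite_Basis] by metis
  \<comment> \<open>Extending the index type by \<open>None\<close> for \<open>y\<close> makes the
    frame a square matrix with respect to the enumerated basis \<open>\<beta>\<close> of the ambient
    space.\<close>
  define fr :: "'n option \<Rightarrow> real^'n \<Rightarrow> 'b" where
    "fr a = (case a of None \<Rightarrow> y | Some i \<Rightarrow> pd i x)" for a
  define M :: "real^'n \<Rightarrow> real^('n option)^('n option)" where "M u = (\<chi> a c. fr a u \<bullet> \<beta> c)" for u
  have sum_opt: "(\<Sum>a. g a) = g None + (\<Sum>i. g (Some i))" for g :: "'n option \<Rightarrow> 'c::comm_monoid_add"
    unfolding UNIV_option_conv by (subst sum.insert) (auto simp: sum.reindex)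
  have fr_diff: "fr a differentiable at u" if "u \<in> D" for a u
    using that by (auto simp: fr_def y_diff dx_diff split: option.splits)
  have M_diff: "(\<lambda>v. M v $ a $ c) differentiable at u" if "u \<in> D" for a c u
    unfolding M_def using that by (simp add: differentiable_inner_at fr_diff)
  have M_det: "det (M u) \<noteq> 0" if u: "u \<in> D" for u
  proof (rule det_nonzero_if_kernel_trivial)
    fix c assume c: "M u *v c = 0"
    define w where "w = (\<Sum>k. c $ k *\<^sub>R \<beta> k)"
    have z: "w \<bullet> fr a u = 0" for a
    proof -
      have "w \<bullet> fr a u = (M u *v c) $ a"
        by (simp add: w_def M_def matrix_vector_mult_def inner_sum_left inner_commute[of "fr a u"] mult.commute)
      then show ?thesis using c by simp
    qed
    have w0: "w = 0"
      by (rule frame_orthogonal_zero[where e = "\<lambda>i. pd i x u" and y = "y u", OF dim indep[OF u]])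
        (use z[of None] z[of "Some _"] in \<open>auto simp: fr_def\<close>)
    have "c $ k = 0" for k
    proof -
      have \<beta>\<beta>: "\<beta> j \<bullet> \<beta> k = (if j = k then 1 else 0)" for j
        using inner_Basis[of "\<beta> j" "\<beta> k"] \<beta> bij_betwE[OF \<beta>] by (auto simp: bij_betw_def inj_on_def)
      have "w \<bullet> \<beta> k = c $ k"
        unfolding w_def inner_sum_left inner_scaleR_left \<beta>\<beta> by (simp add: if_distrib cong: if_cong)
      then show ?thesis using w0 by simp
    qed
    then show "c = 0" by (simp add: vec_eq_iff)
  qed
  have M_pd: "pd l (\<lambda>v. det (M v)) u = (\<Sum>m. \<Theta> m l m u) * det (M u)" if u: "u \<in> D" for l u
  proof -
    \<comment> \<open>The structure equations of the frame as one matrix. Since the derivatives of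
      \<open>y\<close> are tangential, its last diagonal entry is 0 and its trace is that of
      \<open>\<Theta>\<close>.\<close>
    define W where "W a k = (case a of
        None \<Rightarrow> (case k of None \<Rightarrow> 0 | Some m \<Rightarrow> - B l m u)
      | Some i \<Rightarrow> (case k of None \<Rightarrow> G i l u | Some m \<Rightarrow> \<Theta> m i l u))" for a k :: "'n option"
    have "pd l (fr a) u = (\<Sum>k. W a k *\<^sub>R fr k u)" for a
      by (cases a) (simp_all add: sum_opt fr_def W_def shape[OF u] ddx_expand[OF u, of l] sum_negf)
    then have "pd l (\<lambda>v. M v $ a $ c) u = (\<Sum>k. W a k * M u $ k $ c)" for a c
      unfolding M_def by (simp add: pd_inner fr_diff[OF u] inner_sum_left)
    from pd_det[OF M_diff[OF u] this]
    have "pd l (\<lambda>v. det (M v)) u = (\<Sum>a. W a a) * det (M u)" by simp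
    also have "(\<Sum>a. W a a) = (\<Sum>m. \<Theta> m l m u)"
      unfolding sum_opt by (simp add: W_def \<Theta>_sym[OF u, of _ l])
    finally show ?thesis .
  qed
  \<comment> \<open>The logarithmic derivatives of \<open>det M\<close> and \<open>det G\<close> are
    the trace of \<open>\<Theta>\<close> and twice that of \<open>\<Gamma>\<close>; the squares
    double both, so the factors 1/2 and 1/4 leave the difference of the traces.\<close>
  define f where "f u = (1/2) * ln ((det (M u))\<^sup>2) - (1/4) * ln ((det (rel_metric x y u))\<^sup>2)" for u
  have fM: "(\<lambda>v. ln ((det (M v))\<^sup>2)) differentiable at u"
    "pd l (\<lambda>v. ln ((det (M v))\<^sup>2)) u = 2 * (\<Sum>m. \<Theta> m l m u)" if u: "u \<in> D" for u l
    by (rule ln_square_chain[OF differentiable_det[OF M_diff[OF u]] M_det[OF u] M_pd[OF u]])+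
  have fG: "(\<lambda>v. ln ((det (rel_metric x y v))\<^sup>2)) differentiable at u"
    "pd l (\<lambda>v. ln ((det (rel_metric x y v))\<^sup>2)) u = 2 * (2 * (\<Sum>m. \<Gamma> m l m u))" if u: "u \<in> D" for u l
    by (rule ln_square_chain[OF differentiable_det[OF metric_nth_diff[OF u]] det_metric[OF u] pd_det_metric[OF u]])+
  show ?thesis
  proof (rule that[of f])
    fix u assume u: "u \<in> D"
    show "f differentiable at u"
      unfolding f_def[abs_def] by (intro differentiable_diff differentiable_mult differentiable_const fM fG u)
    fix l
    have "pd l f u = (1/2) * (2 * (\<Sum>m. \<Theta> m l m u)) - (1/4) * (2 * (2 * (\<Sum>m. \<Gamma> m l m u)))"
      unfolding f_def[abs_def] fM(2)[OF u, symmetric] fG(2)[OF u, symmetric]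
        pd_diff[OF differentiable_mult[OF differentiable_const fM(1)[OF u]] differentiable_mult[OF differentiable_const fG(1)[OF u]]]
        pd_mult[OF differentiable_const fM(1)[OF u]] pd_mult[OF differentiable_const fG(1)[OF u]] by simp
    then show "pd l f u = (\<Sum>m. \<A> m l m u)"
      by (simp add: \<A>_def sum_subtractf christoffel_sym[OF u, of _ l])
  qed
qed

text \<open>The normalization with conormal \<open>exp f\<close> times the old one: \<open>y\<close>
  plus the gradient of \<open>f\<close> in the relative metric, scaled by \<open>exp (- f)\<close>.
  The gradient keeps the derivatives tangential.\<close>

definition renormalize :: "(real^'n \<Rightarrow> real) \<Rightarrow> real^'n \<Rightarrow> 'b" where
  "renormalize f u = exp (- f u) *\<^sub>R (y u + (\<Sum>m. (\<Sum>p. Q m p u * pd p f u) *\<^sub>R pd m x u))"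

text \<open>In \<open>darboux_formula\<close> the third derivatives are scaled by
  \<open>exp f\<close>, and each of the three metric derivatives contributes one more term, a
  component of \<open>df\<close> times the metric.\<close>

lemma renormalize:
  assumes f: "\<And>u. u \<in> D \<Longrightarrow> f differentiable at u"
    and df: "\<And>u i. u \<in> D \<Longrightarrow> pd i f differentiable at u"
  shows "relative_frame D x (renormalize f)"
    and "u \<in> D \<Longrightarrow> rel_metric x (renormalize f) u = exp (f u) *\<^sub>R rel_metric x y u"
    and "u \<in> D \<Longrightarrow> darboux x (renormalize f) j k l u =
      exp (f u) * (A j k l u - (pd l f u * G j k u + pd j f u * G k l u + pd k f u * G l j u) / 2)"
proof -
  let ?y = "renormalize f"
  define c where "c m u = (\<Sum>p. Q m p u * pd p f u)" for m u
  have y': "?y = (\<lambda>u. exp (- f u) *\<^sub>R (y u + (\<Sum>m. c m u *\<^sub>R pd m x u)))"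
    unfolding renormalize_def[abs_def] c_def ..
  have c_diff: "c m differentiable at u" if u: "u \<in> D" for m u
    unfolding c_def[abs_def]
    by (intro differentiable_sum ballI differentiable_mult df u finite
        differentiable_matrix_inv[OF open_D u det_metric metric_nth_diff[OF u]])
  have ex: "(\<lambda>u. exp (- f u)) differentiable at u" "(\<lambda>u. exp (f u)) differentiable at u"
    "pd i (\<lambda>u. exp (f u)) u = exp (f u) * pd i f u"  if u: "u \<in> D" for u i
  proof -
    have "((\<lambda>t. exp (- t)) has_real_derivative (- exp (- t))) (at t)" for t :: real
      by (auto intro!: derivative_eq_intros)
    then show "(\<lambda>u. exp (- f u)) differentiable at u" by (rule pd_chain_real(1)[OF f[OF u]])
    show "(\<lambda>u. exp (f u)) differentiable at u" "pd i (\<lambda>u. exp (f u)) u = exp (f u) * pd i f u"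
      using pd_chain_real(1)[OF f[OF u] DERIV_exp] pd_chain_real(2)[OF f[OF u] DERIV_exp, of i] by auto
  qed
  define v where "v u = y u + (\<Sum>m. c m u *\<^sub>R pd m x u)" for u
  have v_diff: "v differentiable at u" if u: "u \<in> D" for u
    unfolding v_def[abs_def]
    by (intro differentiable_sum ballI differentiable_add differentiable_scaleR c_diff y_diff dx_diff u finite)
  have y'v: "?y = (\<lambda>u. exp (- f u) *\<^sub>R v u)" unfolding y' v_def ..
  have y'_diff: "?y differentiable at u" if u: "u \<in> D" for u
    unfolding y'v by (intro differentiable_scaleR ex v_diff u)
  have Xv: "X u \<bullet> v u = 1" if u: "u \<in> D" for u
    using u by (simp add: v_def inner_add_right inner_sum_right X_dx X_y)
  have ind: "(\<forall>i. a i = 0) \<and> b = 0"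
    if u: "u \<in> D" and z: "(\<Sum>i. a i *\<^sub>R pd i x u) + b *\<^sub>R ?y u = 0" for u a b
  proof -
    have "X u \<bullet> ((\<Sum>i. a i *\<^sub>R pd i x u) + b *\<^sub>R ?y u) = b * exp (- f u)"
      using u by (simp add: y'v inner_add_right inner_sum_right X_dx Xv)
    then have b: "b = 0" using z by simp
    then have "(\<Sum>i. a i *\<^sub>R pd i x u) + 0 *\<^sub>R y u = 0" using z by simp
    from indep[OF u this] b show ?thesis by simp
  qed
  have X': "conormal x ?y u = exp (f u) *\<^sub>R X u" if u: "u \<in> D" for u
    by (rule conormal_eqI[OF dim ind[OF u]])
      (simp_all add: X_dx[OF u] y'v Xv[OF u] flip: exp_add)
  show R': "rel_metric x ?y u = exp (f u) *\<^sub>R rel_metric x y u" if u: "u \<in> D" for u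
    using X'[OF u] by (simp add: rel_metric_def vec_eq_iff)
  have tang: "pd i ?y u \<in> span (range (\<lambda>j. pd j x u))" if u: "u \<in> D" for u i
  proof -
    \<comment> \<open>The gradient term contributes exactly what cancels the derivative of
      \<open>exp (- f)\<close>.\<close>
    have dv: "X u \<bullet> pd i v u = pd i f u"
    proof -
      have "pd i v u = pd i y u + (\<Sum>m. pd i (c m) u *\<^sub>R pd m x u + c m u *\<^sub>R pd i (pd m x) u)"
        unfolding v_def[abs_def] using u
        by (simp add: pd_add pd_sum pd_scaleR c_diff y_diff dx_diff)
      then have "X u \<bullet> pd i v u = (\<Sum>m. G i m u * c m u)"
        using u by (simp add: inner_add_right inner_sum_right X_dx X_dy G_eq[symmetric] G_sym[of u _ i] mult.commute)
      also have "\<dots> = pd i f u"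
        unfolding c_def by (rule delta_contract[OF GQ[OF u]])
      finally show ?thesis .
    qed
    have nf: "pd i (\<lambda>u. exp (- f u)) u = - exp (- f u) * pd i f u"
    proof -
      have "((\<lambda>t. exp (- t)) has_real_derivative (- exp (- t))) (at t)" for t :: real
        by (auto intro!: derivative_eq_intros)
      from pd_chain_real(2)[OF f[OF u] this] show ?thesis .
    qed
    have "pd i ?y u = pd i (\<lambda>u. exp (- f u)) u *\<^sub>R v u + exp (- f u) *\<^sub>R pd i v u"
      unfolding y'v by (rule pd_scaleR[OF ex(1)[OF u] v_diff[OF u]])
    then have "X u \<bullet> pd i ?y u = 0"
      unfolding nf by (simp add: inner_diff_right Xv[OF u] dv)
    from tangent_expand0[OF u this] show ?thesis
      by (metis (no_types, lifting) rangeI span_base span_scale span_sum)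
  qed
  have R1: "rel_metric x ?y differentiable at u" if u: "u \<in> D" for u
  proof (rule differentiable_cong_open[OF open_D u])
    show "exp (f w) *\<^sub>R rel_metric x y w = rel_metric x ?y w" if "w \<in> D" for w
      using R'[OF that] by simp
    show "(\<lambda>w. exp (f w) *\<^sub>R rel_metric x y w) differentiable at u"
      by (intro differentiable_scaleR ex metric_diff u)
  qed
  have R2: "pd i (rel_metric x ?y) differentiable at u" if u: "u \<in> D" for u i
  proof (rule differentiable_cong_open[OF open_D u])
    show "(exp (f w) * pd i f w) *\<^sub>R rel_metric x y w + exp (f w) *\<^sub>R pd i (rel_metric x y) w
       = pd i (rel_metric x ?y) w" if w: "w \<in> D" for w
      using pd_cong_open[OF open_D w R', where i = i] pd_scaleR[OF ex(2)[OF w] metric_diff[OF w], where i = i] ex(3)[OF w]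
      by simp
    show "(\<lambda>w. (exp (f w) * pd i f w) *\<^sub>R rel_metric x y w + exp (f w) *\<^sub>R pd i (rel_metric x y) w) differentiable at u"
      by (intro differentiable_add differentiable_scaleR differentiable_mult ex df metric_diff dmetric_diff u)
  qed
  have R3: "det (rel_metric x ?y u) \<noteq> 0" if u: "u \<in> D" for u
  proof (rule det_nonzero_if_kernel_trivial)
    fix w assume "rel_metric x ?y u *v w = 0"
    then have "rel_metric x y u *v w = 0"
      unfolding R'[OF u] by (simp flip: scaleR_matrix_vector_assoc)
    then have "matrix_inv (rel_metric x y u) *v (rel_metric x y u *v w) = 0" by simp
    then show "w = 0"
      unfolding matrix_vector_mul_assoc matrix_inv_mult[OF det_metric[OF u]] by simp
  qed
  show rf: "relative_frame D x ?y"
    by unfold_locales (fact open_D dim x_diff dx_diff ddx_diff y'_diff tang R1 R2 R3 | erule (1) ind)+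
  interpret N: relative_frame D x ?y by (rule rf)
  have dG': "pd a (\<lambda>v. rel_metric x ?y v $ b $ c) u = exp (f u) * (pd a f u * G b c u + pd a (\<lambda>v. G b c v) u)"
    if u: "u \<in> D" for u a b c
  proof -
    have "pd a (\<lambda>v. rel_metric x ?y v $ b $ c) u = pd a (\<lambda>v. exp (f v) * G b c v) u"
      by (rule pd_cong_open[OF open_D u]) (simp add: R')
    then show ?thesis
      using pd_mult[OF ex(2)[OF u] metric_nth_diff[OF u], of a b c] ex(3)[OF u] by (simp add: algebra_simps)
  qed
  show "darboux x ?y j k l u =
      exp (f u) * (A j k l u - (pd l f u * G j k u + pd j f u * G k l u + pd k f u * G l j u) / 2)"
    if u: "u \<in> D"
    unfolding N.darboux_formula[OF u] darboux_formula[OF u] dG'[OF u] X'[OF u]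
    by (simp add: field_simps)
qed

end

subsection \<open>Vanishing Darboux tensor\<close>

context relative_frame
begin

text \<open>The lowered Riemann tensor is skew in its first two indices because the metric is
  parallel and its mixed second derivatives commute.\<close>

lemma curv_antisym:
  assumes u: "u \<in> D"
  shows "(\<Sum>q. G m q u * curv q j k l u) + (\<Sum>q. G j q u * curv q m k l u) = 0"
proof -
  \<comment> \<open>Differentiating a lowered Christoffel symbol yields \<open>S + K\<close>. The
    products \<open>S\<close> are symmetric under exchange of the pairs \<open>l m\<close> and
    \<open>k j\<close>, so they cancel when \<open>l\<close> and \<open>k\<close> are interchanged;
    the difference of the \<open>K\<close> is the curvature.\<close>
  define S where "S l m k j = (\<Sum>p. \<Sum>q. \<Gamma> p l m u * (G p q u * \<Gamma> q k j u))" for l m k j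
  define K where "K l m k j = (\<Sum>q. G m q u * (pd l (\<Gamma> q j k) u + (\<Sum>p. \<Gamma> p j k u * \<Gamma> q p l u)))" for l m k j
  have S: "S l m k j = S k j l m" for l m k j
  proof -
    have "S l m k j = (\<Sum>q. \<Sum>p. \<Gamma> p l m u * (G p q u * \<Gamma> q k j u))"
      unfolding S_def by (rule sum.swap)
    then show ?thesis unfolding S_def by (simp add: G_sym[OF u] ac_simps)
  qed
  have low: "pd l (\<lambda>v. \<Sum>q. G m q v * \<Gamma> q j k v) u = S l m k j + K l m k j" for l m k j
  proof -
    have "pd l (\<lambda>v. \<Sum>q. G m q v * \<Gamma> q j k v) u
      = (\<Sum>q. pd l (\<lambda>v. G m q v) u * \<Gamma> q j k u) + (\<Sum>q. G m q u * pd l (\<Gamma> q j k) u)"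
      using u by (simp add: pd_sum pd_mult metric_nth_diff christoffel_diff sum.distrib)
    also have "(\<Sum>q. pd l (\<lambda>v. G m q v) u * \<Gamma> q j k u)
      = (\<Sum>q. \<Sum>p. \<Gamma> p l m u * (G p q u * \<Gamma> q j k u))
      + (\<Sum>q. \<Sum>p. G m p u * (\<Gamma> p l q u * \<Gamma> q j k u))"
      unfolding dG_christoffel[OF u]
      by (simp only: distrib_right sum.distrib sum_distrib_right) (simp add: ac_simps)
    also have "(\<Sum>q. \<Sum>p. \<Gamma> p l m u * (G p q u * \<Gamma> q j k u)) = S l m k j"
      unfolding S_def christoffel_sym[OF u, of _ j k] by (rule sum.swap)
    also have "(\<Sum>q. \<Sum>p. G m p u * (\<Gamma> p l q u * \<Gamma> q j k u))
       = (\<Sum>p. G m p u * (\<Sum>q. \<Gamma> q j k u * \<Gamma> p q l u))"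
      unfolding sum_distrib_left christoffel_sym[OF u, of _ l] by (subst sum.swap) (simp add: mult.commute)
    finally show ?thesis
      unfolding K_def by (simp add: distrib_left sum.distrib)
  qed
  have dd: "pd l (pd k (\<lambda>v. G j m v)) u = S l m k j + K l m k j + (S l j k m + K l j k m)" for l k
  proof -
    have "pd l (pd k (\<lambda>v. G j m v)) u = pd l (\<lambda>v. (\<Sum>q. G m q v * \<Gamma> q j k v) + (\<Sum>q. G j q v * \<Gamma> q m k v)) u"
    proof (rule pd_cong_open[OF open_D u])
      fix v assume v: "v \<in> D"
      show "pd k (\<lambda>v. G j m v) v = (\<Sum>q. G m q v * \<Gamma> q j k v) + (\<Sum>q. G j q v * \<Gamma> q m k v)"
        unfolding dG_christoffel[OF v] christoffel_sym[OF v, of _ k] G_sym[OF v, of _ m]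
        by (simp add: mult.commute)
    qed
    also have "\<dots> = pd l (\<lambda>v. \<Sum>q. G m q v * \<Gamma> q j k v) u + pd l (\<lambda>v. \<Sum>q. G j q v * \<Gamma> q m k v) u"
      by (rule pd_add) (intro differentiable_sum ballI differentiable_mult metric_nth_diff christoffel_diff u finite)+
    finally show ?thesis unfolding low .
  qed
  have c: "(\<Sum>q. G m q u * curv q j k l u) = K l m k j - K k m l j" for m j
    unfolding curv_def K_def sum_subtractf[symmetric]
    by (intro sum.cong refl) (simp add: algebra_simps)
  show ?thesis
    unfolding c using dd[of l k] dd[of k l] ddG_commute[OF u, of l k j m] S[of l m k j] S[of l j k m] by linarith
qed

text \<open>Without Darboux tensor the Gauss equation gives the curvature as
  \<open>G_jk B_l^m - G_jl B_k^m\<close>. Its skewness in the lowered indices \<open>m\<close>,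
  \<open>j\<close>, contracted with the inverse metric on \<open>k\<close>, \<open>j\<close>, leaves
  \<open>n b_lm = G_lm tr B\<close> for the lowered operator \<open>b\<close>.\<close>

lemma shape_umbilic:
  assumes u: "u \<in> D" and A0: "\<And>v j k l. v \<in> D \<Longrightarrow> A j k l v = 0"
  shows "B l q u = (if l = q then mean_curvature x y u else 0)"
proof -
  let ?n = "real CARD('n)"
  have \<A>0: "\<A> m j k v = 0" if "v \<in> D" for m j k v
    using that by (simp add: raise_darboux A0)
  then have "pd l (\<A> m j k) u = 0" for l m j k
    using pd_zero_on[OF open_D u, of "\<A> m j k"] by blast
  then have "\<D> l m j k u = 0" for l m j k
    using \<A>0[OF u] by (simp add: \<D>_def)
  then have curv: "curv m j k l u = G j k u * B l m u - G j l u * B k m u" for m j k l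
    using curvature_split[OF u, of m j k l] by (simp add: \<A>0[OF u])
  define b where "b l m = (\<Sum>q. G m q u * B l q u)" for l m
  have low: "(\<Sum>q. G m q u * curv q j k l u) = G j k u * b l m - G j l u * b k m" for m j k l
    unfolding curv b_def sum_distrib_left sum_subtractf[symmetric]
    by (intro sum.cong refl) (simp add: algebra_simps)
  have sym: "G j k u * b l m + G m k u * b l j = G j l u * b k m + G m l u * b k j" for j k l m
    using curv_antisym[OF u, of m j k l] unfolding low by simp
  have main: "?n * b l m = G m l u * (\<Sum>k. B k k u)" for l m
  proof -
    have 1: "(\<Sum>k. \<Sum>j. Q k j u * (G j k u * b l m)) = ?n * b l m"
      unfolding mult.assoc[symmetric] sum_distrib_right[symmetric] QG[OF u] by simp
    have 2: "(\<Sum>k. \<Sum>j. Q k j u * (G m k u * b l j)) = b l m"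
    proof -
      have "(\<Sum>k. \<Sum>j. Q k j u * (G m k u * b l j)) = (\<Sum>k. G m k u * (\<Sum>j. Q k j u * b l j))"
        by (simp add: sum_distrib_left mult.left_commute)
      also have "\<dots> = b l m" by (rule delta_contract[OF GQ[OF u]])
      finally show ?thesis .
    qed
    have 3: "(\<Sum>k. \<Sum>j. Q k j u * (G j l u * b k m)) = b l m"
      unfolding mult.assoc[symmetric] sum_distrib_right[symmetric] QG[OF u]
      by (simp add: if_distrib[of "\<lambda>z. z * _"] cong: if_cong)
    have 4: "(\<Sum>k. \<Sum>j. Q k j u * (G m l u * b k j)) = G m l u * (\<Sum>k. B k k u)"
    proof -
      have "(\<Sum>j. Q k j u * b k j) = B k k u" for k
        unfolding b_def by (rule delta_contract[OF QG[OF u]])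
      then show ?thesis by (simp add: mult.left_commute[of _ "G m l u"] flip: sum_distrib_left)
    qed
    have "(\<Sum>k. \<Sum>j. Q k j u * (G j k u * b l m + G m k u * b l j))
        = (\<Sum>k. \<Sum>j. Q k j u * (G j l u * b k m + G m l u * b k j))"
      unfolding sym ..
    then show ?thesis
      unfolding distrib_left sum.distrib 1 2 3 4 by simp
  qed
  have "b l m = mean_curvature x y u * G m l u" for l m
    using main[of l m] by (simp add: mean_curvature_def trace_def field_simps)
  then have "(\<Sum>m. Q q m u * b l m) = mean_curvature x y u * (\<Sum>m. Q q m u * G m l u)"
    by (simp add: sum_distrib_left mult.left_commute)
  moreover have "(\<Sum>m. Q q m u * b l m) = B l q u"
    unfolding b_def by (rule delta_contract[OF QG[OF u]])
  ultimately show ?thesis unfolding QG[OF u] by auto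
qed

text \<open>Here \<open>h\<close> is an arbitrary function. The inverse function theorem, applied to
  \<open>x\<close> followed by a projection, gives coordinates \<open>w\<close> in which
  \<open>dy = h dx\<close> reads \<open>dg = h dw\<close>, and
  \<open>conformal_factor_constant\<close> applies.\<close>

lemma proportional_differentials:
  assumes two: "CARD('n) \<ge> 2" and u: "u \<in> D"
    and h: "\<And>v l. v \<in> D \<Longrightarrow> pd l y v = h v *\<^sub>R pd l x v"
  obtains r where "r > 0" "ball u r \<subseteq> D" "\<And>v. v \<in> ball u r \<Longrightarrow> h v = h u"
proof -
  \<comment> \<open>Pairing with the tangent vectors at \<open>u\<close>: a linear map whose
    composition with \<open>dx\<close> at \<open>u\<close> is the first fundamental form, hence
    invertible.\<close>
  define P :: "'b \<Rightarrow> real^'n" where "P v = (\<chi> i. v \<bullet> pd i x u)" for v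
  have P: "bounded_linear P"
    unfolding linear_conv_bounded_linear[symmetric] P_def
    by (rule linearI) (simp_all add: vec_eq_iff inner_add_left)
  define dx where "dx v w = (\<Sum>i. w $ i *\<^sub>R pd i x v)" for v and w :: "real^'n"
  have dxl: "bounded_linear (dx v)" for v
    unfolding linear_conv_bounded_linear[symmetric] dx_def
    by (rule linearI) (simp_all add: scaleR_left_distrib sum.distrib scaleR_sum_right)
  have x': "(x has_derivative dx v) (at v)" if "v \<in> D" for v
    unfolding dx_def by (rule has_derivative_pd[OF x_diff[OF that]])
  define T' where "T' v = Blinfun (\<lambda>w. P (dx v w))" for v
  have T': "blinfun_apply (T' v) w = P (dx v w)" for v w
    unfolding T'_def
    by (subst bounded_linear_Blinfun_apply) (auto intro: bounded_linear_compose[OF P dxl])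
  let ?T = "\<lambda>v. P (x v)"
  have derT: "(?T has_derivative blinfun_apply (T' v)) (at v)" if "v \<in> D" for v
  proof -
    have "blinfun_apply (T' v) = (\<lambda>w. P (dx v w))" by (rule ext) (rule T')
    then show ?thesis using bounded_linear.has_derivative[OF P x'[OF that]] by simp
  qed
  have contT: "continuous_on D T'"
  proof (rule continuous_on_blinfun_componentwise)
    fix i :: "real^'n"
    have "continuous_on D (pd k x)" for k
      by (meson continuous_at_imp_continuous_on differentiable_imp_continuous_within dx_diff)
    then show "continuous_on D (\<lambda>v. blinfun_apply (T' v) i)"
      unfolding T' dx_def
      by (intro bounded_linear.continuous_on[OF P] continuous_intros)
  qed
  define g where "g = matrix_inv (fund1 x u)"
  have inv: "Blinfun ((*v) g) o\<^sub>L T' u = id_blinfun"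
  proof (rule blinfun_eqI)
    fix w
    have "P (dx u w) = fund1 x u *v w"
      by (simp add: vec_eq_iff P_def dx_def inner_sum_left matrix_vector_mult_def fund1_inner mult.commute fund1_sym)
    then show "blinfun_apply (Blinfun ((*v) g) o\<^sub>L T' u) w = blinfun_apply id_blinfun w"
      by (simp add: T' bounded_linear_Blinfun_apply matrix_vector_mul_bounded_linear matrix_vector_mul_assoc
          g_def matrix_inv_mult[OF det_fund1[OF u]])
  qed
  obtain U V k k' where U: "open U" "U \<subseteq> D" "u \<in> U" and V: "open V" "?T u \<in> V" and hom: "homeomorphism U V ?T k"
    and k: "\<And>w. w \<in> V \<Longrightarrow> (k has_derivative k' w) (at w)"
      "\<And>w. w \<in> V \<Longrightarrow> k' w = Hilbert_Choice.inv (blinfun_apply (T' (k w)))"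
      "\<And>w. w \<in> V \<Longrightarrow> bij (blinfun_apply (T' (k w)))"
    by (rule inverse_function_theorem[OF open_D derT contT u inv]) (assumption, rule that)
  obtain r where r: "r > 0" "ball (?T u) r \<subseteq> V" using V open_contains_ball by metis
  have kU: "k w \<in> U" if "w \<in> V" for w
    using hom that by (auto simp: homeomorphism_def)
  have const: "h (k w) = h (k (?T u))" if w: "w \<in> ball (?T u) r" for w
  proof (rule conformal_factor_constant[OF two _ w, where g = "\<lambda>w. P (y (k w))" and h = "\<lambda>w. h (k w)"])
    fix w assume "w \<in> ball (?T u) r"
    then have w: "w \<in> V" using r by blast
    then have kD: "k w \<in> D" using kU U by blast
    have y': "(y has_derivative (\<lambda>z. h (k w) *\<^sub>R dx (k w) z)) (at (k w))"
      using has_derivative_pd[OF y_diff[OF kD]]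
      by (simp add: h[OF kD] dx_def scaleR_sum_right mult.commute)
    have "((\<lambda>w. P (y (k w))) has_derivative (\<lambda>z. P (h (k w) *\<^sub>R dx (k w) (k' w z)))) (at w)"
      using bounded_linear.has_derivative[OF P has_derivative_compose[OF k(1)[OF w] y']] .
    moreover have "P (h (k w) *\<^sub>R dx (k w) (k' w z)) = h (k w) *\<^sub>R z" for z
    proof -
      have "blinfun_apply (T' (k w)) (k' w z) = z"
        unfolding k(2)[OF w] using k(3)[OF w] by (meson bij_inv_eq_iff)
      then show ?thesis
        using P T' by (simp add: linear_simps)
    qed
    ultimately show "((\<lambda>w. P (y (k w))) has_derivative (\<lambda>z. h (k w) *\<^sub>R z)) (at w)" by simp
  qed
  have "continuous_on U ?T" using hom by (auto simp: homeomorphism_def)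
  then have "open (U \<inter> ?T -` ball (?T u) r)"
    using continuous_open_preimage[OF _ U(1) open_ball] by blast
  moreover have "u \<in> U \<inter> ?T -` ball (?T u) r" using U r by simp
  ultimately obtain e where e: "e > 0" "ball u e \<subseteq> U \<inter> ?T -` ball (?T u) r"
    using open_contains_ball by metis
  show ?thesis
  proof (rule that[OF e(1)])
    show "ball u e \<subseteq> D" using e U by blast
    fix v assume "v \<in> ball u e"
    then have v: "v \<in> U" "?T v \<in> ball (?T u) r" using e by auto
    have "k (?T v) = v" "k (?T u) = u" using hom v U by (auto simp: homeomorphism_def)
    then show "h v = h u" using const[OF v(2)] by simp
  qed
qed

text \<open>The equation, evaluated at \<open>z\<close>, of the quadric that osculates the hypersurface at \<open>x u\<close>. If
  \<open>z = x u + a^i x_i + b y\<close>, its value is \<open>G_ij a^i a^j - 2 b + H b^2\<close>.\<close>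

definition osculating :: "real \<Rightarrow> 'b \<Rightarrow> real^'n \<Rightarrow> real" where
  "osculating H z u = (\<Sum>i. \<Sum>j. G i j u * (tcoef u (z - x u - (X u \<bullet> (z - x u)) *\<^sub>R y u) i *
      tcoef u (z - x u - (X u \<bullet> (z - x u)) *\<^sub>R y u) j))
    - 2 * (X u \<bullet> (z - x u)) + H * (X u \<bullet> (z - x u))\<^sup>2"

text \<open>For fixed \<open>z\<close>, differentiating \<open>z - x = a^i x_i + b y\<close> gives
  \<open>\<nabla>_l a^i = (b H - 1) \<delta>^i_l\<close> and \<open>db_l = - a_l\<close>. The
  contributions \<open>2 (b H - 1) a_l\<close>, \<open>2 a_l\<close> and \<open>- 2 H b a_l\<close>
  of the three terms add up to 0. \<open>H\<close> is a number that agrees with the mean curvature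
  at \<open>u\<close>; it is not differentiated.\<close>

lemma osculating_stationary:
  assumes u: "u \<in> D" and A0: "\<And>v j k l. v \<in> D \<Longrightarrow> A j k l v = 0"
    and H: "mean_curvature x y u = H"
  shows "osculating H z differentiable at u" "pd l (osculating H z) u = 0"
proof -
  define b where "b v = X v \<bullet> (z - x v)" for v
  define a where "a i v = tcoef v (z - x v - b v *\<^sub>R y v) i" for i v
  have b_diff: "b differentiable at u"
    unfolding b_def[abs_def] by (intro differentiable_inner_at differentiable_diff differentiable_const X_diff x_diff u)
  have a_diff: "a i differentiable at u" for i
    unfolding a_def[abs_def]
    by (intro tcoef_diff differentiable_diff differentiable_const differentiable_scaleR b_diff x_diff y_diff u)
  have osc: "osculating H z = (\<lambda>v. (\<Sum>i. \<Sum>j. G i j v * (a i v * a j v)) - 2 * b v + H * (b v * b v))"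
    unfolding osculating_def[abs_def] a_def b_def power2_eq_square ..
  show "osculating H z differentiable at u"
    unfolding osc by (intro differentiable_add differentiable_diff differentiable_sum ballI differentiable_mult
        metric_nth_diff a_diff b_diff differentiable_const u finite)
  have "\<A> m j k u = 0" for m j k using u by (simp add: raise_darboux A0)
  then have \<Theta>\<Gamma>: "\<Theta> m j k u = \<Gamma> m j k u" for m j k unfolding \<A>_def by simp
  have Bu: "B i j u = (if i = j then H else 0)" for i j
    using shape_umbilic[OF u A0, of i j] unfolding H .
  have dy: "pd l y u = - (H *\<^sub>R pd l x u)"
    unfolding shape[OF u] Bu by (simp add: if_distrib[of "\<lambda>c. c *\<^sub>R _"] cong: if_cong)
  have expand: "z - x v = (\<Sum>i. a i v *\<^sub>R pd i x v) + b v *\<^sub>R y v" if "v \<in> D" for v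
    using tangent_expand[OF that, of "z - x v"] unfolding a_def b_def .
  have "pd l (\<lambda>v. z - x v) u = pd l (\<lambda>v. (\<Sum>i. a i v *\<^sub>R pd i x v) + b v *\<^sub>R y v) u"
    by (rule pd_cong_open[OF open_D u expand])
  then have "- pd l x u = (\<Sum>i. pd l (a i) u *\<^sub>R pd i x u + a i u *\<^sub>R pd l (pd i x) u)
      + (pd l b u *\<^sub>R y u + b u *\<^sub>R pd l y u)"
    using u by (simp add: pd_add pd_diff pd_sum pd_scaleR a_diff b_diff x_diff dx_diff y_diff)
  also have "(\<Sum>i. pd l (a i) u *\<^sub>R pd i x u + a i u *\<^sub>R pd l (pd i x) u)
     = (\<Sum>m. (pd l (a m) u + (\<Sum>i. a i u * \<Gamma> m i l u)) *\<^sub>R pd m x u) + (\<Sum>i. a i u * G i l u) *\<^sub>R y u"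
    unfolding ddx_expand[OF u, of l] \<Theta>\<Gamma> scaleR_add_right scaleR_left_distrib sum.distrib scaleR_sum_right scaleR_sum_left
    by (subst (2) sum.swap) simp
  finally have "(\<Sum>m. (if m = l then - 1 + b u * H else 0) *\<^sub>R pd m x u) + 0 *\<^sub>R y u
     = (\<Sum>m. (pd l (a m) u + (\<Sum>i. a i u * \<Gamma> m i l u)) *\<^sub>R pd m x u)
       + ((\<Sum>i. a i u * G i l u) + pd l b u) *\<^sub>R y u"
    unfolding dy by (simp add: if_distrib[of "\<lambda>c. c *\<^sub>R _"] scaleR_left_distrib algebra_simps cong: if_cong)
  note co = frame_coeffs[OF u this]
  have da: "pd l (a m) u = (if m = l then - 1 + b u * H else 0) - (\<Sum>i. a i u * \<Gamma> m i l u)" for m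
    using co(1)[of m] by simp
  have db: "pd l b u = - (\<Sum>i. a i u * G i l u)"
    using co(2) by simp
  have "pd l (osculating H z) u = (\<Sum>i. \<Sum>j. pd l (\<lambda>v. G i j v) u * (a i u * a j u)
       + G i j u * (pd l (a i) u * a j u + a i u * pd l (a j) u))
     - 2 * pd l b u + H * (pd l b u * b u + b u * pd l b u)"
    unfolding osc using u
    by (simp add: pd_add pd_diff pd_sum pd_mult a_diff b_diff metric_nth_diff)
  also have "(\<Sum>i. \<Sum>j. pd l (\<lambda>v. G i j v) u * (a i u * a j u)
       + G i j u * (pd l (a i) u * a j u + a i u * pd l (a j) u))
    = 2 * (\<Sum>i. a i u * G i l u) * (- 1 + b u * H)"
  proof -
    \<comment> \<open>The Christoffel terms: the derivative of the metric contributes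
      \<open>2 E\<close>, and each of the two derivatives of \<open>a\<close> contributes
      \<open>- E\<close>.\<close>
    define E where "E = (\<Sum>i. \<Sum>j. \<Sum>p. \<Gamma> p l i u * (G p j u * (a i u * a j u)))"
    have 1: "(\<Sum>i. \<Sum>j. pd l (\<lambda>v. G i j v) u * (a i u * a j u)) = 2 * E"
    proof -
      have "(\<Sum>i. \<Sum>j. \<Sum>p. \<Gamma> p l j u * (G i p u * (a i u * a j u)))
         = (\<Sum>j. \<Sum>i. \<Sum>p. \<Gamma> p l j u * (G p i u * (a j u * a i u)))"
        by (subst sum.swap) (simp add: G_sym[OF u] mult.commute)
      then show ?thesis
        unfolding dG_christoffel[OF u] distrib_right sum.distrib sum_distrib_right E_def mult.assoc by simp
    qed
    have 2: "(\<Sum>i. \<Sum>j. G i j u * (pd l (a i) u * a j u))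
       = (\<Sum>i. a i u * G i l u) * (- 1 + b u * H) - E"
    proof -
      have "(\<Sum>i. \<Sum>j. G i j u * ((if i = l then - 1 + b u * H else 0) * a j u))
          = (\<Sum>i. if i = l then (- 1 + b u * H) * (\<Sum>j. G i j u * a j u) else 0)"
        by (intro sum.cong refl) (simp add: sum_distrib_left mult.left_commute)
      also have "\<dots> = (- 1 + b u * H) * (\<Sum>j. G l j u * a j u)" by simp
      finally have p1: "(\<Sum>i. \<Sum>j. G i j u * ((if i = l then - 1 + b u * H else 0) * a j u))
          = (\<Sum>i. a i u * G i l u) * (- 1 + b u * H)"
        by (simp add: G_sym[OF u, of l] mult.commute)
      have "(\<Sum>i. \<Sum>j. G i j u * ((\<Sum>k. a k u * \<Gamma> i k l u) * a j u))
         = (\<Sum>i. \<Sum>j. \<Sum>k. \<Gamma> i l k u * (G i j u * (a k u * a j u)))"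
        unfolding christoffel_sym[OF u, of _ _ l]
        by (simp add: sum_distrib_left sum_distrib_right ac_simps)
      also have "\<dots> = (\<Sum>i. \<Sum>k. \<Sum>j. \<Gamma> i l k u * (G i j u * (a k u * a j u)))"
        by (intro sum.cong refl sum.swap)
      also have "\<dots> = (\<Sum>k. \<Sum>i. \<Sum>j. \<Gamma> i l k u * (G i j u * (a k u * a j u)))"
        by (rule sum.swap)
      also have "\<dots> = E" unfolding E_def by (intro sum.cong refl sum.swap)
      finally show ?thesis
        unfolding da left_diff_distrib right_diff_distrib sum_subtractf p1 by simp
    qed
    have 3: "(\<Sum>i. \<Sum>j. G i j u * (a i u * pd l (a j) u))
      = (\<Sum>i. \<Sum>j. G i j u * (pd l (a i) u * a j u))"
      by (subst sum.swap) (simp add: G_sym[OF u] mult.commute)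
    show ?thesis
      unfolding sum.distrib distrib_left 1 3 2 by simp
  qed
  finally show "pd l (osculating H z) u = 0"
    unfolding db by (simp add: algebra_simps)
qed

end

subsection \<open>Quadrics through a hypersurface\<close>

definition self_adjoint :: "('b::euclidean_space \<Rightarrow> 'b) \<Rightarrow> bool" where
  "self_adjoint L \<longleftrightarrow> linear L \<and> (\<forall>v w. L v \<bullet> w = v \<bullet> L w)"

definition quadric_fun :: "('b::euclidean_space \<Rightarrow> 'b) \<Rightarrow> 'b \<Rightarrow> real \<Rightarrow> 'b \<Rightarrow> real" where
  "quadric_fun L b c z = z \<bullet> L z + 2 * (b \<bullet> z) + c"

lemma hyperquadric_iff:
  "hyperquadric Z \<longleftrightarrow> (\<exists>L b c. self_adjoint L \<and> L \<noteq> (\<lambda>v. 0) \<and> Z = {z. quadric_fun L b c z = 0})"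
  unfolding hyperquadric_def self_adjoint_def quadric_fun_def by (simp only: conj_assoc)

locale smooth_patch =
  fixes D :: "(real^'n::finite) set" and x :: "real^'n \<Rightarrow> 'b::euclidean_space"
  assumes open_D: "open D" and dim: "DIM('b) = CARD('n) + 1"
    and x_diff: "u \<in> D \<Longrightarrow> x differentiable at u"
    and dx_diff: "u \<in> D \<Longrightarrow> pd i x differentiable at u"
    and ddx_diff: "u \<in> D \<Longrightarrow> pd j (pd i x) differentiable at u"
    and immersed: "u \<in> D \<Longrightarrow> (\<Sum>i. a i *\<^sub>R pd i x u) = 0 \<Longrightarrow> a i = 0"
begin

lemma normal_frame:
  assumes u: "u \<in> D" and e: "e \<noteq> 0" "\<And>i. e \<bullet> pd i x u = 0"
    and z: "(\<Sum>i. a i *\<^sub>R pd i x u) + b *\<^sub>R e = 0"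
  shows "(\<forall>i. a i = 0) \<and> b = 0"
proof -
  have "e \<bullet> ((\<Sum>i. a i *\<^sub>R pd i x u) + b *\<^sub>R e) = b * (e \<bullet> e)"
    using e(2) by (simp add: inner_add_right inner_sum_right)
  then have "b = 0" using z e(1) by simp
  then show ?thesis using z immersed[OF u] by simp
qed

lemma normal_multiple:
  assumes u: "u \<in> D" and e: "e \<noteq> 0" "\<And>i. e \<bullet> pd i x u = 0" and v: "\<And>i. v \<bullet> pd i x u = 0"
  shows "v = ((v \<bullet> e) / (e \<bullet> e)) *\<^sub>R e"
proof -
  have "v - ((v \<bullet> e) / (e \<bullet> e)) *\<^sub>R e = 0"
    by (rule frame_orthogonal_zero[where e = "\<lambda>i. pd i x u" and y = e, OF dim normal_frame[OF u e]])
      (use e v in \<open>auto simp: inner_diff_left\<close>)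
  then show ?thesis by simp
qed

section \<open>Derivatives of a quadric equation along a patch\<close>

context
  fixes L :: "'b \<Rightarrow> 'b" and b :: 'b and c :: real and W :: "(real^'n) set"
  assumes L: "self_adjoint L" and W: "open W" "W \<subseteq> D"
    and zero: "\<And>v. v \<in> W \<Longrightarrow> quadric_fun L b c (x v) = 0"
begin

lemma L_linear: "linear L" and L_adj: "L v \<bullet> w = v \<bullet> L w"
  using L by (auto simp: self_adjoint_def)

lemma L_bounded: "bounded_linear L"
  using L_linear linear_conv_bounded_linear by blast

lemma quadric_first:
  assumes v: "v \<in> W" shows "(L (x v) + b) \<bullet> pd i x v = 0"
proof -
  have vD: "v \<in> D" using v W by auto
  have Lx: "(\<lambda>w. L (x w)) differentiable at v"
    by (rule differentiable_bounded_linear[OF L_bounded x_diff[OF vD]])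
  have "pd i (\<lambda>w. x w \<bullet> L (x w) + 2 * (b \<bullet> x w) + c) v = 0"
    by (rule pd_zero_on[OF W(1) v]) (use zero in \<open>simp add: quadric_fun_def\<close>)
  then have "pd i x v \<bullet> L (x v) + x v \<bullet> L (pd i x v) + 2 * (b \<bullet> pd i x v) = 0"
    using x_diff[OF vD] Lx
    by (simp add: pd_add pd_mult pd_inner differentiable_inner_at pd_bounded_linear[OF L_bounded])
  then show ?thesis
    by (simp add: inner_add_left L_adj inner_commute[of "pd i x v"])
qed

lemma quadric_second:
  assumes v: "v \<in> W" shows "L (pd j x v) \<bullet> pd i x v + (L (x v) + b) \<bullet> pd j (pd i x) v = 0"
proof -
  have vD: "v \<in> D" using v W by auto
  have Lx: "(\<lambda>w. L (x w) + b) differentiable at v"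
    using differentiable_bounded_linear[OF L_bounded x_diff[OF vD]] by simp
  have "pd j (\<lambda>w. (L (x w) + b) \<bullet> pd i x w) v = 0"
    by (rule pd_zero_on[OF W(1) v quadric_first])
  then show ?thesis
    using x_diff[OF vD] Lx dx_diff[OF vD]
    by (simp add: pd_inner pd_add differentiable_bounded_linear[OF L_bounded] pd_bounded_linear[OF L_bounded])
qed

lemma quadric_third:
  assumes v: "v \<in> W"
  shows "L (pd l (pd j x) v) \<bullet> pd i x v + L (pd j x v) \<bullet> pd l (pd i x) v + L (pd l x v) \<bullet> pd j (pd i x) v
    + (L (x v) + b) \<bullet> pd l (pd j (pd i x)) v = 0"
proof -
  have vD: "v \<in> D" using v W by auto
  have Lx: "(\<lambda>w. L (x w) + b) differentiable at v"
    using differentiable_bounded_linear[OF L_bounded x_diff[OF vD]] by simp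
  have Lj: "(\<lambda>w. L (pd j x w)) differentiable at v"
    by (rule differentiable_bounded_linear[OF L_bounded dx_diff[OF vD]])
  have "pd l (\<lambda>w. L (pd j x w) \<bullet> pd i x w + (L (x w) + b) \<bullet> pd j (pd i x) w) v = 0"
    by (rule pd_zero_on[OF W(1) v quadric_second])
  then show ?thesis
    using x_diff[OF vD] Lx Lj dx_diff[OF vD] ddx_diff[OF vD]
    by (simp add: pd_inner pd_add differentiable_inner_at differentiable_bounded_linear[OF L_bounded] pd_bounded_linear[OF L_bounded])
qed

text \<open>A point where the gradient \<open>L (x u) + b\<close> vanishes is a singular point of the quadric;
  the second and third derivatives of the quadric equation there force the quadric to be a double
  hyperplane, which is excluded by the second fundamental form.\<close>

lemma quadric_singular:
  assumes u: "u \<in> W" and e: "e \<noteq> 0" "\<And>i. e \<bullet> pd i x u = 0"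
    and def: "\<And>i. e \<bullet> pd i (pd i x) u \<noteq> 0"
    and N: "L (x u) + b = 0"
  shows "L = (\<lambda>v. 0)" "b = 0" "c = 0"
proof -
  have uD: "u \<in> D" using u W by auto
  have Lxx: "L (pd j x u) \<bullet> pd i x u = 0" for i j
    using quadric_second[OF u, of j i] N by simp
  define \<omega> where "\<omega> j = (L (pd j x u) \<bullet> e) / (e \<bullet> e)" for j
  have Lx: "L (pd j x u) = \<omega> j *\<^sub>R e" for j
    unfolding \<omega>_def by (rule normal_multiple[OF uD e Lxx])
  have "\<omega> i = 0" for i
  proof -
    have "L (pd i (pd i x) u) \<bullet> pd i x u = L (pd i x u) \<bullet> pd i (pd i x) u"
      using L_adj inner_commute by metis
    \<comment> \<open>By self-adjointness the three quadratic terms of the third derivative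
      coincide, and the term with the gradient is absent.\<close>
    then have "3 * (\<omega> i * (e \<bullet> pd i (pd i x) u)) = 0"
      using quadric_third[OF u, of i i i] N by (simp add: Lx)
    then show ?thesis using def[of i] by simp
  qed
  then have Lx0: "L (pd j x u) = 0" for j using Lx by simp
  define \<kappa> where "\<kappa> = (L e \<bullet> e) / (e \<bullet> e)"
  have Le: "L e = \<kappa> *\<^sub>R e"
    unfolding \<kappa>_def by (rule normal_multiple[OF uD e]) (simp add: L_adj Lx0)
  \<comment> \<open>\<open>L\<close> annihilates the tangent vectors and scales \<open>e\<close>, so
    it is \<open>\<kappa>\<close> times the projection to the normal line.\<close>
  have Lv: "L v = (\<kappa> * (v \<bullet> e) / (e \<bullet> e)) *\<^sub>R e" for v
    using normal_multiple[OF uD e, of "L v"] by (simp add: L_adj Lx0 Le)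
  have b: "b = - L (x u)" using N by (metis add_eq_0_iff2 add.commute)
  have c: "c = x u \<bullet> L (x u)"
    using zero[OF u] unfolding quadric_fun_def b by (simp add: inner_commute)
  \<comment> \<open>Otherwise the quadric is a double hyperplane, the patch lies in it, and the
    second derivatives of \<open>x\<close> are orthogonal to \<open>e\<close>.\<close>
  have \<kappa>: "\<kappa> = 0"
  proof (rule ccontr)
    assume \<kappa>: "\<kappa> \<noteq> 0"
    have on: "e \<bullet> x w = e \<bullet> x u" if w: "w \<in> W" for w
    proof -
      have "quadric_fun L b c (x w) = (x w - x u) \<bullet> L (x w - x u)"
      proof -
        have "x u \<bullet> L (x w) = x w \<bullet> L (x u)" by (metis L_adj inner_commute)
        then show ?thesis
          unfolding quadric_fun_def b c linear_diff[OF L_linear, of "x w" "x u"]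
          by (simp add: inner_diff_left inner_diff_right inner_commute[of "L (x u)"])
      qed
      then have "(\<kappa> / (e \<bullet> e)) * ((x w - x u) \<bullet> e)\<^sup>2 = 0"
        using zero[OF w] by (subst (asm) Lv) (simp add: power2_eq_square)
      then have "(x w - x u) \<bullet> e = 0" using \<kappa> e(1) by simp
      then show ?thesis by (simp add: inner_diff_right inner_commute[of _ e])
    qed
    have e1: "e \<bullet> pd i x w = 0" if w: "w \<in> W" for w i
    proof -
      have "pd i (\<lambda>w. e \<bullet> x w) w = pd i (\<lambda>w. e \<bullet> x u) w"
        by (rule pd_cong_open[OF W(1) w on])
      then show ?thesis using x_diff W(2) w by (simp add: pd_inner subset_eq)
    qed
    have "pd i (\<lambda>w. e \<bullet> pd i x w) u = 0" for i
      by (rule pd_zero_on[OF W(1) u e1])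
    then show False using dx_diff[OF uD] def by (simp add: pd_inner)
  qed
  then show "L = (\<lambda>v. 0)" using Lv by auto
  then show "b = 0" "c = 0" using b c by auto
qed

end

text \<open>Both gradients at \<open>u\<close> are nonzero multiples of \<open>e\<close>. The member
  of the pencil whose gradient at \<open>u\<close> vanishes is trivial by
  \<open>quadric_singular\<close>, so the two equations are proportional.\<close>

lemma quadric_unique:
  assumes L: "self_adjoint L" "L \<noteq> (\<lambda>v. 0)" and L': "self_adjoint L'" "L' \<noteq> (\<lambda>v. 0)"
    and W: "open W" "W \<subseteq> D" "u \<in> W"
    and z: "\<And>v. v \<in> W \<Longrightarrow> quadric_fun L b c (x v) = 0" "\<And>v. v \<in> W \<Longrightarrow> quadric_fun L' b' c' (x v) = 0"
    and e: "e \<noteq> 0" "\<And>i. e \<bullet> pd i x u = 0" "\<And>i. e \<bullet> pd i (pd i x) u \<noteq> 0"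
  shows "{z. quadric_fun L b c z = 0} = {z. quadric_fun L' b' c' z = 0}"
proof -
  have uD: "u \<in> D" using W by auto
  define k where "k = ((L (x u) + b) \<bullet> e) / (e \<bullet> e)"
  define k' where "k' = ((L' (x u) + b') \<bullet> e) / (e \<bullet> e)"
  have N: "L (x u) + b = k *\<^sub>R e"
    unfolding k_def by (rule normal_multiple[OF uD e(1,2) quadric_first[OF L(1) W(1,2) z(1) W(3)]])
  have N': "L' (x u) + b' = k' *\<^sub>R e"
    unfolding k'_def by (rule normal_multiple[OF uD e(1,2) quadric_first[OF L'(1) W(1,2) z(2) W(3)]])
  have k: "k \<noteq> 0"
    using quadric_singular(1)[OF L(1) W(1,2) z(1) W(3) e] N L(2) by auto
  have k': "k' \<noteq> 0"
    using quadric_singular(1)[OF L'(1) W(1,2) z(2) W(3) e] N' L'(2) by auto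
  define M where "M v = k' *\<^sub>R L v - k *\<^sub>R L' v" for v
  have M: "self_adjoint M"
    using L(1) L'(1) unfolding self_adjoint_def M_def
    by (auto simp: inner_diff_left inner_diff_right intro!: linear_compose_sub linear_compose_scale_right)
  have qM: "quadric_fun M (k' *\<^sub>R b - k *\<^sub>R b') (k' * c - k * c') v = k' * quadric_fun L b c v - k * quadric_fun L' b' c' v" for v
    unfolding quadric_fun_def M_def by (simp add: inner_diff_right inner_diff_left algebra_simps)
  have zM: "quadric_fun M (k' *\<^sub>R b - k *\<^sub>R b') (k' * c - k * c') (x v) = 0" if "v \<in> W" for v
    unfolding qM using z[OF that] by simp
  have NM: "M (x u) + (k' *\<^sub>R b - k *\<^sub>R b') = 0"
  proof -
    have "M (x u) + (k' *\<^sub>R b - k *\<^sub>R b') = k' *\<^sub>R (L (x u) + b) - k *\<^sub>R (L' (x u) + b')"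
      by (simp add: M_def algebra_simps)
    then show ?thesis unfolding N N' by simp
  qed
  note s = quadric_singular[OF M W(1,2) zM W(3) e NM]
  have "k' * quadric_fun L b c v = k * quadric_fun L' b' c' v" for v
    using qM[of v] s by (simp add: quadric_fun_def)
  then show ?thesis using k k' by (metis mult_eq_0_iff)
qed

end

context relative_frame
begin

text \<open>With \<open>H\<close> locally constant, the osculating equation has the same value at
  \<open>z\<close> from every nearby base point. For \<open>z = x v\<close> and base point
  \<open>v\<close> that value is 0, so all nearby points lie on the quadric that osculates at
  \<open>u\<close>.\<close>

lemma osculating_quadric:
  assumes two: "CARD('n) \<ge> 2" and u: "u \<in> D" and A0: "\<And>v j k l. v \<in> D \<Longrightarrow> A j k l v = 0"
  obtains r L b c where "r > 0" "ball u r \<subseteq> D" "self_adjoint L" "L \<noteq> (\<lambda>v. 0)"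
    "\<And>v. v \<in> ball u r \<Longrightarrow> quadric_fun L b c (x v) = 0"
proof -
  define H where "H = mean_curvature x y u"
  have "pd l y v = (- mean_curvature x y v) *\<^sub>R pd l x v" if v: "v \<in> D" for v l
  proof -
    have Bv: "B i j v = (if i = j then mean_curvature x y v else 0)" for i j
      by (rule shape_umbilic[OF v A0])
    show ?thesis unfolding shape[OF v] Bv by (simp add: if_distrib[of "\<lambda>c. c *\<^sub>R _"] cong: if_cong)
  qed
  then obtain r where r: "r > 0" "ball u r \<subseteq> D"
    "\<And>v. v \<in> ball u r \<Longrightarrow> - mean_curvature x y v = - mean_curvature x y u"
    by (rule proportional_differentials[OF two u, of "\<lambda>v. - mean_curvature x y v"]) (assumption, rule that)
  have const: "osculating H z v = osculating H z u" if v: "v \<in> ball u r" for z v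
  proof (rule has_derivative_zero_unique_connected[OF open_ball connected_ball _ v])
    show "u \<in> ball u r" using r by simp
    fix w assume w: "w \<in> ball u r"
    then have wD: "w \<in> D" using r(2) by blast
    have Hw: "mean_curvature x y w = H" using r(3)[OF w] by (simp add: H_def)
    note s = osculating_stationary(1)[OF wD A0 Hw, where z = z] osculating_stationary(2)[OF wD A0 Hw, where z = z]
    show "(osculating H z has_derivative (\<lambda>x. 0)) (at w)"
      using has_derivative_pd[OF s(1)] by (simp add: s(2))
  qed
  \<comment> \<open>Vectors representing the coefficients \<open>a^i\<close> as linear forms, so
    that the osculating equation becomes a polynomial in \<open>z\<close>.\<close>
  define p where "p i = (\<Sum>j. matrix_inv (fund1 x u) $ i $ j *\<^sub>R (pd j x u - (y u \<bullet> pd j x u) *\<^sub>R X u))" for i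
  have p: "tcoef u (w - (X u \<bullet> w) *\<^sub>R y u) i = p i \<bullet> w" for w i
    unfolding tcoef_def p_def inner_sum_left
    by (intro sum.cong refl) (simp add: inner_diff_left inner_commute[of w] algebra_simps)
  define L where "L w = (\<Sum>i. \<Sum>j. (G i j u * (p i \<bullet> w)) *\<^sub>R p j) + (H * (X u \<bullet> w)) *\<^sub>R X u" for w
  have lin: "linear L"
    unfolding L_def
    by (rule linearI)
      (simp_all add: inner_add_right distrib_left scaleR_left_distrib sum.distrib scaleR_sum_right scaleR_add_right mult.left_commute)
  have adj: "L v \<bullet> w = v \<bullet> L w" for v w
  proof -
    have "(\<Sum>i. \<Sum>j. G i j u * (p i \<bullet> v) * (p j \<bullet> w)) = (\<Sum>i. \<Sum>j. G i j u * (p i \<bullet> w) * (p j \<bullet> v))"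
      by (subst sum.swap) (simp add: G_sym[OF u] mult.commute mult.left_commute)
    then show ?thesis
      unfolding L_def by (simp add: inner_add_left inner_add_right inner_sum_left inner_sum_right inner_commute[of v] mult.commute)
  qed
  have L: "self_adjoint L" unfolding self_adjoint_def using lin adj by blast
  have osc: "osculating H z u = (z - x u) \<bullet> L (z - x u) - 2 * (X u \<bullet> (z - x u))" for z
    unfolding osculating_def p L_def
    by (simp add: inner_add_right inner_sum_right inner_commute[of "z - x u" "p _"] inner_commute[of "z - x u" "X u"]
        power2_eq_square mult.assoc)
  have "L \<noteq> (\<lambda>v. 0)"
  proof
    \<comment> \<open>On tangent vectors \<open>L\<close> reproduces the relative metric; if it were
      0, the metric would be 0 and could not have an inverse.\<close>
    assume L0: "L = (\<lambda>v. 0)"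
    have pd: "p i \<bullet> pd k x u = (if i = k then 1 else 0)" for i k
    proof -
      have "p i \<bullet> pd k x u = tcoef u (\<Sum>m. (if m = k then 1 else 0) *\<^sub>R pd m x u) i"
        using p[of "pd k x u" i] X_dx[OF u] by (simp add: if_distrib[of "\<lambda>c. c *\<^sub>R _"] cong: if_cong)
      then show ?thesis unfolding tcoef_tangent[OF u] .
    qed
    have "L (pd k x u) \<bullet> pd l x u = G k l u" for k l
      unfolding L_def using X_dx[OF u]
      by (simp add: inner_add_left inner_sum_left pd if_distrib[of "\<lambda>c. _ * c"] if_distrib[of "\<lambda>c. c * _"] cong: if_cong)
    then have "G k l u = 0" for k l unfolding L0 by simp
    then show False using GQ[OF u, of "undefined" undefined] by simp
  qed
  moreover have "quadric_fun L (- L (x u) - X u) (x u \<bullet> L (x u) + 2 * (X u \<bullet> x u)) (x v) = 0"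
    if v: "v \<in> ball u r" for v
  proof -
    have vD: "v \<in> D" using v r by blast
    have "quadric_fun L (- L (x u) - X u) (x u \<bullet> L (x u) + 2 * (X u \<bullet> x u)) (x v) = osculating H (x v) u"
      unfolding osc quadric_fun_def linear_diff[OF lin] using adj[of "x u" "x v"]
      by (simp add: inner_diff_left inner_diff_right inner_commute algebra_simps)
    also have "\<dots> = osculating H (x v) v" using const[OF v] by simp
    also have "\<dots> = 0" by (simp add: osculating_def tcoef_def)
    finally show ?thesis .
  qed
  ultimately show ?thesis using that[OF r(1,2) L] by blast
qed

text \<open>The potential of the trace, suitably scaled, provides the rescaling that removes the
  pure-trace Darboux tensor.\<close>

theorem locally_quadric:
  assumes two: "CARD('n) \<ge> 2" and u: "u \<in> D"
    and def: "\<And>v. v \<in> D \<Longrightarrow> definite_form (rel_metric x y v)"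
    and b: "\<And>v. v \<in> D \<Longrightarrow> 3 * real CARD('n) * tchebychev_norm x y v
      = (real CARD('n) - 1) * (real CARD('n) + 2) * pick x y v"
  obtains r L b c where "r > 0" "ball u r \<subseteq> D" "self_adjoint L" "L \<noteq> (\<lambda>v. 0)"
    "\<And>v. v \<in> ball u r \<Longrightarrow> quadric_fun L b c (x v) = 0"
proof -
  let ?n = "real CARD('n)"
  have n2: "?n \<ge> 2" using two by simp
  define \<tau> where "\<tau> p v = (\<Sum>m. \<A> m p m v)" for p v
  have pt: "(?n + 2) * A j k l v = \<tau> j v * G k l v + \<tau> k v * G j l v + \<tau> l v * G j k v" if "v \<in> D" for j k l v
    using darboux_pure_trace[OF that n2 def[OF that] b[OF that]] unfolding \<tau>_def .
  obtain f0 where f0: "\<And>u. u \<in> D \<Longrightarrow> f0 differentiable at u"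
    "\<And>u l. u \<in> D \<Longrightarrow> pd l f0 u = (\<Sum>m. \<A> m l m u)"
    by (rule darboux_trace_potential) (rule that)
  \<comment> \<open>The factor makes \<open>df / 2\<close> equal to the trace form divided by
    \<open>n + 2\<close>, as in \<open>pt\<close>.\<close>
  define f where "f v = 2 / (?n + 2) * f0 v" for v
  have f_diff: "f differentiable at v" if "v \<in> D" for v
    unfolding f_def[abs_def] by (intro differentiable_mult differentiable_const f0(1) that)
  have df: "pd l f v = 2 / (?n + 2) * \<tau> l v" if "v \<in> D" for l v
    unfolding f_def[abs_def] pd_mult[OF differentiable_const f0(1)[OF that]] by (simp add: f0(2)[OF that] \<tau>_def)
  have \<tau>_diff: "\<tau> l differentiable at v" if "v \<in> D" for l v
    unfolding \<tau>_def[abs_def] by (intro differentiable_sum ballI \<A>_diff that finite)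
  have df_diff: "pd l f differentiable at v" if v: "v \<in> D" for l v
    by (rule differentiable_cong_open[OF open_D v df[symmetric]], assumption)
      (intro differentiable_mult differentiable_const \<tau>_diff v)
  interpret N: relative_frame D x "renormalize f"
    by (rule renormalize(1)[OF f_diff df_diff])
  have "darboux x (renormalize f) j k l v = 0" if v: "v \<in> D" for j k l v
  proof -
    have Av: "A j k l v = (\<tau> j v * G k l v + \<tau> k v * G j l v + \<tau> l v * G j k v) / (?n + 2)"
      using pt[OF v, of j k l] n2 by (simp add: field_simps)
    have q: "(2 / m * a * a' + 2 / m * b * b' + 2 / m * c * c') / 2 = (b * b' + c * c' + a * a') / m"
      for a a' b b' c c' m :: real
      by (simp add: add_divide_distrib)
    have "A j k l v - (pd l f v * G j k v + pd j f v * G k l v + pd k f v * G l j v) / 2 = 0"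
      unfolding df[OF v] G_sym[OF v, of l j] q Av by simp
    then show ?thesis
      using renormalize(3)[OF f_diff df_diff v, of j k l] by simp
  qed
  from N.osculating_quadric[OF two u this] show ?thesis using that by blast
qed

end

subsection \<open>Hypersurfaces with definite second fundamental form\<close>

lemma definite_form_scaleR:
  fixes h :: "real^'n^'n::finite"
  assumes "definite_form h" "c \<noteq> 0"
  shows "definite_form (c *\<^sub>R h)"
proof -
  have "v \<bullet> ((c *\<^sub>R h) *v v) = c * (v \<bullet> (h *v v))" for v
    by (simp flip: scaleR_matrix_vector_assoc)
  then show ?thesis
    using assms unfolding definite_form_def
    by (cases "c > 0") (auto simp: zero_less_mult_iff mult_less_0_iff)
qed

lemma definite_form_det: "definite_form h \<Longrightarrow> det h \<noteq> 0"
  by (rule det_nonzero_if_kernel_trivial)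
    (metis definite_form_def inner_zero_right less_irrefl)

text \<open>Provides the condition on second derivatives that excludes double hyperplanes in
  \<open>quadric_singular\<close>.\<close>

lemma definite_form_diagonal: "definite_form h \<Longrightarrow> h $ i $ i \<noteq> 0"
proof -
  assume h: "definite_form h"
  have "axis i 1 \<bullet> (h *v axis i 1) = h $ i $ i"
    by (simp add: inner_axis' matrix_vector_mult_basis column_def)
  moreover have "axis i (1::real) \<noteq> 0" by (simp add: axis_eq_0_iff)
  ultimately show "h $ i $ i \<noteq> 0"
    using h unfolding definite_form_def by (metis less_irrefl)
qed

locale definite_hypersurface =
  fixes M :: "'m::{t2_space, second_countable_topology} set"
    and \<A> :: "('n::finite, 'm) param set"
    and x \<xi> :: "'m \<Rightarrow> 'b::euclidean_space"
    and r :: nat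
  assumes n: "CARD('n) \<ge> 2"
    and ambient: "DIM('b) = CARD('n) + 1"
    and r: "3 \<le> r"
    and hypersurface: "hypersurface r M \<A> x \<xi>"
    and definite: "definite_fund2 \<A> x \<xi>"
begin

abbreviation (input) dx where "dx \<phi> i \<equiv> pd i (x \<circ> \<phi>)"

lemma chart:
  assumes "(D, \<phi>) \<in> \<A>"
  shows "open D" "open (\<phi> ` D)" "\<exists>\<psi>. homeomorphism D (\<phi> ` D) \<phi> \<psi>" "\<phi> ` D \<subseteq> M"
proof -
  have om: "oriented_manifold r M \<A>" using hypersurface by (simp add: hypersurface_def)
  then have "local_param (D, \<phi>)" using assms unfolding oriented_manifold_def by blast
  then show "open D" "open (\<phi> ` D)" "\<exists>\<psi>. homeomorphism D (\<phi> ` D) \<phi> \<psi>"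
    by (auto simp: local_param_def)
  show "\<phi> ` D \<subseteq> M" using om assms unfolding oriented_manifold_def by auto
qed

lemma chart_cover:
  assumes "p \<in> M" obtains D \<phi> u where "(D, \<phi>) \<in> \<A>" "u \<in> D" "\<phi> u = p"
proof -
  have "M = (\<Union>(D, \<phi>)\<in>\<A>. \<phi> ` D)"
    using hypersurface by (simp add: hypersurface_def oriented_manifold_def)
  then show ?thesis using assms that by auto
qed

lemma x_Ck: "(D, \<phi>) \<in> \<A> \<Longrightarrow> Ck_on r (x \<circ> \<phi>) D"
  using hypersurface unfolding hypersurface_def immersion_def Ck_map_def by blast

lemma x_C3:
  assumes c: "(D, \<phi>) \<in> \<A>" and u: "u \<in> D"
  shows "x \<circ> \<phi> differentiable at u" "dx \<phi> i differentiable at u"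
    "pd j (dx \<phi> i) differentiable at u"
proof -
  have "Ck_on (Suc (Suc (Suc 0))) (x \<circ> \<phi>) D"
    by (rule Ck_on_mono[OF x_Ck[OF c]]) (use r in simp)
  then show "x \<circ> \<phi> differentiable at u" "dx \<phi> i differentiable at u"
    "pd j (dx \<phi> i) differentiable at u"
    using u by auto
qed

lemma patch:
  assumes c: "(D, \<phi>) \<in> \<A>"
  shows "smooth_patch D (x \<circ> \<phi>)"
proof (unfold_locales, goal_cases)
  case (6 u a i)
  let ?f = "frechet_derivative (x \<circ> \<phi>) (at u)"
  have inj: "inj ?f"
    using hypersurface c 6(1) unfolding hypersurface_def immersion_def by blast
  have d: "(x \<circ> \<phi> has_derivative ?f) (at u)"
    by (rule has_derivative_frechet[OF x_C3(1)[OF c 6(1)]])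
  have "?f = (\<lambda>v. \<Sum>i. v $ i *\<^sub>R dx \<phi> i u)"
    by (rule has_derivative_unique[OF d has_derivative_pd[OF x_C3(1)[OF c 6(1)]]])
  then have "?f (\<chi> i. a i) = 0" using 6(2) by simp
  then have "(\<chi> i. a i) = 0"
    using inj linear_injective_0[OF has_derivative_linear[OF d]] by blast
  then show ?case by (simp add: vec_eq_iff)
qed (use chart(1)[OF c] ambient x_C3[OF c] in auto)

lemma normal:
  assumes c: "(D, \<phi>) \<in> \<A>" and u: "u \<in> D"
  shows "\<xi> (\<phi> u) \<noteq> 0" "\<xi> (\<phi> u) \<bullet> dx \<phi> i u = 0"
    "definite_form (fund2 (x \<circ> \<phi>) (\<xi> \<circ> \<phi>) u)" "\<xi> (\<phi> u) \<bullet> pd i (dx \<phi> i) u \<noteq> 0"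
proof -
  have un: "unit_normal_field M \<A> x \<xi>" using hypersurface by (simp add: hypersurface_def)
  have "\<phi> u \<in> M" using chart(4)[OF c] u by blast
  then have "norm (\<xi> (\<phi> u)) = 1" using un by (simp add: unit_normal_field_def)
  then show "\<xi> (\<phi> u) \<noteq> 0" by auto
  show "\<xi> (\<phi> u) \<bullet> dx \<phi> i u = 0"
    using un c u unfolding unit_normal_field_def by fastforce
  show d: "definite_form (fund2 (x \<circ> \<phi>) (\<xi> \<circ> \<phi>) u)"
    using definite c u unfolding definite_fund2_def by blast
  show "\<xi> (\<phi> u) \<bullet> pd i (dx \<phi> i) u \<noteq> 0"
    using definite_form_diagonal[OF d, of i] by (simp add: fund2_def)
qed

lemma normalization_frame:
  assumes y: "normalization_of s M \<A> x \<xi> y" and s: "1 \<le> s" and c: "(D, \<phi>) \<in> \<A>"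
  shows "relative_frame D (x \<circ> \<phi>) (y \<circ> \<phi>)"
    and "u \<in> D \<Longrightarrow> definite_form (rel_metric (x \<circ> \<phi>) (y \<circ> \<phi>) u)"
proof -
  have rn: "relative_normalization s \<A> x y" and ps: "positive_support M \<xi> y" and C2: "C2_rel_metric \<A> x y"
    using y by (auto simp: normalization_of_def)
  have ind: "(\<forall>i. a i = 0) \<and> b = 0"
    if "u \<in> D" "(\<Sum>i. a i *\<^sub>R dx \<phi> i u) + b *\<^sub>R (y \<circ> \<phi>) u = 0" for u a b
  proof -
    have "\<forall>(D, \<phi>)\<in>\<A>. \<forall>u\<in>D. \<forall>a b. (\<Sum>i. a i *\<^sub>R dx \<phi> i u) + b *\<^sub>R (y \<circ> \<phi>) u = 0
               \<longrightarrow> (\<forall>i. a i = 0) \<and> b = 0"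
      using rn unfolding relative_normalization_def by blast
    from bspec[OF this c] that show ?thesis by simp
  qed
  have tang: "pd i (y \<circ> \<phi>) u \<in> span (range (\<lambda>j. dx \<phi> j u))" if "u \<in> D" for u i
  proof -
    have "\<forall>(D, \<phi>)\<in>\<A>. \<forall>u\<in>D. \<forall>i. pd i (y \<circ> \<phi>) u \<in> span (range (\<lambda>j. dx \<phi> j u))"
      using rn unfolding relative_normalization_def by blast
    from bspec[OF this c] that show ?thesis by simp
  qed
  have "Ck_on s (y \<circ> \<phi>) D"
    using rn c unfolding relative_normalization_def Ck_map_def by blast
  then have "Ck_on (Suc 0) (y \<circ> \<phi>) D" by (rule Ck_on_mono) (use s in simp)
  then have y_diff: "y \<circ> \<phi> differentiable at u" if "u \<in> D" for u using that by simp
  have "Ck_on 2 (rel_metric (x \<circ> \<phi>) (y \<circ> \<phi>)) D"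
    using C2 c unfolding C2_rel_metric_def by blast
  then have "Ck_on (Suc (Suc 0)) (rel_metric (x \<circ> \<phi>) (y \<circ> \<phi>)) D" by (simp only: numeral_2_eq_2)
  then have G: "rel_metric (x \<circ> \<phi>) (y \<circ> \<phi>) differentiable at u"
    "pd i (rel_metric (x \<circ> \<phi>) (y \<circ> \<phi>)) differentiable at u" if "u \<in> D" for u i
    using that by auto
  show def: "definite_form (rel_metric (x \<circ> \<phi>) (y \<circ> \<phi>) u)" if u: "u \<in> D" for u
  proof -
    define q where "q = \<xi> (\<phi> u) \<bullet> y (\<phi> u)"
    have q: "q > 0" using ps chart(4)[OF c] u unfolding positive_support_def q_def by blast
    have "conormal (x \<circ> \<phi>) (y \<circ> \<phi>) u = (1 / q) *\<^sub>R \<xi> (\<phi> u)"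
      by (rule conormal_eqI[OF ambient ind[OF u]]) (use normal(2)[OF c u] q in \<open>auto simp: q_def\<close>)
    then have "rel_metric (x \<circ> \<phi>) (y \<circ> \<phi>) u = (1 / q) *\<^sub>R fund2 (x \<circ> \<phi>) (\<xi> \<circ> \<phi>) u"
      by (simp add: rel_metric_def fund2_def vec_eq_iff)
    then show ?thesis using definite_form_scaleR[OF normal(3)[OF c u], of "1 / q"] q by simp
  qed
  show "relative_frame D (x \<circ> \<phi>) (y \<circ> \<phi>)"
    by unfold_locales
      (fact chart(1)[OF c] ambient x_C3[OF c] y_diff tang G definite_form_det[OF def] | erule (1) ind)+
qed

text \<open>By the Gauss equation \<open>n T - (n + 2) (H - S)\<close> and
  \<open>3 (S - H) + (n - 1) J\<close> are equal; times \<open>n - 1\<close>, either is the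
  difference of the two sides of (b).\<close>

lemma properties_equivalent:
  assumes y: "normalization_of s M \<A> x \<xi> y" and s: "1 \<le> s"
  shows "property_a \<A> x y \<longleftrightarrow> property_b \<A> x y" "property_b \<A> x y \<longleftrightarrow> property_c \<A> x y"
proof -
  let ?n = "real CARD('n)"
  let ?S = "\<lambda>\<phi> u. scalar_curvature (rel_metric (x \<circ> \<phi>) (y \<circ> \<phi>)) u"
  let ?H = "\<lambda>\<phi> u. mean_curvature (x \<circ> \<phi>) (y \<circ> \<phi>) u"
  let ?J = "\<lambda>\<phi> u. pick (x \<circ> \<phi>) (y \<circ> \<phi>) u"
  let ?T = "\<lambda>\<phi> u. tchebychev_norm (x \<circ> \<phi>) (y \<circ> \<phi>) u"
  have n2: "?n \<ge> 2" using n by simp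
  have e: "(3 * (?S \<phi> u - ?H \<phi> u) + (?n - 1) * ?J \<phi> u = 0) = (3 * ?n * ?T \<phi> u = (?n - 1) * (?n + 2) * ?J \<phi> u)"
    "(?n * ?T \<phi> u = (?n + 2) * (?H \<phi> u - ?S \<phi> u)) = (3 * ?n * ?T \<phi> u = (?n - 1) * (?n + 2) * ?J \<phi> u)"
    if c: "(D, \<phi>) \<in> \<A>" and u: "u \<in> D" for D \<phi> u
  proof -
    have "?H \<phi> u + ?J \<phi> u - ?S \<phi> u = ?n / (?n - 1) * ?T \<phi> u"
      by (rule relative_frame.theorema_egregium[OF normalization_frame(1)[OF y s c] u n2])
    then have id: "(?n - 1) * (?H \<phi> u + ?J \<phi> u - ?S \<phi> u) = ?n * ?T \<phi> u"
      using n2 by simp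
    have aux: "(P = 0) = (L = R)" if "k * P = R - L" "k \<noteq> 0" for k P L R :: real
      using that by auto
    have "(?n - 1) * (3 * (?S \<phi> u - ?H \<phi> u) + (?n - 1) * ?J \<phi> u)
        = (?n - 1) * (?n + 2) * ?J \<phi> u - 3 * ?n * ?T \<phi> u"
      unfolding mult.assoc[of 3] id[symmetric] by (simp add: algebra_simps)
    then show "(3 * (?S \<phi> u - ?H \<phi> u) + (?n - 1) * ?J \<phi> u = 0) = (3 * ?n * ?T \<phi> u = (?n - 1) * (?n + 2) * ?J \<phi> u)"
      by (rule aux) (use n2 in simp)
    have "(?n - 1) * (?n * ?T \<phi> u - (?n + 2) * (?H \<phi> u - ?S \<phi> u))
        = (?n - 1) * (?n + 2) * ?J \<phi> u - 3 * ?n * ?T \<phi> u"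
      unfolding mult.assoc[of 3] id[symmetric] by (simp add: algebra_simps)
    then show "(?n * ?T \<phi> u = (?n + 2) * (?H \<phi> u - ?S \<phi> u)) = (3 * ?n * ?T \<phi> u = (?n - 1) * (?n + 2) * ?J \<phi> u)"
      using aux[of "?n - 1" "?n * ?T \<phi> u - (?n + 2) * (?H \<phi> u - ?S \<phi> u)"] n2 by simp
  qed
  show "property_a \<A> x y \<longleftrightarrow> property_b \<A> x y"
    unfolding property_a_def property_b_def Let_def using e(1) by (auto split: prod.splits)
  show "property_b \<A> x y \<longleftrightarrow> property_c \<A> x y"
    unfolding property_c_def property_b_def Let_def using e(2) by (auto split: prod.splits)
qed

section \<open>Gluing local quadrics over the manifold\<close>

lemma chart_neighbourhood:
  assumes c: "(D, \<phi>) \<in> \<A>" and U: "open U" "U \<subseteq> D"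
  shows "open (\<phi> ` U)"
proof -
  obtain \<psi> where h: "homeomorphism D (\<phi> ` D) \<phi> \<psi>" using chart(3)[OF c] by blast
  have "openin (top_of_set (\<phi> ` D)) (\<phi> ` U)"
    by (rule homeomorphism_imp_open_map[OF h]) (use U open_subset in blast)
  then show ?thesis using chart(2)[OF c] openin_open_trans by blast
qed

lemma chart_preimage:
  assumes c: "(D, \<phi>) \<in> \<A>" and W: "open W"
  shows "open (D \<inter> \<phi> -` W)"
proof -
  obtain \<psi> where h: "homeomorphism D (\<phi> ` D) \<phi> \<psi>" using chart(3)[OF c] by blast
  then have "continuous_on D \<phi>" by (simp add: homeomorphism_def)
  then show ?thesis using continuous_open_preimage[OF _ chart(1)[OF c] W] by blast
qed

theorem quadric_if_property_b:
  assumes y: "normalization_of s M \<A> x \<xi> y" and s: "1 \<le> s" and b: "property_b \<A> x y"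
  shows "\<exists>Z. hyperquadric Z \<and> x ` M \<subseteq> Z"
proof (cases "M = {}")
  \<comment> \<open>\<open>M\<close> may be empty; any hyperquadric will do, here the equation
    \<open>z \<bullet> z = 0\<close>.\<close>
  case True
  have "hyperquadric {z :: 'b. quadric_fun (\<lambda>v. v) 0 0 z = 0}"
    unfolding hyperquadric_iff
  proof (intro exI[of _ "\<lambda>v. v"] exI[of _ 0] conjI refl)
    show "self_adjoint (\<lambda>v::'b. v)" by (simp add: self_adjoint_def linear_id[unfolded id_def])
    show "(\<lambda>v::'b. v) \<noteq> (\<lambda>v. 0)" using nonzero_Basis SOME_Basis by metis
  qed
  then show ?thesis using True by blast
next
  case False
  then obtain a where a: "a \<in> M" by blast
  \<comment> \<open>\<open>Z\<close> contains the image of a neighbourhood of \<open>p\<close>. In a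
    suitable neighbourhood of each point exactly one hyperquadric has this property at every point,
    by uniqueness.\<close>
  define germ where "germ Z p \<longleftrightarrow> (\<exists>W. open W \<and> p \<in> W \<and> x ` (W \<inter> M) \<subseteq> Z)" for Z p
  have loc: "\<exists>T Z. open T \<and> p \<in> T \<and> T \<subseteq> M \<and> hyperquadric Z \<and> x ` T \<subseteq> Z \<and>
      (\<forall>q\<in>T. \<forall>Z'. hyperquadric Z' \<and> germ Z' q \<longrightarrow> Z' = Z)" if p: "p \<in> M" for p
  proof -
    obtain D \<phi> u where c: "(D, \<phi>) \<in> \<A>" and u: "u \<in> D" and \<phi>: "\<phi> u = p"
      by (rule chart_cover[OF p])
    interpret R: relative_frame D "x \<circ> \<phi>" "y \<circ> \<phi>" by (rule normalization_frame(1)[OF y s c])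
    interpret P: smooth_patch D "x \<circ> \<phi>" by (rule patch[OF c])
    have bv: "3 * real CARD('n) * tchebychev_norm (x \<circ> \<phi>) (y \<circ> \<phi>) v
      = (real CARD('n) - 1) * (real CARD('n) + 2) * pick (x \<circ> \<phi>) (y \<circ> \<phi>) v" if "v \<in> D" for v
      using bspec[OF b[unfolded property_b_def Let_def] c] that by simp
    obtain e L bb cc where e: "e > 0" "ball u e \<subseteq> D" and L: "self_adjoint L" "L \<noteq> (\<lambda>v. 0)"
      and z: "\<And>v. v \<in> ball u e \<Longrightarrow> quadric_fun L bb cc ((x \<circ> \<phi>) v) = 0"
      by (rule R.locally_quadric[OF n u normalization_frame(2)[OF y s c] bv]) (assumption+, rule that)
    define Z where "Z = {z. quadric_fun L bb cc z = 0}"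
    show ?thesis
    proof (intro exI[of _ "\<phi> ` ball u e"] exI[of _ Z] conjI ballI allI impI)
      show "open (\<phi> ` ball u e)" by (rule chart_neighbourhood[OF c open_ball e(2)])
      show "p \<in> \<phi> ` ball u e" using \<phi> e(1) by auto
      show "\<phi> ` ball u e \<subseteq> M" using e(2) chart(4)[OF c] by blast
      show "hyperquadric Z" unfolding hyperquadric_iff Z_def using L by blast
      show "x ` \<phi> ` ball u e \<subseteq> Z" using z by (auto simp: Z_def)
      fix q Z' assume q: "q \<in> \<phi> ` ball u e" and Z': "hyperquadric Z' \<and> germ Z' q"
      obtain v where v: "v \<in> ball u e" "q = \<phi> v" using q by blast
      have vD: "v \<in> D" using v e by blast
      obtain L' b' c' where L': "self_adjoint L'" "L' \<noteq> (\<lambda>v. 0)" and Z'_def: "Z' = {z. quadric_fun L' b' c' z = 0}"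
        using Z' unfolding hyperquadric_iff by blast
      obtain W where W: "open W" "q \<in> W" "x ` (W \<inter> M) \<subseteq> Z'" using Z' unfolding germ_def by blast
      define W' where "W' = ball u e \<inter> (D \<inter> \<phi> -` W)"
      have W': "open W'" "W' \<subseteq> D" "v \<in> W'"
        using chart_preimage[OF c W(1)] v W vD by (auto simp: W'_def)
      have z': "quadric_fun L' b' c' ((x \<circ> \<phi>) w) = 0" if "w \<in> W'" for w
      proof -
        have "\<phi> w \<in> W \<inter> M" using that chart(4)[OF c] by (auto simp: W'_def)
        then show ?thesis using W(3) unfolding Z'_def by auto
      qed
      have zz: "quadric_fun L bb cc ((x \<circ> \<phi>) w) = 0" if "w \<in> W'" for w
        using z that by (simp add: W'_def)
      show "Z' = Z"
        unfolding Z_def Z'_def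
        by (rule P.quadric_unique[OF L' L W' z' zz normal(1,2,4)[OF c vD]])
    qed
  qed
  obtain T0 Z0 where T0: "open T0" "a \<in> T0" "T0 \<subseteq> M" and Z0: "hyperquadric Z0" "x ` T0 \<subseteq> Z0"
    using loc[OF a] by blast
  have "germ Z0 a" unfolding germ_def using T0 Z0 by blast
  moreover have "\<forall>Z. hyperquadric Z \<longrightarrow> (germ Z a \<longleftrightarrow> germ Z q)" if q: "q \<in> M" for q
  \<comment> \<open>Having the same quadric germs is a locally constant relation on the connected
    \<open>M\<close>, so the quadric found at \<open>a\<close> serves everywhere.\<close>
  proof (rule connected_equivalence_relation[where S = M and a = a and b = q
        and R = "\<lambda>p q. \<forall>Z. hyperquadric Z \<longrightarrow> (germ Z p \<longleftrightarrow> germ Z q)"])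
    show "connected M" using hypersurface by (simp add: hypersurface_def)
    fix p assume p: "p \<in> M"
    obtain T Z where T: "open T" "p \<in> T" "T \<subseteq> M" and Z: "hyperquadric Z" "x ` T \<subseteq> Z"
      and un: "\<forall>q\<in>T. \<forall>Z'. hyperquadric Z' \<and> germ Z' q \<longrightarrow> Z' = Z"
      using loc[OF p] by blast
    have g: "germ Z q" if "q \<in> T" for q unfolding germ_def using T Z that by blast
    show "\<exists>T. openin (top_of_set M) T \<and> p \<in> T \<and> (\<forall>q\<in>T. \<forall>Z. hyperquadric Z \<longrightarrow> (germ Z p \<longleftrightarrow> germ Z q))"
    proof (intro exI[of _ T] conjI ballI allI impI)
      show "openin (top_of_set M) T" using T open_subset by blast
      show "p \<in> T" by fact
      fix q and Z' :: "'b set" assume "q \<in> T" "hyperquadric Z'"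
      then show "germ Z' p \<longleftrightarrow> germ Z' q" using un g T(2) by metis
    qed
  qed (use a q in auto)
  ultimately have "germ Z0 q" if "q \<in> M" for q using that Z0(1) by blast
  then have "x q \<in> Z0" if "q \<in> M" for q
    using that unfolding germ_def by blast
  then show ?thesis using Z0(1) by blast
qed

theorem property_b_if_quadric:
  assumes s1: "1 \<le> s" and s: "s < r" and Z: "hyperquadric Z" "x ` M \<subseteq> Z"
  shows "\<exists>y. normalization_of s M \<A> x \<xi> y \<and> property_b \<A> x y"
proof -
  obtain L b c where L: "self_adjoint L" "L \<noteq> (\<lambda>v. 0)" and Z_def: "Z = {z. quadric_fun L b c z = 0}"
    using Z(1) unfolding hyperquadric_iff by blast
  have lin: "linear L" and adj: "L v \<bullet> w = v \<bullet> L w" for v w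
    using L(1) by (auto simp: self_adjoint_def)
  have bl: "bounded_linear L" using lin linear_conv_bounded_linear by blast
  have zM: "quadric_fun L b c (x p) = 0" if "p \<in> M" for p
    using that Z(2) unfolding Z_def by blast
  have zD: "quadric_fun L b c ((x \<circ> \<phi>) u) = 0" if "(D, \<phi>) \<in> \<A>" "u \<in> D" for D \<phi> u
    using zM chart(4)[OF that(1)] that(2) by auto
  define N where "N p = L (x p) + b" for p
  have N1: "N (\<phi> u) \<bullet> dx \<phi> i u = 0" if "(D, \<phi>) \<in> \<A>" "u \<in> D" for D \<phi> u i
    using smooth_patch.quadric_first[OF patch[OF that(1)] L(1) chart(1)[OF that(1)] subset_refl zD[OF that(1)] that(2)]
    by (simp add: N_def comp_def)
  have N2: "L (dx \<phi> j u) \<bullet> dx \<phi> i u + N (\<phi> u) \<bullet> pd j (dx \<phi> i) u = 0"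
    if "(D, \<phi>) \<in> \<A>" "u \<in> D" for D \<phi> u i j
    using smooth_patch.quadric_second[OF patch[OF that(1)] L(1) chart(1)[OF that(1)] subset_refl zD[OF that(1)] that(2)]
    by (simp add: N_def comp_def)
  have N3: "L (pd l (dx \<phi> j) u) \<bullet> dx \<phi> i u + L (dx \<phi> j u) \<bullet> pd l (dx \<phi> i) u
      + L (dx \<phi> l u) \<bullet> pd j (dx \<phi> i) u + N (\<phi> u) \<bullet> pd l (pd j (dx \<phi> i)) u = 0"
    if "(D, \<phi>) \<in> \<A>" "u \<in> D" for D \<phi> u i j l
    using smooth_patch.quadric_third[OF patch[OF that(1)] L(1) chart(1)[OF that(1)] subset_refl zD[OF that(1)] that(2)]
    by (simp add: N_def comp_def)
  have N0: "N (\<phi> u) \<noteq> 0" if "(D, \<phi>) \<in> \<A>" "u \<in> D" for D \<phi> u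
    using smooth_patch.quadric_singular(1)[OF patch[OF that(1)] L(1) chart(1)[OF that(1)] subset_refl zD[OF that(1)] that(2)
        normal(1,2,4)[OF that]] L(2)
    by (auto simp: N_def)
  \<comment> \<open>If \<open>L\<close> is invertible, \<open>- \<beta>\<close> is the centre and
    \<open>Y\<close> the position vector from it. Otherwise \<open>\<beta>\<close> spans a direction
    in the kernel, such as the axis of a paraboloid, and \<open>Y\<close> is constant.\<close>
  obtain \<alpha> \<beta> where \<alpha>\<beta>: "L \<beta> = \<alpha> *\<^sub>R b" "\<alpha> = 1 \<or> \<alpha> = 0 \<and> \<beta> \<noteq> 0"
  proof (cases "inj L")
    case True
    then have "surj L" by (rule linear_injective_imp_surjective[OF lin]) (rule refl)
    then obtain \<beta> where "L \<beta> = b" by (metis surjD)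
    then show ?thesis using that[of \<beta> 1] by simp
  next
    case False
    then obtain \<beta> where "L \<beta> = 0" "\<beta> \<noteq> 0" using linear_injective_0[OF lin] by blast
    then show ?thesis using that[of \<beta> 0] by simp
  qed
  define Y where "Y p = \<alpha> *\<^sub>R x p + \<beta>" for p
  define k where "k = b \<bullet> \<beta> - \<alpha> * c"
  have LY: "L (Y p) = \<alpha> *\<^sub>R N p" for p
    unfolding Y_def N_def linear_add[OF lin] linear_scale[OF lin] \<alpha>\<beta>(1) by (simp add: scaleR_add_right)
  have NY: "N p \<bullet> Y p = k" if p: "p \<in> M" for p
  proof -
    have 1: "L (x p) \<bullet> \<beta> = \<alpha> * (b \<bullet> x p)"
      unfolding adj \<alpha>\<beta>(1) by (simp add: inner_commute)
    have 2: "L (x p) \<bullet> x p = - 2 * (b \<bullet> x p) - c"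
      using zM[OF p] unfolding quadric_fun_def by (simp add: inner_commute)
    show ?thesis
      unfolding N_def Y_def k_def inner_add_left inner_add_right inner_scaleR_right 1 2 by (simp add: algebra_simps)
  qed
  \<comment> \<open>If \<open>Y\<close> were tangential, its coefficients would lie in the kernel of
    the second fundamental form, since \<open>L Y = \<alpha> N\<close> is normal. Definiteness gives
    \<open>Y = 0\<close>, which contradicts \<open>\<beta> \<noteq> 0\<close> or
    \<open>N \<noteq> 0\<close>.\<close>
  have \<xi>Y: "\<xi> p \<bullet> Y p \<noteq> 0" if p: "p \<in> M" for p
  proof
    assume z: "\<xi> p \<bullet> Y p = 0"
    obtain D \<phi> u where ch: "(D, \<phi>) \<in> \<A>" and u: "u \<in> D" and p: "p = \<phi> u"
      using chart_cover[OF p] by metis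
    note nrm = normal[OF ch u]
    interpret P: smooth_patch D "x \<circ> \<phi>" by (rule patch[OF ch])
    obtain a a0 where Y: "Y p = (\<Sum>i. a i *\<^sub>R dx \<phi> i u) + a0 *\<^sub>R \<xi> (\<phi> u)"
      by (rule frame_expand[where e = "\<lambda>i. dx \<phi> i u" and y = "\<xi> (\<phi> u)" and v = "Y p",
            OF ambient P.normal_frame[OF u nrm(1,2)]]) (assumption | rule that)+
    have "\<xi> p \<bullet> Y p = a0 * (\<xi> p \<bullet> \<xi> p)"
      unfolding Y using nrm(2) by (simp add: p inner_add_right inner_sum_right)
    then have a0: "a0 = 0" using z nrm(1) by (simp add: p)
    define l where "l = (N p \<bullet> \<xi> p) / (\<xi> p \<bullet> \<xi> p)"
    have N: "N p = l *\<^sub>R \<xi> p"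
      unfolding l_def p by (rule P.normal_multiple[OF u nrm(1,2) N1[OF ch u]])
    have l0: "l \<noteq> 0" using N0[OF ch u] N by (auto simp: p)
    let ?h = "fund2 (x \<circ> \<phi>) (\<xi> \<circ> \<phi>) u"
    let ?a = "\<chi> i. a i"
    have h: "l * (?h $ i $ j) = - (L (dx \<phi> j u) \<bullet> dx \<phi> i u)" for i j
      using N2[OF ch u, of j i] N unfolding p by (simp add: fund2_def)
    have tan: "dx \<phi> i u \<bullet> L (Y p) = 0" for i
      unfolding LY using N1[OF ch u] by (simp add: p inner_commute)
    have "l * (\<Sum>j. ?h $ i $ j * a j) = 0" for i
    proof -
      have "l * (\<Sum>j. ?h $ i $ j * a j) = (\<Sum>j. (l * ?h $ i $ j) * a j)"
        by (simp add: sum_distrib_left mult.assoc)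
      also have "\<dots> = - (dx \<phi> i u \<bullet> L (Y p))"
        unfolding h Y a0
        by (simp add: linear_sum[OF lin] linear_scale[OF lin] inner_sum_right sum_negf inner_commute mult.commute)
      finally show ?thesis by (simp add: tan)
    qed
    then have "?h *v ?a = 0" using l0 by (simp add: vec_eq_iff matrix_vector_mult_def)
    then have "?a = 0"
      using nrm(3) unfolding definite_form_def by (metis inner_zero_right less_irrefl)
    then have "a i = 0" for i by (simp add: vec_eq_iff)
    then have Y0: "Y p = 0" unfolding Y a0 by simp
    show False
    proof (cases "\<alpha> = 0")
      case True then show False using \<alpha>\<beta>(2) Y0 by (simp add: Y_def)
    next
      case False
      then have "\<alpha> = 1" using \<alpha>\<beta>(2) by simp
      then have "N p = 0" using LY[of p] Y0 linear_0[OF lin] by simp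
      then show False using N0[OF ch u] by (simp add: p)
    qed
  qed
  have x_cont: "continuous_on M x"
  proof (rule continuous_at_imp_continuous_on, rule ballI)
    fix p assume "p \<in> M"
    then obtain D \<phi> u where ch: "(D, \<phi>) \<in> \<A>" and u: "u \<in> D" and p: "\<phi> u = p" by (rule chart_cover)
    obtain \<psi> where h: "homeomorphism D (\<phi> ` D) \<phi> \<psi>" using chart(3)[OF ch] by blast
    have 1: "continuous_on D (x \<circ> \<phi>)"
      by (meson continuous_at_imp_continuous_on differentiable_imp_continuous_within x_C3(1)[OF ch])
    have "continuous_on (\<phi> ` D) (\<lambda>q. (x \<circ> \<phi>) (\<psi> q))"
      by (rule continuous_on_compose2[OF 1]) (use h in \<open>auto simp: homeomorphism_def\<close>)
    moreover have "(x \<circ> \<phi>) (\<psi> q) = x q" if "q \<in> \<phi> ` D" for q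
      using h that by (auto simp: homeomorphism_def)
    ultimately have "continuous_on (\<phi> ` D) x" by (metis (no_types, lifting) continuous_on_cong)
    then show "isCont x p"
      using continuous_on_eq_continuous_at[OF chart(2)[OF ch]] u p by blast
  qed
  have "continuous_on M \<xi>" using hypersurface by (simp add: hypersurface_def unit_normal_field_def)
  then have cont: "continuous_on M (\<lambda>p. \<xi> p \<bullet> Y p)"
    unfolding Y_def by (intro continuous_intros x_cont)
  have "connected ((\<lambda>p. \<xi> p \<bullet> Y p) ` M)"
    by (rule connected_continuous_image[OF cont]) (use hypersurface in \<open>simp add: hypersurface_def\<close>)
  then have int: "\<And>v w z. v \<in> (\<lambda>p. \<xi> p \<bullet> Y p) ` M \<Longrightarrow> w \<in> (\<lambda>p. \<xi> p \<bullet> Y p) ` M \<Longrightarrow> v \<le> z \<Longrightarrow> z \<le> w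
      \<Longrightarrow> z \<in> (\<lambda>p. \<xi> p \<bullet> Y p) ` M"
    unfolding connected_iff_interval by blast
  \<comment> \<open>A continuous function without zeros on the connected \<open>M\<close> has a
    constant sign; \<open>\<sigma>\<close> corrects it to make the support positive.\<close>
  obtain \<sigma> :: real where \<sigma>: "\<sigma> \<noteq> 0" "\<And>p. p \<in> M \<Longrightarrow> \<sigma> * (\<xi> p \<bullet> Y p) > 0"
  proof (cases "\<exists>p\<in>M. \<xi> p \<bullet> Y p < 0")
    case True
    then obtain p where p: "p \<in> M" "\<xi> p \<bullet> Y p < 0" by blast
    have "\<xi> q \<bullet> Y q < 0" if q: "q \<in> M" for q
    proof (rule ccontr)
      assume "\<not> \<xi> q \<bullet> Y q < 0"
      then have "0 \<in> (\<lambda>p. \<xi> p \<bullet> Y p) ` M"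
        using int[of "\<xi> p \<bullet> Y p" "\<xi> q \<bullet> Y q" 0] p q by auto
      then show False using \<xi>Y by force
    qed
    then show ?thesis using that[of "-1"] by simp
  next
    case False
    then have "\<xi> q \<bullet> Y q > 0" if "q \<in> M" for q using \<xi>Y[OF that] that by (meson linorder_neqE_linordered_idom)
    then show ?thesis using that[of 1] by simp
  qed
  define y where "y p = \<sigma> *\<^sub>R Y p" for p
  have y\<phi>: "y \<circ> \<phi> = (\<lambda>u. (\<sigma> * \<alpha>) *\<^sub>R (x \<circ> \<phi>) u + \<sigma> *\<^sub>R \<beta>)" for \<phi> :: "real^'n \<Rightarrow> 'm"
    by (rule ext) (simp add: y_def Y_def scaleR_add_right)
  have dy: "pd i (y \<circ> \<phi>) u = (\<sigma> * \<alpha>) *\<^sub>R dx \<phi> i u" if "(D, \<phi>) \<in> \<A>" "u \<in> D" for D \<phi> u i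
  proof -
    have "pd i (\<lambda>u. c *\<^sub>R f u + d) u = c *\<^sub>R pd i f u" if "f differentiable at u" for c d and f :: "real^'n \<Rightarrow> 'b"
      using that by (simp add: pd_add pd_scaleR)
    then show ?thesis unfolding y\<phi> using x_C3(1)[OF that] .
  qed
  have Ny: "N (\<phi> u) \<bullet> (y \<circ> \<phi>) u = \<sigma> * k" if "(D, \<phi>) \<in> \<A>" "u \<in> D" for D \<phi> u
    using NY[of "\<phi> u"] chart(4)[OF that(1)] that(2) by (auto simp: y_def)
  have k0: "\<sigma> * k \<noteq> 0" if ch: "(D, \<phi>) \<in> \<A>" and u: "u \<in> D" for D \<phi> u
  proof -
    interpret P: smooth_patch D "x \<circ> \<phi>" by (rule patch[OF ch])
    have p: "\<phi> u \<in> M" using chart(4)[OF ch] u by blast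
    have N: "N (\<phi> u) = ((N (\<phi> u) \<bullet> \<xi> (\<phi> u)) / (\<xi> (\<phi> u) \<bullet> \<xi> (\<phi> u))) *\<^sub>R \<xi> (\<phi> u)"
      by (rule P.normal_multiple[OF u normal(1,2)[OF ch u] N1[OF ch u]])
    then have "(N (\<phi> u) \<bullet> \<xi> (\<phi> u)) / (\<xi> (\<phi> u) \<bullet> \<xi> (\<phi> u)) \<noteq> 0"
      using N0[OF ch u] by (metis scaleR_zero_left)
    moreover have "k = ((N (\<phi> u) \<bullet> \<xi> (\<phi> u)) / (\<xi> (\<phi> u) \<bullet> \<xi> (\<phi> u))) * (\<xi> (\<phi> u) \<bullet> Y (\<phi> u))"
      using NY[OF p] by (subst (asm) N) simp
    ultimately show ?thesis using \<xi>Y[OF p] \<sigma>(1) by simp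
  qed
  have ind: "(\<forall>i. a i = 0) \<and> a0 = 0"
    if ch: "(D, \<phi>) \<in> \<A>" and u: "u \<in> D" and z: "(\<Sum>i. a i *\<^sub>R dx \<phi> i u) + a0 *\<^sub>R (y \<circ> \<phi>) u = 0" for D \<phi> u a a0
  proof -
    interpret P: smooth_patch D "x \<circ> \<phi>" by (rule patch[OF ch])
    have "N (\<phi> u) \<bullet> ((\<Sum>i. a i *\<^sub>R dx \<phi> i u) + a0 *\<^sub>R (y \<circ> \<phi>) u) = a0 * (\<sigma> * k)"
      unfolding inner_add_right inner_sum_right inner_scaleR_right N1[OF ch u] Ny[OF ch u] by simp
    then have a0: "a0 = 0" unfolding z using k0[OF ch u] by simp
    then show ?thesis using z P.immersed[OF u] by simp
  qed
  have con: "conormal (x \<circ> \<phi>) (y \<circ> \<phi>) u = (1 / (\<sigma> * k)) *\<^sub>R N (\<phi> u)"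
    if ch: "(D, \<phi>) \<in> \<A>" and u: "u \<in> D" for D \<phi> u
    by (rule conormal_eqI[OF ambient ind[OF ch u]]) (use N1[OF ch u] Ny[OF ch u] k0[OF ch u] in simp_all)
  have met: "rel_metric (x \<circ> \<phi>) (y \<circ> \<phi>) u $ i $ j = (- 1 / (\<sigma> * k)) * (L (dx \<phi> j u) \<bullet> dx \<phi> i u)"
    if ch: "(D, \<phi>) \<in> \<A>" and u: "u \<in> D" for D \<phi> u i j
  proof -
    have "N (\<phi> u) \<bullet> pd j (dx \<phi> i) u = - (L (dx \<phi> j u) \<bullet> dx \<phi> i u)"
      using N2[OF ch u, of j i] by simp
    then show ?thesis by (simp add: rel_metric_def con[OF ch u])
  qed
  have "relative_normalization s \<A> x y"
    unfolding relative_normalization_def Ck_map_def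
  proof (intro conjI ballI; clarify)
    fix D \<phi> assume ch: "(D, \<phi>) \<in> \<A>"
    show "Ck_on s (y \<circ> \<phi>) D"
      unfolding y\<phi>
      by (intro Ck_on_add[OF chart(1)[OF ch]] Ck_on_const
          Ck_on_bounded_linear[OF chart(1)[OF ch] bounded_linear_scaleR_right] Ck_on_mono[OF x_Ck[OF ch]] less_imp_le[OF s])
  next
    fix D \<phi> u assume ch: "(D, \<phi>) \<in> \<A>" "u \<in> D"
    show "(\<forall>a b. (\<Sum>i. a i *\<^sub>R dx \<phi> i u) + b *\<^sub>R (y \<circ> \<phi>) u = 0 \<longrightarrow> (\<forall>i. a i = 0) \<and> b = 0) \<and>
        (\<forall>i. pd i (y \<circ> \<phi>) u \<in> span (range (\<lambda>j. dx \<phi> j u)))"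
      unfolding dy[OF ch] using ind[OF ch] by (blast intro: span_scale span_base)
  qed
  moreover have "positive_support M \<xi> y"
    using \<sigma>(2) by (simp add: positive_support_def y_def)
  moreover have "C2_rel_metric \<A> x y"
    unfolding C2_rel_metric_def
  proof clarify
    fix D \<phi> assume ch: "(D, \<phi>) \<in> \<A>"
    note oD = chart(1)[OF ch]
    have C3: "Ck_on (Suc 2) (x \<circ> \<phi>) D" by (rule Ck_on_mono[OF x_Ck[OF ch]]) (use r in simp)
    then have dx: "Ck_on 2 (dx \<phi> i) D" for i by (simp only: Ck_on.simps)
    have "Ck_on 2 (\<lambda>u. rel_metric (x \<circ> \<phi>) (y \<circ> \<phi>) u $ i $ j) D" for i j
    proof (rule Ck_on_cong[OF oD])
      show "(- 1 / (\<sigma> * k)) *\<^sub>R (L (dx \<phi> j u) \<bullet> dx \<phi> i u) = rel_metric (x \<circ> \<phi>) (y \<circ> \<phi>) u $ i $ j"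
        if "u \<in> D" for u using met[OF ch that] by simp
      show "Ck_on 2 (\<lambda>u. (- 1 / (\<sigma> * k)) *\<^sub>R (L (dx \<phi> j u) \<bullet> dx \<phi> i u)) D"
        by (intro Ck_on_bounded_linear[OF oD bounded_linear_scaleR_right] Ck_on_inner[OF oD]
            Ck_on_bounded_linear[OF oD bl] dx)
    qed
    then show "Ck_on 2 (rel_metric (x \<circ> \<phi>) (y \<circ> \<phi>)) D"
      by (intro Ck_on_vec[OF oD])
  qed
  ultimately have y: "normalization_of s M \<A> x \<xi> y" by (simp add: normalization_of_def)
  have "darboux (x \<circ> \<phi>) (y \<circ> \<phi>) i j l u = 0" if ch: "(D, \<phi>) \<in> \<A>" and u: "u \<in> D" for D \<phi> u i j l
  proof -
    interpret R: relative_frame D "x \<circ> \<phi>" "y \<circ> \<phi>" by (rule normalization_frame(1)[OF y s1 ch])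
    let ?x = "x \<circ> \<phi>"
    let ?q = "1 / (\<sigma> * k)"
    have dG: "pd l (\<lambda>v. rel_metric ?x (y \<circ> \<phi>) v $ i $ j) u
      = - ?q * (L (pd l (pd j ?x) u) \<bullet> pd i ?x u + L (pd j ?x u) \<bullet> pd l (pd i ?x) u)" for i j l
    proof -
      have d: "(\<lambda>v. L (pd j ?x v)) differentiable at u"
        by (rule differentiable_bounded_linear[OF bl R.dx_diff[OF u]])
      have "pd l (\<lambda>v. rel_metric ?x (y \<circ> \<phi>) v $ i $ j) u = pd l (\<lambda>v. - ?q * (L (pd j ?x v) \<bullet> pd i ?x v)) u"
        by (rule pd_cong_open[OF R.open_D u]) (simp add: met[OF ch])
      also have "\<dots> = - ?q * pd l (\<lambda>v. L (pd j ?x v) \<bullet> pd i ?x v) u"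
        by (subst pd_mult) (auto intro!: differentiable_inner_at d R.dx_diff[OF u] differentiable_const)
      finally show ?thesis
        by (simp add: pd_inner d R.dx_diff[OF u] pd_bounded_linear[OF bl R.dx_diff[OF u]])
    qed
    have c: "v \<bullet> L w = L v \<bullet> w" "L v \<bullet> w = L w \<bullet> v" for v w
      using adj inner_commute by metis+
    \<comment> \<open>The third derivative of the quadric equation is a sum of three terms, and each
      metric derivative contains two of them. The cyclic sum contains each term twice, so half of it
      cancels the third derivatives in \<open>darboux_formula\<close>.\<close>
    have t: "N (\<phi> u) \<bullet> pd l (pd j (pd i ?x)) u = - (L (pd l (pd j ?x) u) \<bullet> pd i ?x u + L (pd j ?x u) \<bullet> pd l (pd i ?x) u
      + L (pd l ?x u) \<bullet> pd j (pd i ?x) u)"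
      using N3[OF ch u, of l j i] by simp
    have e: "L (pd a ?x u) \<bullet> pd d (pd f ?x) u = L (pd d (pd f ?x) u) \<bullet> pd a ?x u" for a d f by (rule c(2))
    show ?thesis
      unfolding R.darboux_formula[OF u] con[OF ch u] inner_scaleR_left t dG e
        R.ddx_commute[OF u, of l i] R.ddx_commute[OF u, of j i] R.ddx_commute[OF u, of l j]
      by (simp add: add_divide_distrib diff_divide_distrib distrib_left)
  qed
  \<comment> \<open>Both sides of (b) are 0.\<close>
  then have "property_b \<A> x y"
    unfolding property_b_def Let_def pick_def tchebychev_norm_def tchebychev_def by auto
  then show ?thesis using y by blast
qed

end

theorem proposition3p3:
  fixes M :: "'m::{t2_space, second_countable_topology} set"
    and \<A> :: "('n::finite, 'm) param set"
    and x \<xi> :: "'m \<Rightarrow> 'b::euclidean_space"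
    and r s :: nat
  assumes n: "CARD('n) \<ge> 2"
    and ambient: "DIM('b) = CARD('n) + 1"
    and regularity: "3 \<le> r" "1 \<le> s" "s < r"
    and hypersurface: "hypersurface r M \<A> x \<xi>"
    and positive: "positive_gauss_curvature \<A> x \<xi>"
    and definite: "definite_fund2 \<A> x \<xi>"
  shows "(\<forall>y. normalization_of s M \<A> x \<xi> y \<longrightarrow>
            (property_a \<A> x y \<longleftrightarrow> property_b \<A> x y) \<and>
            (property_b \<A> x y \<longleftrightarrow> property_c \<A> x y)) \<and>
         ((\<exists>Q. hyperquadric Q \<and> x ` M \<subseteq> Q) \<longleftrightarrow>
            (\<exists>y. normalization_of s M \<A> x \<xi> y \<and> property_a \<A> x y)) \<and>
         ((\<exists>Q. hyperquadric Q \<and> x ` M \<subseteq> Q) \<longleftrightarrow>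
            (\<exists>y. normalization_of s M \<A> x \<xi> y \<and> property_b \<A> x y)) \<and>
         ((\<exists>Q. hyperquadric Q \<and> x ` M \<subseteq> Q) \<longleftrightarrow>
            (\<exists>y. normalization_of s M \<A> x \<xi> y \<and> property_c \<A> x y))"
proof -
  interpret definite_hypersurface M \<A> x \<xi> r
    by unfold_locales (fact n ambient regularity(1) hypersurface definite)+
  have ab: "property_a \<A> x y \<longleftrightarrow> property_b \<A> x y" and bc: "property_b \<A> x y \<longleftrightarrow> property_c \<A> x y"
    if "normalization_of s M \<A> x \<xi> y" for y
    using properties_equivalent[OF that regularity(2)] by auto
  have "(\<exists>Q. hyperquadric Q \<and> x ` M \<subseteq> Q) \<longleftrightarrow> (\<exists>y. normalization_of s M \<A> x \<xi> y \<and> property_b \<A> x y)"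
    using quadric_if_property_b[OF _ regularity(2)] property_b_if_quadric[OF regularity(2,3)] by blast
  then show ?thesis using ab bc by blast
qed

end
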